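(* Let $\gamma>3$. Let $W$ be a nonnegative real random variable such that $\mathbb{P}(W\ge x)=O(x^{1-\gamma})$ for $x>0$ and $\nu:=\mathbb{E}W^2<1$. Let $W_1,W_2,\dots$ be i.i.d. copies of $W$, and, given these, let $G_n$ be the random simple graph on vertex set $\{1,\dots,n\}$ in which edges appear (conditionally on $(W_i)_1^n$) independently, the edge $ij$ being present with probability $$p_{ij}:=\frac{W_iW_j}{n+W_iW_j},\qquad 1\le i<j\le n .$$ Then, as $n\to\infty$, $$|\mathcal{C}_1(G_n)|=\frac{\Delta(G_n)}{1-\nu}+o_p\bigl(n^{1/(\gamma-1)}\bigr).$$
   Context: $\Delta(G_n)$ is the maximum vertex degree of $G_n$, $\mathcal{C}_1(G_n)$ is the largest component of $G_n$ (any choice if there is a tie), and $|\mathcal{C}_1(G_n)|$ is its number of vertices. The condition $\mathbb{P}(W\ge x)=O(x^{1-\gamma})$, $x>0$, means that there is a constant $C$ with $\mathbb{P}(W\ge x)\le Cx^{1-\gamma}$ for all $x>0$. $X_n=o_p(a_n)$ means $\mathbb{P}(|X_n|>\varepsilon a_n)\to0$ as $n\to\infty$ for every $\varepsilon>0$. *)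

theory Defs
  imports "HOL-Probability.Probability"
begin

text \<open>A simple graph on a vertex set \<open>V\<close> is given by its edge set, a set of two-element subsets
  of \<open>V\<close>.\<close>

definition all_edges :: "nat set \<Rightarrow> nat set set" where
  "all_edges V = {e. e \<subseteq> V \<and> card e = 2}"

definition simple_graphs :: "nat set \<Rightarrow> nat set set set" where
  "simple_graphs V = Pow (all_edges V)"

definition degree :: "nat set \<Rightarrow> nat set set \<Rightarrow> nat \<Rightarrow> nat" where
  "degree V E v = card {u \<in> V. {u, v} \<in> E}"

definition max_degree :: "nat set \<Rightarrow> nat set set \<Rightarrow> nat" where
  "max_degree V E = Max (degree V E ` V)"

definition joined :: "nat set \<Rightarrow> nat set set \<Rightarrow> (nat \<times> nat) set" where
  "joined V E = {(u, v) \<in> V \<times> V. (u, v) \<in> {(x, y). {x, y} \<in> E}\<^sup>*}"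

definition components :: "nat set \<Rightarrow> nat set set \<Rightarrow> nat set set" where
  "components V E = V // joined V E"

text \<open>Ties are broken by Hilbert choice; the cardinality does not depend on it.\<close>

definition largest_component :: "nat set \<Rightarrow> nat set set \<Rightarrow> nat set" where
  "largest_component V E = arg_max card (\<lambda>C. C \<in> components V E)"

definition cond_prob :: "'a measure \<Rightarrow> 'a measure \<Rightarrow> 'a set \<Rightarrow> 'a \<Rightarrow> real" where
  "cond_prob M F A = real_cond_exp M F (indicator A)"

definition cond_indep_events ::
    "'a measure \<Rightarrow> 'a measure \<Rightarrow> ('i \<Rightarrow> 'a set) \<Rightarrow> 'i set \<Rightarrow> bool" where
  "cond_indep_events M F A I \<longleftrightarrow>
     (\<forall>i\<in>I. A i \<in> sets M) \<and>
     (\<forall>J. J \<subseteq> I \<longrightarrow> finite J \<longrightarrow> J \<noteq> {} \<longrightarrow>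
        (AE \<omega> in M. cond_prob M F (\<Inter>j\<in>J. A j) \<omega> = (\<Prod>j\<in>J. cond_prob M F (A j) \<omega>)))"

text \<open>The \<open>\<sigma>\<close>-algebra on \<open>space M\<close> generated by \<open>W 1, \<dots>, W n\<close>.\<close>

definition weight_algebra :: "'a measure \<Rightarrow> (nat \<Rightarrow> 'a \<Rightarrow> real) \<Rightarrow> nat \<Rightarrow> 'a measure" where
  "weight_algebra M W n =
     vimage_algebra (space M) (\<lambda>\<omega>. \<lambda>i\<in>{1..n}. W i \<omega>) (Pi\<^sub>M {1..n} (\<lambda>_. borel))"

definition edge_prob :: "nat \<Rightarrow> real \<Rightarrow> real \<Rightarrow> real" where
  "edge_prob n x y = x * y / (real n + x * y)"

definition edge_event :: "'a measure \<Rightarrow> ('a \<Rightarrow> nat set set) \<Rightarrow> nat \<times> nat \<Rightarrow> 'a set" where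
  "edge_event M G = (\<lambda>(i, j). {\<omega> \<in> space M. {i, j} \<in> G \<omega>})"

definition weighted_random_graph ::
    "'a measure \<Rightarrow> (nat \<Rightarrow> 'a \<Rightarrow> real) \<Rightarrow> nat \<Rightarrow> ('a \<Rightarrow> nat set set) \<Rightarrow> bool" where
  "weighted_random_graph M W n G \<longleftrightarrow>
     G \<in> M \<rightarrow>\<^sub>M count_space (simple_graphs {1..n}) \<and>
     (\<forall>i j. 1 \<le> i \<longrightarrow> i < j \<longrightarrow> j \<le> n \<longrightarrow>
        (AE \<omega> in M. cond_prob M (weight_algebra M W n) (edge_event M G (i, j)) \<omega>
           = edge_prob n (W i \<omega>) (W j \<omega>))) \<and>
     cond_indep_events M (weight_algebra M W n) (edge_event M G) {(i, j). 1 \<le> i \<and> i < j \<and> j \<le> n}"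

definition small_o_p :: "'a measure \<Rightarrow> (nat \<Rightarrow> 'a \<Rightarrow> real) \<Rightarrow> (nat \<Rightarrow> real) \<Rightarrow> bool" where
  "small_o_p M X a \<longleftrightarrow>
     (\<forall>\<epsilon>>0. (\<lambda>n. measure M {\<omega> \<in> space M. \<bar>X n \<omega>\<bar> > \<epsilon> * a n}) \<longlonglongrightarrow> 0)"

end

theory Submission
  imports Defs "HOL-Real_Asymp.Real_Asymp"
begin

text \<open>
  Put \<open>\<alpha> = 1/(\<gamma> - 1) < 1/2\<close> and condition on the weights, which with high probability have averages
  \<open>n\<^sup>-\<^sup>1 \<Sum> W\<^sub>i\<close> and \<open>n\<^sup>-\<^sup>1 \<Sum> W\<^sub>i\<^sup>2\<close> close to \<open>\<mu> = E W\<close> and \<open>\<nu>\<close>, are all at most \<open>K n\<^sup>\<alpha>\<close>, and of which only boundedly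
  many exceed \<open>\<delta> n\<^sup>\<alpha>\<close>.  Exploring the component of a set \<open>A\<close> vertex by vertex, an induction gives
  \<open>E exp (s |C(A)|) \<le> \<Prod>\<^bsub>u\<in>A\<^esub> exp (s + x W\<^sub>u)\<close> as soon as \<open>\<Sum>\<^sub>v p\<^sub>u\<^sub>v (exp (s + x W\<^sub>v) - 1) \<le> x W\<^sub>u\<close>, which to first
  order says \<open>s \<mu> + x \<nu> \<le> x\<close>, that is \<open>x \<approx> s \<mu> / (1 - \<nu>)\<close>.

  With \<open>s\<close> of order \<open>\<plusminus> n\<^sup>-\<^sup>\<alpha>\<close> this yields, for each single vertex \<open>v\<close>, that \<open>|C(v)|\<close> is within \<open>\<epsilon> n\<^sup>\<alpha>\<close> of
  \<open>deg(v) / (1 - \<nu>)\<close> with probability close to one, which suffices for the boundedly many vertices of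
  large weight.  With \<open>s\<close> of order \<open>ln n / n\<^sup>\<alpha>\<close> it shows that the subgraph spanned by the remaining
  vertices has no component larger than \<open>\<epsilon> n\<^sup>\<alpha>\<close>, by a union bound over all \<open>n\<close> of them.
\<close>

section \<open>Independent edges and the exploration of components\<close>

text \<open>Given the weights, every expectation is a finite sum over edge sets, so measure theory
  enters only when the conditional law of the graph is identified. Size and degree of a root share
  one Laplace transform, with coefficients \<open>s\<close> and \<open>- s / (1 - \<nu>)\<close>.
  Their first-order contributions cancel even for roots of weight n^\<alpha>, for which s times the
  weight is of order one. The resulting bound \<open>exp 2\<close> does not grow with t = |s|
  n^\<alpha>, so a large t makes Markov's inequality as sharp as desired. The obstacle is the lower
  tail. For s < 0 the terms exp(...) - 1 are negative, so every vertex already used up raises the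
  drift. The exploration is therefore cut off at sqrt n vertices: far above the scale n^\<alpha>,
  yet few enough that their squared weights sum to o(n), thanks to a moment of order 2 + \<beta>. A
  component beyond the cutoff can violate the lower bound only if the degree of its root is at least
  (1 - \<nu>) sqrt n, an event excluded separately.\<close>

definition bernoulli_sum :: "'e set \<Rightarrow> ('e \<Rightarrow> real) \<Rightarrow> ('e set \<Rightarrow> real) \<Rightarrow> real" where
  "bernoulli_sum X p f = (\<Sum>E\<in>Pow X. (\<Prod>e\<in>E. p e) * (\<Prod>e\<in>X - E. 1 - p e) * f E)"

text \<open>Independence in algebraic form: expand the product of the factors
  \<open>p e * g e + (1 - p e)\<close> over subsets of \<open>X\<close>. The case
  \<open>g = 1\<close> is total mass one.\<close>

lemma bernoulli_sum_prod:
  assumes "finite X"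
  shows "bernoulli_sum X p (\<lambda>E. \<Prod>e\<in>E. g e) = (\<Prod>e\<in>X. 1 + p e * (g e - 1))"
proof -
  have "(\<Prod>e\<in>X. 1 + p e * (g e - 1)) = (\<Prod>e\<in>X. p e * g e + (1 - p e))"
    by (rule prod.cong) (auto simp: algebra_simps)
  also have "\<dots> = (\<Sum>E\<in>Pow X. (\<Prod>e\<in>E. p e * g e) * (\<Prod>e\<in>X - E. 1 - p e))"
    by (rule prod_add) (use assms in auto)
  also have "\<dots> = bernoulli_sum X p (\<lambda>E. \<Prod>e\<in>E. g e)"
    unfolding bernoulli_sum_def by (rule sum.cong) (auto simp: prod.distrib mult_ac)
  finally show ?thesis by simp
qed

lemma bernoulli_sum_const:
  assumes "finite X"
  shows "bernoulli_sum X p (\<lambda>E. c) = c"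
proof -
  have "bernoulli_sum X p (\<lambda>E. c) = c * bernoulli_sum X p (\<lambda>E. \<Prod>e\<in>E. 1)"
    unfolding bernoulli_sum_def sum_distrib_left by (rule sum.cong) auto
  then show ?thesis using bernoulli_sum_prod[OF assms, of p "\<lambda>_. 1"] by simp
qed

lemma bernoulli_sum_cong:
  assumes "\<And>E. E \<subseteq> X \<Longrightarrow> f E = g E"
  shows "bernoulli_sum X p f = bernoulli_sum X p g"
  unfolding bernoulli_sum_def by (rule sum.cong) (auto simp: assms)

lemma bernoulli_sum_cmult: "bernoulli_sum X p (\<lambda>E. c * f E) = c * bernoulli_sum X p f"
  unfolding bernoulli_sum_def sum_distrib_left by (rule sum.cong) auto

lemma bernoulli_sum_sum:
  "bernoulli_sum X p (\<lambda>E. \<Sum>i\<in>I. f i E) = (\<Sum>i\<in>I. bernoulli_sum X p (f i))"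
  unfolding bernoulli_sum_def sum_distrib_left by (rule sum.swap)

lemma bernoulli_sum_add:
  "bernoulli_sum X p (\<lambda>E. f E + g E) = bernoulli_sum X p f + bernoulli_sum X p g"
  unfolding bernoulli_sum_def by (simp add: algebra_simps sum.distrib)

lemma bernoulli_sum_mono:
  assumes "\<And>e. e \<in> X \<Longrightarrow> 0 \<le> p e \<and> p e \<le> 1" "\<And>E. E \<subseteq> X \<Longrightarrow> f E \<le> g E"
  shows "bernoulli_sum X p f \<le> bernoulli_sum X p g"
  unfolding bernoulli_sum_def
proof (rule sum_mono)
  fix E assume E: "E \<in> Pow X"
  have "0 \<le> (\<Prod>e\<in>E. p e)" "0 \<le> (\<Prod>e\<in>X - E. 1 - p e)"
    using E assms(1) by (auto intro!: prod_nonneg)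
  then show "(\<Prod>e\<in>E. p e) * (\<Prod>e\<in>X - E. 1 - p e) * f E
      \<le> (\<Prod>e\<in>E. p e) * (\<Prod>e\<in>X - E. 1 - p e) * g E"
    using assms(2) E by (intro mult_left_mono) auto
qed

text \<open>Fubini for two independent blocks of edges: a subset of the union corresponds to the
  pair of its traces, and its weight factorises accordingly.\<close>

lemma bernoulli_sum_Un:
  assumes "finite X" "finite Y" "X \<inter> Y = {}"
  shows "bernoulli_sum (X \<union> Y) p f
    = bernoulli_sum X p (\<lambda>E. bernoulli_sum Y p (\<lambda>F. f (E \<union> F)))"
proof -
  have "bernoulli_sum (X \<union> Y) p f =
     (\<Sum>(E, F)\<in>Pow X \<times> Pow Y. (\<Prod>e\<in>E \<union> F. p e) * (\<Prod>e\<in>X \<union> Y - (E \<union> F). 1 - p e) * f (E \<union> F))"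
    unfolding bernoulli_sum_def
    by (rule sum.reindex_bij_witness[of _ "\<lambda>(E, F). E \<union> F" "\<lambda>E. (E \<inter> X, E \<inter> Y)"])
       (use assms(3) in \<open>auto simp: Int_Un_distrib[symmetric] Int_absorb2\<close>)
  also have "\<dots> = (\<Sum>(E, F)\<in>Pow X \<times> Pow Y. ((\<Prod>e\<in>E. p e) * (\<Prod>e\<in>X - E. 1 - p e)) *
      ((\<Prod>e\<in>F. p e) * (\<Prod>e\<in>Y - F. 1 - p e) * f (E \<union> F)))"
  proof (rule sum.cong, simp, clarify)
    fix E F assume EF: "E \<subseteq> X" "F \<subseteq> Y"
    have 1: "(\<Prod>e\<in>E \<union> F. p e) = (\<Prod>e\<in>E. p e) * (\<Prod>e\<in>F. p e)"
      by (rule prod.union_disjoint) (use EF assms in \<open>auto intro: finite_subset\<close>)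
    have "X \<union> Y - (E \<union> F) = (X - E) \<union> (Y - F)" using EF assms by auto
    then have 2: "(\<Prod>e\<in>X \<union> Y - (E \<union> F). 1 - p e) = (\<Prod>e\<in>X - E. 1 - p e) * (\<Prod>e\<in>Y - F. 1 - p e)"
      by (simp, intro prod.union_disjoint) (use EF assms in \<open>auto intro: finite_subset\<close>)
    show "(\<Prod>e\<in>E \<union> F. p e) * (\<Prod>e\<in>X \<union> Y - (E \<union> F). 1 - p e) * f (E \<union> F) =
       ((\<Prod>e\<in>E. p e) * (\<Prod>e\<in>X - E. 1 - p e)) *
      ((\<Prod>e\<in>F. p e) * (\<Prod>e\<in>Y - F. 1 - p e) * f (E \<union> F))"
      unfolding 1 2 by (simp add: mult_ac)
  qed
  also have "\<dots> = bernoulli_sum X p (\<lambda>E. bernoulli_sum Y p (\<lambda>F. f (E \<union> F)))"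
    unfolding bernoulli_sum_def sum_distrib_left by (simp add: sum.cartesian_product)
  finally show ?thesis .
qed

lemma bernoulli_sum_image:
  assumes "inj_on h X"
  shows "bernoulli_sum (h ` X) p f = bernoulli_sum X (\<lambda>e. p (h e)) (\<lambda>E. f (h ` E))"
proof -
  have "bernoulli_sum (h ` X) p f =
    (\<Sum>E\<in>Pow X. (\<Prod>e\<in>h ` E. p e) * (\<Prod>e\<in>h ` X - h ` E. 1 - p e) * f (h ` E))"
    unfolding bernoulli_sum_def
    by (subst image_Pow_surj[of h X "h ` X", symmetric], simp,
        subst sum.reindex[OF inj_on_image_Pow[OF assms]]) simp
  also have "\<dots> = bernoulli_sum X (\<lambda>e. p (h e)) (\<lambda>E. f (h ` E))"
    unfolding bernoulli_sum_def
  proof (rule sum.cong, simp)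
    fix E assume E: "E \<in> Pow X"
    then have "h ` X - h ` E = h ` (X - E)" "inj_on h E" "inj_on h (X - E)"
      using assms by (auto simp: inj_on_def)
    then show "(\<Prod>e\<in>h ` E. p e) * (\<Prod>e\<in>h ` X - h ` E. 1 - p e) * f (h ` E) =
         (\<Prod>e\<in>E. p (h e)) * (\<Prod>e\<in>X - E. 1 - p (h e)) * f (h ` E)"
      by (simp add: prod.reindex)
  qed
  finally show ?thesis .
qed

text \<open>Marginal law: the edges outside \<open>X\<close> integrate to one. It serves to pass to
  the subgraph spanned by the light vertices.\<close>

lemma bernoulli_sum_subset:
  assumes "finite Y" "X \<subseteq> Y"
  shows "bernoulli_sum Y p (\<lambda>E. f (E \<inter> X)) = bernoulli_sum X p f"
proof -
  have "bernoulli_sum (X \<union> (Y - X)) p (\<lambda>E. f (E \<inter> X))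
    = bernoulli_sum X p (\<lambda>E. bernoulli_sum (Y - X) p (\<lambda>F. f ((E \<union> F) \<inter> X)))"
    by (rule bernoulli_sum_Un) (use assms in \<open>auto intro: finite_subset\<close>)
  also have "\<dots> = bernoulli_sum X p (\<lambda>E. bernoulli_sum (Y - X) p (\<lambda>F. f E))"
  proof (intro bernoulli_sum_cong)
    fix E F assume "E \<subseteq> X" "F \<subseteq> Y - X"
    then have "(E \<union> F) \<inter> X = E" by auto
    then show "f ((E \<union> F) \<inter> X) = f E" by simp
  qed
  also have "\<dots> = bernoulli_sum X p f"
    using assms by (simp add: bernoulli_sum_const)
  finally show ?thesis using assms by (simp add: Un_absorb1)
qed

section \<open>Edge sets and the removal of a vertex\<close>

lemma finite_all_edges: "finite V \<Longrightarrow> finite (all_edges V)"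
  unfolding all_edges_def by (rule finite_subset[of _ "Pow V"]) auto

lemma all_edges_mono: "U \<subseteq> V \<Longrightarrow> all_edges U \<subseteq> all_edges V"
  unfolding all_edges_def by auto

lemma all_edges_remove:
  assumes "u \<in> V"
  shows "all_edges V = all_edges (V - {u}) \<union> (\<lambda>v. {u, v}) ` (V - {u})"
proof
  show "all_edges V \<subseteq> all_edges (V - {u}) \<union> (\<lambda>v. {u, v}) ` (V - {u})"
  proof
    fix e assume e: "e \<in> all_edges V"
    then obtain x y where xy: "e = {x, y}" "x \<noteq> y" "x \<in> V" "y \<in> V"
      by (auto simp: all_edges_def card_2_iff)
    show "e \<in> all_edges (V - {u}) \<union> (\<lambda>v. {u, v}) ` (V - {u})"
    proof (cases "u \<in> e")
      case True
      then have "e = {u, if x = u then y else x}" "(if x = u then y else x) \<in> V - {u}"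
        using xy by auto
      then show ?thesis by blast
    next
      case False
      then show ?thesis using e by (auto simp: all_edges_def)
    qed
  qed
qed (use assms in \<open>auto simp: all_edges_def\<close>)

text \<open>One exploration step: the neighbourhood \<open>B\<close> of \<open>u\<close> is
  independent of the graph on the other vertices, and its edges are indexed by their far
  endpoints.\<close>

lemma bernoulli_sum_remove_vertex:
  assumes "finite V" "u \<in> V"
  shows "bernoulli_sum (all_edges V) p f =
    bernoulli_sum (V - {u}) (\<lambda>v. p {u, v})
      (\<lambda>B. bernoulli_sum (all_edges (V - {u})) p (\<lambda>E. f (E \<union> (\<lambda>v. {u, v}) ` B)))"
proof -
  have inj: "inj_on (\<lambda>v. {u, v}) (V - {u})" by (auto simp: inj_on_def doubleton_eq_iff)
  have "bernoulli_sum ((\<lambda>v. {u, v}) ` (V - {u}) \<union> all_edges (V - {u})) p f =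
    bernoulli_sum ((\<lambda>v. {u, v}) ` (V - {u})) p (\<lambda>F. bernoulli_sum (all_edges (V - {u})) p (\<lambda>E. f (F \<union> E)))"
    by (rule bernoulli_sum_Un) (use assms in \<open>auto simp: finite_all_edges all_edges_def\<close>)
  then show ?thesis
    unfolding bernoulli_sum_image[OF inj] using all_edges_remove[OF assms(2)]
    by (simp add: Un_commute)
qed

section \<open>Vertices reachable from a set\<close>

definition reach :: "'v set set \<Rightarrow> 'v set \<Rightarrow> 'v set" where
  "reach E A = {v. \<exists>a\<in>A. (a, v) \<in> {(x, y). {x, y} \<in> E}\<^sup>*}"

lemma subset_reach: "A \<subseteq> reach E A"
  unfolding reach_def by auto

lemma reach_empty [simp]: "reach E {} = {}"
  unfolding reach_def by auto

lemma reach_step: "v \<in> reach E A \<Longrightarrow> {v, z} \<in> E \<Longrightarrow> z \<in> reach E A"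
  unfolding reach_def by (auto intro: rtrancl.rtrancl_into_rtrancl)

lemma reach_least:
  assumes "A \<subseteq> C" "\<And>v z. v \<in> C \<Longrightarrow> {v, z} \<in> E \<Longrightarrow> z \<in> C"
  shows "reach E A \<subseteq> C"
proof
  fix v assume "v \<in> reach E A"
  then obtain a where a: "a \<in> A" and "(a, v) \<in> {(x, y). {x, y} \<in> E}\<^sup>*"
    unfolding reach_def by auto
  from this(2) show "v \<in> C"
    by (induction rule: rtrancl_induct) (use assms a in auto)
qed

lemma reach_subset:
  assumes "E \<subseteq> all_edges V" "A \<subseteq> V"
  shows "reach E A \<subseteq> V"
  by (rule reach_least) (use assms in \<open>auto simp: all_edges_def\<close>)

text \<open>Exploring \<open>u\<close> trades it for its neighbours \<open>B\<close> in the graph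
  without \<open>u\<close>. Since the vertex set shrinks, later steps use only fresh edges. This is
  why \<open>reach\<close> starts from a set: the frontier is no longer a single vertex after one
  step.\<close>

lemma reach_explore:
  assumes E: "E \<subseteq> all_edges (V - {u})" and B: "B \<subseteq> V - {u}" and u: "u \<in> A"
  shows "reach (E \<union> (\<lambda>v. {u, v}) ` B) A = insert u (reach E (A - {u} \<union> B))"
    (is "reach ?F A = _")
proof
  show "reach ?F A \<subseteq> insert u (reach E (A - {u} \<union> B))"
  proof (rule reach_least)
    show "A \<subseteq> insert u (reach E (A - {u} \<union> B))"
      using subset_reach[of "A - {u} \<union> B" E] by auto
    fix v z assume v: "v \<in> insert u (reach E (A - {u} \<union> B))" and vz: "{v, z} \<in> ?F"
    consider "{v, z} \<in> E" | "{v, z} \<in> (\<lambda>v. {u, v}) ` B" using vz by auto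
    then show "z \<in> insert u (reach E (A - {u} \<union> B))"
    proof cases
      case 1
      then have "v \<noteq> u" using E by (auto simp: all_edges_def)
      then show ?thesis using v 1 reach_step by fast
    next
      case 2
      then have "z = u \<or> z \<in> B" by (auto simp: doubleton_eq_iff)
      then show ?thesis using subset_reach[of "A - {u} \<union> B" E] by auto
    qed
  qed
  have "u \<in> reach ?F A" using u subset_reach by fast
  moreover have "reach E (A - {u} \<union> B) \<subseteq> reach ?F A"
  proof (rule reach_least)
    show "A - {u} \<union> B \<subseteq> reach ?F A"
      using subset_reach[of A ?F] reach_step[OF \<open>u \<in> reach ?F A\<close>] by auto
  qed (use reach_step in fast)
  ultimately show "insert u (reach E (A - {u} \<union> B)) \<subseteq> reach ?F A" by simp
qed

section \<open>Laplace bounds for explored components\<close>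

lemma prod_one_plus_le_exp:
  fixes f :: "'a \<Rightarrow> real"
  assumes "\<And>a. a \<in> A \<Longrightarrow> 0 \<le> 1 + f a"
  shows "(\<Prod>a\<in>A. 1 + f a) \<le> exp (\<Sum>a\<in>A. f a)"
proof (cases "finite A")
  case True
  have "(\<Prod>a\<in>A. 1 + f a) \<le> (\<Prod>a\<in>A. exp (f a))"
    by (rule prod_mono) (use assms in \<open>auto simp: exp_ge_add_one_self\<close>)
  then show ?thesis using True by (simp add: exp_sum)
qed simp

text \<open>Vertices of \<open>A\<close> are explored one at a time; the budget \<open>b\<close> bounds how many vertices can
  be used up, so that the neighbours of the vertex being explored always range over a set \<open>U\<close> that
  misses at most \<open>M\<close> vertices.  Negative \<open>s\<close> gives lower tails; there the
  sums over \<open>U\<close> must not lose too many terms.\<close>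

lemma exploration_bound:
  fixes p :: "nat set \<Rightarrow> real" and w :: "nat \<Rightarrow> real" and s x :: real
  assumes fin: "finite V0"
    and p01: "\<And>e. e \<in> all_edges V0 \<Longrightarrow> 0 \<le> p e \<and> p e \<le> 1"
    and drift: "\<And>u U. u \<in> V0 \<Longrightarrow> U \<subseteq> V0 \<Longrightarrow> card (V0 - U) \<le> M
        \<Longrightarrow> (\<Sum>v\<in>U. p {u, v} * (exp (s + x * w v) - 1)) \<le> x * w u"
    and "V \<subseteq> V0" "A \<subseteq> V" "card (V0 - V) + b \<le> M"
  shows "bernoulli_sum (all_edges V) p
      (\<lambda>E. if card (reach E A) \<le> b then exp (s * card (reach E A)) else 0)
    \<le> (\<Prod>u\<in>A. exp (s + x * w u))"
  using assms(4-6)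
proof (induction b arbitrary: V A)
  case (0 V A)
  have finV: "finite V" using 0 fin finite_subset by blast
  show ?case
  proof (cases "A = {}")
    case True
    then show ?thesis by (simp add: bernoulli_sum_const finite_all_edges finV)
  next
    case False
    have "bernoulli_sum (all_edges V) p
      (\<lambda>E. if card (reach E A) \<le> 0 then exp (s * card (reach E A)) else 0)
      = bernoulli_sum (all_edges V) p (\<lambda>E. 0)"
    proof (rule bernoulli_sum_cong)
      fix E assume "E \<subseteq> all_edges V"
      then have "finite (reach E A)" using reach_subset[of E V A] 0 finV finite_subset by blast
      moreover have "reach E A \<noteq> {}" using False subset_reach[of A E] by auto
      ultimately show "(if card (reach E A) \<le> 0 then exp (s * card (reach E A)) else 0) = 0"
        by simp
    qed
    then show ?thesis by (simp add: bernoulli_sum_const finite_all_edges finV prod_nonneg)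
  qed
next
  case (Suc b V A)
  have finV: "finite V" using Suc.prems fin finite_subset by blast
  let ?f = "\<lambda>b A E. if card (reach E A) \<le> b then exp (s * card (reach E A)) else 0"
  let ?g = "\<lambda>u. exp (s + x * w u)"
  consider "A = {}" | "card A > Suc b" | "A \<noteq> {}" "card A \<le> Suc b" by linarith
  then show ?case
  proof cases
    case 1
    then show ?thesis by (simp add: bernoulli_sum_const finite_all_edges finV)
  next
    \<comment> \<open>The starting set alone exceeds the budget, so the truncated integrand
      vanishes.\<close>
    case 2
    have "bernoulli_sum (all_edges V) p (?f (Suc b) A) = bernoulli_sum (all_edges V) p (\<lambda>E. 0)"
    proof (rule bernoulli_sum_cong)
      fix E assume "E \<subseteq> all_edges V"
      then have "finite (reach E A)" using reach_subset[of E V A] Suc finV finite_subset by blast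
      then have "card A \<le> card (reach E A)" using subset_reach[of A E] by (rule card_mono)
      then show "?f (Suc b) A E = 0" using 2 by simp
    qed
    then show ?thesis by (simp add: bernoulli_sum_const finite_all_edges finV prod_nonneg)
  next
    case 3
    then obtain u where u: "u \<in> A" by auto
    then have uV: "u \<in> V" "u \<in> V0" using Suc.prems by auto
    have finA: "finite A" using Suc.prems finV finite_subset by blast
    have q01: "0 \<le> p {u, v} \<and> p {u, v} \<le> 1" if "v \<in> V - {u}" for v
      by (rule p01) (use that uV Suc.prems in \<open>auto simp: all_edges_def\<close>)
    have "bernoulli_sum (all_edges V) p (?f (Suc b) A) =
      bernoulli_sum (V - {u}) (\<lambda>v. p {u, v}) (\<lambda>B. bernoulli_sum (all_edges (V - {u})) p
        (\<lambda>E. ?f (Suc b) A (E \<union> (\<lambda>v. {u, v}) ` B)))"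
      by (rule bernoulli_sum_remove_vertex[OF finV uV(1)])
    \<comment> \<open>Removing \<open>u\<close> costs one factor \<open>exp s\<close> and one unit
      of budget, which puts the induction hypothesis within reach.\<close>
    also have "\<dots> = bernoulli_sum (V - {u}) (\<lambda>v. p {u, v}) (\<lambda>B. bernoulli_sum (all_edges (V - {u})) p
        (\<lambda>E. exp s * ?f b (A - {u} \<union> B) E))"
    proof (intro bernoulli_sum_cong)
      fix B E assume BE: "B \<subseteq> V - {u}" "E \<subseteq> all_edges (V - {u})"
      have sub: "reach E (A - {u} \<union> B) \<subseteq> V - {u}"
        by (rule reach_subset) (use BE Suc.prems in auto)
      then have "finite (reach E (A - {u} \<union> B))" "u \<notin> reach E (A - {u} \<union> B)"
        using finV finite_subset by auto
      then show "?f (Suc b) A (E \<union> (\<lambda>v. {u, v}) ` B) = exp s * ?f b (A - {u} \<union> B) E"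
        unfolding reach_explore[OF BE(2,1) u]
        by (simp add: algebra_simps exp_add)
    qed
    also have "\<dots> \<le> bernoulli_sum (V - {u}) (\<lambda>v. p {u, v})
        (\<lambda>B. exp s * (\<Prod>v\<in>A - {u} \<union> B. ?g v))"
    proof (rule bernoulli_sum_mono)
      fix B assume B: "B \<subseteq> V - {u}"
      have "V0 - (V - {u}) = insert u (V0 - V)" using uV by auto
      then have "card (V0 - (V - {u})) = Suc (card (V0 - V))" using fin uV by simp
      then have "bernoulli_sum (all_edges (V - {u})) p (?f b (A - {u} \<union> B)) \<le> (\<Prod>v\<in>A - {u} \<union> B. ?g v)"
        by (intro Suc.IH) (use B Suc.prems in auto)
      then show "bernoulli_sum (all_edges (V - {u})) p (\<lambda>E. exp s * ?f b (A - {u} \<union> B) E)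
         \<le> exp s * (\<Prod>v\<in>A - {u} \<union> B. ?g v)"
        by (simp only: bernoulli_sum_cmult) simp
    qed (use q01 in auto)
    \<comment> \<open>Neighbours already in \<open>A\<close> must not be counted twice. Giving them
      the factor 1 makes the integrand a product over \<open>B\<close>, as
      \<open>bernoulli_sum_prod\<close> requires.\<close>
    also have "\<dots> = bernoulli_sum (V - {u}) (\<lambda>v. p {u, v})
        (\<lambda>B. (exp s * (\<Prod>v\<in>A - {u}. ?g v)) * (\<Prod>v\<in>B. if v \<in> A then 1 else ?g v))"
    proof (intro bernoulli_sum_cong)
      fix B assume B: "B \<subseteq> V - {u}"
      then have finB: "finite B" using finV finite_subset by blast
      have eq: "A - {u} \<union> B = (A - {u}) \<union> (B - A)" using B by auto
      have "(\<Prod>v\<in>A - {u} \<union> B. ?g v) = (\<Prod>v\<in>A - {u}. ?g v) * (\<Prod>v\<in>B - A. ?g v)"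
        unfolding eq by (rule prod.union_disjoint) (use finA finB in auto)
      also have "(\<Prod>v\<in>B - A. ?g v) = (\<Prod>v\<in>B. if v \<in> A then 1 else ?g v)"
        by (rule prod.mono_neutral_cong_left) (use finB in auto)
      finally show "exp s * (\<Prod>v\<in>A - {u} \<union> B. ?g v) =
          (exp s * (\<Prod>v\<in>A - {u}. ?g v)) * (\<Prod>v\<in>B. if v \<in> A then 1 else ?g v)"
        by (simp add: mult_ac)
    qed
    also have "\<dots> = (exp s * (\<Prod>v\<in>A - {u}. ?g v)) *
        (\<Prod>v\<in>V - {u}. 1 + p {u, v} * ((if v \<in> A then 1 else ?g v) - 1))"
      unfolding bernoulli_sum_cmult using finV by (subst bernoulli_sum_prod) auto
    also have "(\<Prod>v\<in>V - {u}. 1 + p {u, v} * ((if v \<in> A then 1 else ?g v) - 1))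
       = (\<Prod>v\<in>V - A. 1 + p {u, v} * (?g v - 1))"
      by (rule prod.mono_neutral_cong_right) (use finV u in auto)
    also have "(exp s * (\<Prod>v\<in>A - {u}. ?g v)) * (\<Prod>v\<in>V - A. 1 + p {u, v} * (?g v - 1))
      \<le> (exp s * (\<Prod>v\<in>A - {u}. ?g v)) * exp (\<Sum>v\<in>V - A. p {u, v} * (?g v - 1))"
    proof (rule mult_left_mono[OF prod_one_plus_le_exp])
      fix v assume "v \<in> V - A"
      then have v: "v \<in> V - {u}" using u by auto
      have "p {u, v} * (?g v - 1) \<ge> p {u, v} * (- 1)"
        by (rule mult_left_mono) (use q01[OF v] in auto)
      then show "0 \<le> 1 + p {u, v} * (?g v - 1)" using q01[OF v] by auto
    qed (simp add: prod_nonneg)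
    also have "\<dots> \<le> (exp s * (\<Prod>v\<in>A - {u}. ?g v)) * exp (x * w u)"
    proof -
      \<comment> \<open>Besides the deleted vertices the sum misses \<open>A\<close>; the case
        assumption \<open>card A \<le> Suc b\<close> keeps the total within
        \<open>M\<close>.\<close>
      have "V0 - (V - A) = (V0 - V) \<union> A" using Suc.prems by auto
      then have "card (V0 - (V - A)) \<le> card (V0 - V) + card A"
        by (metis card_Un_le)
      then have "(\<Sum>v\<in>V - A. p {u, v} * (?g v - 1)) \<le> x * w u"
        by (intro drift) (use 3 Suc.prems uV in auto)
      then show ?thesis by (intro mult_left_mono) (auto simp: prod_nonneg)
    qed
    also have "\<dots> = (\<Prod>u\<in>A. ?g u)"
      using prod.remove[OF finA u, of ?g] by (simp add: exp_add mult_ac)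
    finally show ?thesis .
  qed
qed

lemma degree_star:
  assumes "E \<subseteq> all_edges (V - {v})" "B \<subseteq> V - {v}" "v \<in> V"
  shows "degree V (E \<union> (\<lambda>u. {v, u}) ` B) v = card B"
proof -
  have "{u \<in> V. {u, v} \<in> E \<union> (\<lambda>u. {v, u}) ` B} = B"
    using assms by (auto simp: all_edges_def doubleton_eq_iff)
  then show ?thesis by (simp add: degree_def)
qed

text \<open>The root is explored by hand so that each of its neighbours receives an extra factor
  \<open>exp r\<close>, which records the degree. Only the later steps rely on the drift condition;
  the root's own sum stays explicit, with \<open>r + s\<close> in place of \<open>s\<close>, and is
  evaluated by the caller.\<close>

lemma rooted_exploration_bound:
  fixes p :: "nat set \<Rightarrow> real" and w :: "nat \<Rightarrow> real" and s x r :: real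
  assumes fin: "finite V"
    and p01: "\<And>e. e \<in> all_edges V \<Longrightarrow> 0 \<le> p e \<and> p e \<le> 1"
    and drift: "\<And>u U. u \<in> V \<Longrightarrow> U \<subseteq> V \<Longrightarrow> card (V - U) \<le> b
        \<Longrightarrow> (\<Sum>v\<in>U. p {u, v} * (exp (s + x * w v) - 1)) \<le> x * w u"
    and v: "v \<in> V"
  shows "bernoulli_sum (all_edges V) p
      (\<lambda>E. if card (reach E {v}) \<le> b then exp (s * card (reach E {v}) + r * degree V E v) else 0)
    \<le> exp (s + (\<Sum>u\<in>V - {v}. p {v, u} * (exp (r + s + x * w u) - 1)))"
proof (cases b)
  case 0
  have "bernoulli_sum (all_edges V) p
      (\<lambda>E. if card (reach E {v}) \<le> b then exp (s * card (reach E {v}) + r * degree V E v) else 0)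
     = bernoulli_sum (all_edges V) p (\<lambda>E. 0)"
  proof (rule bernoulli_sum_cong)
    fix E assume "E \<subseteq> all_edges V"
    then have "finite (reach E {v})" using reach_subset[of E V "{v}"] fin v finite_subset by blast
    moreover have "reach E {v} \<noteq> {}" using subset_reach[of "{v}" E] by auto
    ultimately show "(if card (reach E {v}) \<le> b
        then exp (s * card (reach E {v}) + r * degree V E v) else 0) = 0"
      using 0 by simp
  qed
  then show ?thesis using fin by (simp add: bernoulli_sum_const finite_all_edges)
next
  case (Suc b')
  let ?f = "\<lambda>b A E. if card (reach E A) \<le> b then exp (s * card (reach E A)) else 0"
  have q01: "0 \<le> p {v, u} \<and> p {v, u} \<le> 1" if "u \<in> V - {v}" for u
    by (rule p01) (use that v in \<open>auto simp: all_edges_def\<close>)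
  let ?h = "\<lambda>E. if card (reach E {v}) \<le> b
      then exp (s * card (reach E {v}) + r * degree V E v) else 0"
  have "bernoulli_sum (all_edges V) p ?h =
     bernoulli_sum (V - {v}) (\<lambda>u. p {v, u}) (\<lambda>B. bernoulli_sum (all_edges (V - {v})) p
        (\<lambda>E. ?h (E \<union> (\<lambda>u. {v, u}) ` B)))"
    by (rule bernoulli_sum_remove_vertex[OF fin v])
  also have "\<dots> = bernoulli_sum (V - {v}) (\<lambda>u. p {v, u}) (\<lambda>B. bernoulli_sum (all_edges (V - {v})) p
        (\<lambda>E. exp (s + r * card B) * ?f b' B E))"
  proof (intro bernoulli_sum_cong)
    fix B E assume BE: "B \<subseteq> V - {v}" "E \<subseteq> all_edges (V - {v})"
    have "reach E B \<subseteq> V - {v}" by (rule reach_subset) (use BE in auto)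
    then have "finite (reach E B)" "v \<notin> reach E B" using fin finite_subset by auto
    then show "?h (E \<union> (\<lambda>u. {v, u}) ` B) = exp (s + r * card B) * ?f b' B E"
      using reach_explore[OF BE(2,1), of "{v}"] degree_star[OF BE(2,1) v] Suc
      by (simp add: algebra_simps exp_add)
  qed
  also have "\<dots> \<le> bernoulli_sum (V - {v}) (\<lambda>u. p {v, u}) (\<lambda>B. exp s * (\<Prod>u\<in>B. exp (r + s + x * w u)))"
  proof (rule bernoulli_sum_mono)
    fix B assume B: "B \<subseteq> V - {v}"
    then have finB: "finite B" using fin finite_subset by blast
    \<comment> \<open>The root is the one missing vertex, and 1 + \<open>b'\<close> =
      \<open>b\<close> is exactly what \<open>drift\<close> tolerates.\<close>
    have "V - (V - {v}) = {v}" using v by auto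
    then have "bernoulli_sum (all_edges (V - {v})) p (?f b' B) \<le> (\<Prod>u\<in>B. exp (s + x * w u))"
      by (intro exploration_bound[OF fin p01 drift]) (use B v Suc in auto)
    then have "bernoulli_sum (all_edges (V - {v})) p (\<lambda>E. exp (s + r * card B) * ?f b' B E)
      \<le> exp (s + r * card B) * (\<Prod>u\<in>B. exp (s + x * w u))"
      by (simp only: bernoulli_sum_cmult) simp
    also have "\<dots> = exp s * (\<Prod>u\<in>B. exp (r + s + x * w u))"
      using finB by (simp add: exp_add prod.distrib mult_ac flip: exp_of_nat_mult)
    finally show "bernoulli_sum (all_edges (V - {v})) p (\<lambda>E. exp (s + r * card B) * ?f b' B E)
      \<le> exp s * (\<Prod>u\<in>B. exp (r + s + x * w u))" .
  qed (use q01 in auto)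
  also have "\<dots> = exp s * (\<Prod>u\<in>V - {v}. 1 + p {v, u} * (exp (r + s + x * w u) - 1))"
    unfolding bernoulli_sum_cmult using fin by (subst bernoulli_sum_prod) auto
  also have "\<dots> \<le> exp s * exp (\<Sum>u\<in>V - {v}. p {v, u} * (exp (r + s + x * w u) - 1))"
  proof (rule mult_left_mono[OF prod_one_plus_le_exp])
    fix u assume u: "u \<in> V - {v}"
    have "p {v, u} * (exp (r + s + x * w u) - 1) \<ge> p {v, u} * (- 1)"
      by (rule mult_left_mono) (use q01[OF u] in auto)
    then show "0 \<le> 1 + p {v, u} * (exp (r + s + x * w u) - 1)" using q01[OF u] by auto
  qed simp
  also have "\<dots> = exp (s + (\<Sum>u\<in>V - {v}. p {v, u} * (exp (r + s + x * w u) - 1)))"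
    by (simp add: exp_add)
  finally show ?thesis .
qed

section \<open>Largest component and maximum degree\<close>

text \<open>Edges are undirected, so \<open>a\<close> is reachable from \<open>b\<close> as well.
  One inclusion is enough to compare cardinalities.\<close>

lemma reach_sym:
  assumes "b \<in> reach E {a}"
  shows "reach E {a} \<subseteq> reach E {b}"
proof (rule reach_least)
  have "(b, a) \<in> {(x, y). {x, y} \<in> E}\<^sup>*"
  proof -
    have "sym {(x, y). {x, y} \<in> E}" by (auto simp: sym_def insert_commute)
    then have "sym ({(x, y). {x, y} \<in> E}\<^sup>*)" by (rule sym_rtrancl)
    then show ?thesis using assms by (auto simp: reach_def sym_def)
  qed
  then show "{a} \<subseteq> reach E {b}" by (auto simp: reach_def)
qed (use reach_step in fast)

lemma components_eq_reach:
  assumes "E \<subseteq> all_edges V"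
  shows "components V E = (\<lambda>v. reach E {v}) ` V"
proof -
  have "joined V E `` {v} = reach E {v}" if "v \<in> V" for v
    using reach_subset[OF assms, of "{v}"] that by (auto simp: joined_def reach_def)
  then show ?thesis by (auto simp: components_def quotient_def)
qed

text \<open>The choice made by \<open>arg_max\<close> is controlled only when the cardinalities are
  bounded; the bound used is \<open>Suc (card V)\<close>, because the inequality asked for is
  strict.\<close>

lemma largest_component_reach:
  assumes "finite V" "V \<noteq> {}" "E \<subseteq> all_edges V"
  shows "\<exists>v\<in>V. largest_component V E = reach E {v}"
    and "v \<in> V \<Longrightarrow> card (reach E {v}) \<le> card (largest_component V E)"
proof -
  obtain v0 where v0: "v0 \<in> V" using assms by auto
  have comp: "components V E = (\<lambda>v. reach E {v}) ` V"
    by (rule components_eq_reach[OF assms(3)])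
  have "card C < Suc (card V)" if "C \<in> components V E" for C
    using that reach_subset[OF assms(3)] card_mono[OF assms(1)] unfolding comp by (auto simp: less_Suc_eq_le)
  then have *: "\<forall>C. C \<in> components V E \<longrightarrow> card C < Suc (card V)" by auto
  have v0': "reach E {v0} \<in> components V E" using v0 comp by auto
  from arg_max_natI[of "\<lambda>C. C \<in> components V E", OF v0' *]
  show "\<exists>v\<in>V. largest_component V E = reach E {v}"
    unfolding largest_component_def comp by auto
  show "card (reach E {v}) \<le> card (largest_component V E)" if "v \<in> V"
    using arg_max_nat_le[of "\<lambda>C. C \<in> components V E", OF _ *] that
    unfolding largest_component_def comp by auto
qed

lemma degree_le_card_reach:
  assumes "finite V" "E \<subseteq> all_edges V" "v \<in> V"
  shows "degree V E v \<le> card (reach E {v})"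
  unfolding degree_def
proof (rule card_mono)
  show "finite (reach E {v})" using reach_subset[OF assms(2), of "{v}"] assms finite_subset by auto
  show "{u \<in> V. {u, v} \<in> E} \<subseteq> reach E {v}"
    using subset_reach[of "{v}" E] by (auto intro: reach_step simp: insert_commute)
qed

text \<open>The deterministic core, with \<open>V - S\<close> the heavy vertices. A component
  meeting \<open>V - S\<close> has its size read off a degree; one inside \<open>S\<close> is small.
  Conversely, a vertex of maximal degree is heavy, or its degree is at most \<open>e\<close> plus
  the number of heavy vertices.\<close>

lemma largest_component_max_degree:
  fixes \<nu> e :: real
  assumes fin: "finite V" and ne: "V \<noteq> {}" and E: "E \<subseteq> all_edges V" and S: "S \<subseteq> V"
    and \<nu>: "0 \<le> \<nu>" "\<nu> < 1" and e: "0 \<le> e"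
    and small: "\<And>v. v \<in> S \<Longrightarrow> card (reach (E \<inter> all_edges S) {v}) \<le> e"
    and big: "\<And>v. v \<in> V - S \<Longrightarrow> \<bar>card (reach E {v}) - degree V E v / (1 - \<nu>)\<bar> \<le> e"
  shows "\<bar>card (largest_component V E) - max_degree V E / (1 - \<nu>)\<bar>
    \<le> e + (e + card (V - S)) / (1 - \<nu>)"
proof -
  note lc = largest_component_reach[OF fin ne E]
  have deg_le: "degree V E v \<le> max_degree V E" if "v \<in> V" for v
    unfolding max_degree_def using fin that by (intro Max_ge) auto
  have pos: "0 \<le> (e + card (V - S)) / (1 - \<nu>)" "0 \<le> max_degree V E / (1 - \<nu>)"
    using \<nu> e by auto
  have "card (largest_component V E) \<le> max_degree V E / (1 - \<nu>) + e"
  proof -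
    obtain v where v: "v \<in> V" "largest_component V E = reach E {v}" using lc by auto
    have sub: "reach E {v} \<subseteq> V" by (rule reach_subset) (use E v in auto)
    show ?thesis
    proof (cases "reach E {v} \<subseteq> S")
      case True
      \<comment> \<open>The intersection is closed under \<open>E\<close>: its first part keeps both
        ends of an edge in \<open>S\<close>, so the edge belongs to the spanned subgraph.\<close>
      have "reach E {v} \<subseteq> reach E {v} \<inter> reach (E \<inter> all_edges S) {v}"
      proof (rule reach_least)
        fix x z assume x: "x \<in> reach E {v} \<inter> reach (E \<inter> all_edges S) {v}" and xz: "{x, z} \<in> E"
        then have z: "z \<in> reach E {v}" using reach_step by fast
        then have "{x, z} \<in> all_edges S" using x xz True E by (auto simp: all_edges_def)
        then show "z \<in> reach E {v} \<inter> reach (E \<inter> all_edges S) {v}"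
          using x xz z reach_step[of x "E \<inter> all_edges S" "{v}" z] by auto
      qed (use subset_reach[of "{v}"] in auto)
      then have sub2: "reach E {v} \<subseteq> reach (E \<inter> all_edges S) {v}" by auto
      have "v \<in> S" using True subset_reach[of "{v}" E] by auto
      then have "finite (reach (E \<inter> all_edges S) {v})"
        using reach_subset[of "E \<inter> all_edges S" S "{v}"] fin S finite_subset by (metis Int_lower2 bot_least insert_subset)
      then have "card (reach E {v}) \<le> card (reach (E \<inter> all_edges S) {v})"
        using sub2 by (rule card_mono)
      then show ?thesis using small[OF \<open>v \<in> S\<close>] pos unfolding v(2) by linarith
    next
      case False
      then obtain b where b: "b \<in> reach E {v}" "b \<in> V - S" using sub by auto
      have "finite (reach E {b})" using reach_subset[OF E, of "{b}"] b fin finite_subset by auto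
      then have "card (reach E {v}) \<le> card (reach E {b})"
        using reach_sym[OF b(1)] by (rule card_mono)
      also have "card (reach E {b}) \<le> degree V E b / (1 - \<nu>) + e"
        using big[OF b(2)] by linarith
      also have "degree V E b / (1 - \<nu>) \<le> max_degree V E / (1 - \<nu>)"
        using deg_le[of b] b \<nu> by (intro divide_right_mono) auto
      finally show ?thesis using v by simp
    qed
  qed
  moreover have "max_degree V E / (1 - \<nu>) \<le> card (largest_component V E) + e + (e + card (V - S)) / (1 - \<nu>)"
  proof -
    have "max_degree V E \<in> degree V E ` V" unfolding max_degree_def using fin ne by (intro Max_in) auto
    then obtain v where v: "v \<in> V" "max_degree V E = degree V E v" by auto
    show ?thesis
    proof (cases "v \<in> S")
      case True
      have finS: "finite S" using fin S finite_subset by auto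
      \<comment> \<open>Light neighbours lie in the small component of the spanned subgraph; the
        others number at most \<open>card (V - S)\<close>.\<close>
      have "{u \<in> V. {u, v} \<in> E} \<subseteq> {u \<in> S. {u, v} \<in> E \<inter> all_edges S} \<union> (V - S)"
        using True E by (auto simp: all_edges_def)
      then have "card {u \<in> V. {u, v} \<in> E} \<le> card ({u \<in> S. {u, v} \<in> E \<inter> all_edges S} \<union> (V - S))"
        by (intro card_mono) (use fin finS in auto)
      also have "\<dots> \<le> degree S (E \<inter> all_edges S) v + card (V - S)"
        unfolding degree_def by (rule card_Un_le)
      finally have "degree V E v \<le> degree S (E \<inter> all_edges S) v + card (V - S)"
        by (simp add: degree_def)
      also have "degree S (E \<inter> all_edges S) v \<le> card (reach (E \<inter> all_edges S) {v})"
        by (rule degree_le_card_reach) (use finS True in auto)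
      finally have "degree V E v \<le> e + card (V - S)" using small[OF True] by linarith
      then have "max_degree V E / (1 - \<nu>) \<le> (e + card (V - S)) / (1 - \<nu>)"
        using v \<nu> by (intro divide_right_mono) auto
      then show ?thesis using e by linarith
    next
      case False
      then have "degree V E v / (1 - \<nu>) \<le> card (reach E {v}) + e"
        using big[of v] v by auto
      then show ?thesis using lc(2)[OF v(1)] pos unfolding v(2) by linarith
    qed
  qed
  ultimately show ?thesis using pos by linarith
qed

section \<open>Weight sequences\<close>

text \<open>\<open>Min\<close> and \<open>Max\<close> recover the two endpoints, making the
  probability a function of the unordered pair; \<open>edge_prob\<close> is symmetric, so the order
  is immaterial.\<close>

definition edge_weight :: "nat \<Rightarrow> (nat \<Rightarrow> real) \<Rightarrow> nat set \<Rightarrow> real" where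
  "edge_weight n w e = edge_prob n (w (Min e)) (w (Max e))"

lemma edge_weight_pair: "edge_weight n w {u, v} = edge_prob n (w u) (w v)"
  by (cases "u \<le> v") (auto simp: edge_weight_def edge_prob_def min_def max_def mult_ac)

text \<open>With z = xy/n the probability is z / (1 + z), which lies between z (1 - z) and z.
  Linearising it thus costs a relative error of at most z.\<close>

lemma edge_prob_bounds:
  assumes "0 \<le> x" "0 \<le> y" "0 < n"
  shows "0 \<le> edge_prob n x y" "edge_prob n x y \<le> 1" "edge_prob n x y \<le> x * y / n"
    "x * y / n * (1 - x * y / n) \<le> edge_prob n x y"
proof -
  have xy: "0 \<le> x * y" using assms by simp
  then have pos: "0 < n + x * y" using assms by (simp add: add_pos_nonneg)
  then show "0 \<le> edge_prob n x y" "edge_prob n x y \<le> 1" using xy by (auto simp: edge_prob_def)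
  show "edge_prob n x y \<le> x * y / n"
    unfolding edge_prob_def by (rule divide_left_mono) (use xy assms pos in auto)
  have "x * y * ((n - x * y) * (n + x * y)) \<le> x * y * (real n * n)"
    using xy mult_nonneg_nonneg[OF xy xy] by (intro mult_left_mono) (auto simp: algebra_simps)
  then have "x * y * (n - x * y) / (real n * n) \<le> x * y / (n + x * y)"
    using assms pos by (simp add: field_simps)
  moreover have "x * y / n * (1 - x * y / n) = x * y * (n - x * y) / (real n * n)"
    using assms by (simp add: field_simps)
  ultimately show "x * y / n * (1 - x * y / n) \<le> edge_prob n x y"
    unfolding edge_prob_def by simp
qed

lemma edge_weight_bounds:
  assumes "\<And>i. i \<in> {1..n} \<Longrightarrow> 0 \<le> w i" "e \<in> all_edges {1..n}"
  shows "0 \<le> edge_weight n w e" "edge_weight n w e \<le> 1"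
proof -
  from assms obtain x y where xy: "e = {x, y}" "x \<in> {1..n}" "y \<in> {1..n}"
    by (auto simp: all_edges_def card_2_iff)
  then have "0 < n" by auto
  then show "0 \<le> edge_weight n w e" "edge_weight n w e \<le> 1"
    unfolding xy edge_weight_pair using xy assms(1) by (auto intro!: edge_prob_bounds)
qed

section \<open>Elementary estimates for a single edge\<close>

lemma abs_exp_minus_one_le: "\<bar>exp y - 1\<bar> \<le> \<bar>y\<bar> * exp \<bar>y\<bar>" for y :: real
proof (cases "0 \<le> y")
  case True
  have "exp y * (1 + - y) \<le> exp y * exp (- y)"
    by (rule mult_left_mono[OF exp_ge_add_one_self]) simp
  then have "exp y - 1 \<le> y * exp y" by (simp add: algebra_simps flip: exp_add)
  then show ?thesis using True by simp
next
  case False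
  have "1 - exp y \<le> - y" using exp_ge_add_one_self[of y] by linarith
  also have "- y \<le> - y * exp (- y)" using False by (simp add: mult_le_cancel_left1)
  finally show ?thesis using False by simp
qed

lemma exp_minus_one_minus_bounds:
  fixes y :: real
  shows "0 \<le> exp y - 1 - y" "exp y - 1 - y \<le> y\<^sup>2 * exp \<bar>y\<bar>"
proof -
  show "0 \<le> exp y - 1 - y" using exp_ge_add_one_self[of y] by linarith
  have "exp y * (1 + - y) \<le> exp y * exp (- y)"
    by (rule mult_left_mono[OF exp_ge_add_one_self]) simp
  then have "exp y - 1 - y \<le> y * (exp y - 1)" by (simp add: algebra_simps flip: exp_add)
  also have "\<dots> \<le> \<bar>y\<bar> * \<bar>exp y - 1\<bar>" by (metis abs_ge_self abs_mult)
  also have "\<dots> \<le> \<bar>y\<bar> * (\<bar>y\<bar> * exp \<bar>y\<bar>)" by (intro mult_left_mono abs_exp_minus_one_le) auto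
  finally show "exp y - 1 - y \<le> y\<^sup>2 * exp \<bar>y\<bar>" by (simp add: power2_eq_square flip: abs_mult)
qed

text \<open>Two linearisations are made together: of the edge probability, with relative error at
  most L^2 / n, and of the exponential, with an error quadratic in \<open>y\<close>.\<close>

lemma edge_term_estimate:
  fixes a b y L :: real
  assumes "0 \<le> a" "a \<le> L" "0 \<le> b" "b \<le> L" "0 < n"
  shows "\<bar>edge_prob n a b * (exp y - 1) - a * b / n * y\<bar>
    \<le> a / n * exp \<bar>y\<bar> * (b * y\<^sup>2 + L\<^sup>2 / n * (b * \<bar>y\<bar>))"
proof -
  let ?q = "edge_prob n a b"
  note q = edge_prob_bounds[OF assms(1,3,5)]
  have ab: "0 \<le> a * b / n" "a * b \<le> L\<^sup>2"
    using assms by (auto simp: power2_eq_square intro: mult_mono)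
  have eq: "q * (E - 1) - c * y = (q - c) * (E - 1) + c * (E - 1 - y)" for q c E :: real
    by (simp add: algebra_simps)
  have "\<bar>?q * (exp y - 1) - a * b / n * y\<bar> = \<bar>(?q - a * b / n) * (exp y - 1) + a * b / n * (exp y - 1 - y)\<bar>"
    by (rule arg_cong[OF eq])
  also have "\<dots> \<le> \<bar>?q - a * b / n\<bar> * \<bar>exp y - 1\<bar> + a * b / n * \<bar>exp y - 1 - y\<bar>"
    using ab(1) by (metis abs_triangle_ineq abs_mult abs_of_nonneg)
  also have "\<dots> \<le> (a * b / n * (L\<^sup>2 / n)) * (\<bar>y\<bar> * exp \<bar>y\<bar>) + a * b / n * (y\<^sup>2 * exp \<bar>y\<bar>)"
  proof (intro add_mono mult_mono)
    have "\<bar>?q - a * b / n\<bar> \<le> a * b / n * (a * b / n)"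
      using q by (simp add: algebra_simps)
    also have "\<dots> \<le> a * b / n * (L\<^sup>2 / n)"
      using ab by (intro mult_left_mono divide_right_mono) auto
    finally show "\<bar>?q - a * b / n\<bar> \<le> a * b / n * (L\<^sup>2 / n)" .
    show "\<bar>exp y - 1 - y\<bar> \<le> y\<^sup>2 * exp \<bar>y\<bar>" using exp_minus_one_minus_bounds[of y] by simp
  qed (use ab abs_exp_minus_one_le mult_nonneg_nonneg[OF ab(1), of "L\<^sup>2 / n"] in auto)
  finally show ?thesis by (simp add: algebra_simps)
qed

text \<open>Above level \<open>T\<close> the square is dominated by the power 2 + \<beta> with the
  small factor T^(-\<beta>). This shows that few vertices carry little squared weight.\<close>

lemma square_le_truncation:
  fixes z T \<beta> :: real
  assumes "0 \<le> z" "0 < T" "0 < \<beta>"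
  shows "z\<^sup>2 \<le> T\<^sup>2 + z powr (2 + \<beta>) * T powr - \<beta>"
proof (cases "z \<le> T")
  case True
  then have "z\<^sup>2 \<le> T\<^sup>2" using assms by (intro power_mono) auto
  then show ?thesis by (simp add: add_increasing2)
next
  case False
  then have z: "0 < z" using assms by auto
  have "1 \<le> z powr \<beta> * T powr - \<beta>"
    using False assms by (simp add: powr_minus field_simps powr_mono2)
  then have "z\<^sup>2 * 1 \<le> z\<^sup>2 * (z powr \<beta> * T powr - \<beta>)" by (rule mult_left_mono) simp
  also have "\<dots> = z powr (2 + \<beta>) * T powr - \<beta>" using z by (simp add: powr_add)
  finally show ?thesis using zero_le_power2[of T] by linarith
qed

text \<open>Third moments of the weights may be infinite. Below level \<open>L\<close> they cost a
  factor L^(1-\<beta>), which a Laplace parameter of order n^(-\<alpha>) turns into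
  n^(-\<alpha>\<beta>) when L is of order n^\<alpha>.\<close>

lemma cube_le_truncation:
  fixes z L \<beta> :: real
  assumes "0 \<le> z" "z \<le> L" "0 < \<beta>" "\<beta> \<le> 1"
  shows "z ^ 3 \<le> L powr (1 - \<beta>) * z powr (2 + \<beta>)"
proof (cases "z = 0")
  case False
  then have z: "0 < z" using assms by auto
  have "z ^ 3 = z powr (1 - \<beta>) * z powr (2 + \<beta>)"
    using z by (simp flip: powr_add powr_numeral)
  also have "\<dots> \<le> L powr (1 - \<beta>) * z powr (2 + \<beta>)"
    using assms z by (intro mult_right_mono powr_mono2) auto
  finally show ?thesis .
qed simp

text \<open>Weights will be of order at most \<open>n\<^sup>\<alpha>\<close> and have bounded empirical moments of order \<open>2 + \<beta>\<close>, and
  \<open>\<alpha> < 1/2\<close> makes \<open>w\<^sub>u w\<^sub>v = o(n)\<close>, so that edge probabilities are asymptotically \<open>w\<^sub>u w\<^sub>v / n\<close>.\<close>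

locale subcritical =
  fixes \<alpha> \<beta> \<mu> \<nu> :: real
  assumes \<alpha>: "0 < \<alpha>" "\<alpha> < 1 / 2" and \<beta>: "0 < \<beta>" "\<beta> \<le> 1" and \<mu>: "0 \<le> \<mu>" and \<nu>: "0 \<le> \<nu>" "\<nu> < 1"
begin

text \<open>Only \<eta> has to be small. \<open>K\<close> and \<open>Q\<close> are constants fixed
  by the admissible failure probability, since the maximum divided by n^\<alpha> is merely bounded
  in probability.\<close>

definition good_weights :: "real \<Rightarrow> real \<Rightarrow> real \<Rightarrow> nat \<Rightarrow> (nat \<Rightarrow> real) \<Rightarrow> bool" where
  "good_weights \<eta> K Q n w \<longleftrightarrow>
     (\<forall>i\<in>{1..n}. 0 \<le> w i \<and> w i \<le> K * n powr \<alpha>) \<and>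
     \<bar>(\<Sum>i=1..n. w i) / n - \<mu>\<bar> \<le> \<eta> \<and> \<bar>(\<Sum>i=1..n. (w i)\<^sup>2) / n - \<nu>\<bar> \<le> \<eta> \<and>
     (\<Sum>i=1..n. w i powr (2 + \<beta>)) \<le> Q * n"

lemma good_weights_mono: "good_weights \<eta> K Q n w \<Longrightarrow> \<eta> \<le> \<eta>' \<Longrightarrow> good_weights \<eta>' K Q n w"
  by (auto simp: good_weights_def)

text \<open>Second-order terms bring in \<open>w v\<close> times (1 + \<open>w v\<close>)^2, hence
  third moments, which \<open>cube_le_truncation\<close> controls. The cap \<open>L\<close> is a
  parameter because the estimate is used both for all vertices and for the light ones only.\<close>

lemma quadratic_error:
  assumes w: "good_weights \<eta> K Q n w" and n: "0 < n" and \<eta>: "\<eta> \<le> 1" and U: "U \<subseteq> {1..n}"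
    and L: "\<And>v. v \<in> U \<Longrightarrow> w v \<le> L" "0 \<le> L" and u: "0 \<le> w u" "w u \<le> L"
    and s: "\<bar>s\<bar> \<le> \<tau>" and x: "\<bar>x\<bar> \<le> \<tau>" and D: "\<And>v. v \<in> U \<Longrightarrow> \<bar>s + x * w v\<bar> \<le> D"
  shows "\<bar>(\<Sum>v\<in>U. edge_prob n (w u) (w v) * (exp (s + x * w v) - 1))
      - w u * ((\<Sum>v\<in>U. w v * (s + x * w v)) / n)\<bar>
    \<le> w u * (\<tau> * exp D * (4 * \<tau> * (1 + L powr (1 - \<beta>) * Q) + 6 * L\<^sup>2 / n))"
proof -
  have wL: "0 \<le> w v" "w v \<le> L" if "v \<in> U" for v using w U L that by (auto simp: good_weights_def)
  have \<tau>0: "0 \<le> \<tau>" using s by auto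
  have term_le: "\<bar>edge_prob n (w u) (w v) * (exp (s + x * w v) - 1) - w u * w v / n * (s + x * w v)\<bar>
     \<le> w u / n * exp D * (\<tau>\<^sup>2 * (4 * (1 + w v ^ 3)) + L\<^sup>2 / n * (\<tau> * (2 * (1 + (w v)\<^sup>2))))"
    if v: "v \<in> U" for v
  proof -
    let ?y = "s + x * w v"
    have y: "\<bar>?y\<bar> \<le> \<tau> * (1 + w v)"
    proof -
      have "\<bar>?y\<bar> \<le> \<bar>s\<bar> + \<bar>x\<bar> * w v" using wL[OF v] by (metis abs_mult abs_of_nonneg abs_triangle_ineq)
      also have "\<dots> \<le> \<tau> + \<tau> * w v" using s x wL[OF v] by (intro add_mono mult_right_mono) auto
      finally show ?thesis by (simp add: algebra_simps)
    qed
    have "?y\<^sup>2 \<le> (\<tau> * (1 + w v))\<^sup>2" using y by (rule abs_le_square_iff[THEN iffD1, OF order_trans]) (use \<tau>0 wL[OF v] in auto)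
    then have "w v * ?y\<^sup>2 \<le> w v * (\<tau> * (1 + w v))\<^sup>2" using wL[OF v] by (intro mult_left_mono) auto
    also have "\<dots> = \<tau>\<^sup>2 * (w v * (1 + w v)\<^sup>2)" by (simp add: power_mult_distrib)
    also have "w v * (1 + w v)\<^sup>2 \<le> 4 * (1 + w v ^ 3)"
    proof -
      \<comment> \<open>With z = \<open>w v\<close> the difference equals z (z-1)^2 + (z^3 - 2z + 2)
        + z^3 + 2, where z^3 - 2z + 2 = z (z-1)^2 + 2 (z - 3/4)^2 + 7/8.\<close>
      have "4 * (1 + w v ^ 3) - w v * (1 + w v)\<^sup>2 = 4 + 3 * w v ^ 3 - 2 * (w v)\<^sup>2 - w v"
        by (simp add: power2_eq_square power3_eq_cube algebra_simps)
      moreover have "0 \<le> w v * (w v - 1)\<^sup>2" "0 \<le> w v ^ 3" "0 \<le> (w v - 1)\<^sup>2" using wL[OF v] by auto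
      moreover have "w v * (w v - 1)\<^sup>2 = w v ^ 3 - 2 * (w v)\<^sup>2 + w v"
        by (simp add: power2_eq_square power3_eq_cube algebra_simps)
      moreover have "w v ^ 3 + 2 - 2 * w v - w v * (w v - 1)\<^sup>2 = 2 * (w v)\<^sup>2 - 3 * w v + 2"
        by (simp add: power2_eq_square power3_eq_cube algebra_simps)
      moreover have "2 * (w v)\<^sup>2 - 3 * w v + 2 = 2 * (w v - 3 / 4)\<^sup>2 + 7 / 8"
        by (simp add: power2_eq_square algebra_simps)
      moreover have "0 \<le> (w v - 3 / 4)\<^sup>2" by simp
      ultimately show ?thesis by linarith
    qed
    finally have 1: "w v * ?y\<^sup>2 \<le> \<tau>\<^sup>2 * (4 * (1 + w v ^ 3))" by (simp add: mult_left_mono)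
    have "w v * \<bar>?y\<bar> \<le> w v * (\<tau> * (1 + w v))" using y wL[OF v] by (intro mult_left_mono) auto
    also have "\<dots> = \<tau> * (w v * (1 + w v))" by simp
    also have "\<dots> \<le> \<tau> * (2 * (1 + (w v)\<^sup>2))"
    proof (rule mult_left_mono[OF _ \<tau>0])
      have "0 \<le> (w v - 1 / 2)\<^sup>2" by simp
      then show "w v * (1 + w v) \<le> 2 * (1 + (w v)\<^sup>2)" by (simp add: power2_eq_square algebra_simps)
    qed
    finally have 2: "w v * \<bar>?y\<bar> \<le> \<tau> * (2 * (1 + (w v)\<^sup>2))" .
    have "\<bar>edge_prob n (w u) (w v) * (exp ?y - 1) - w u * w v / n * ?y\<bar>
      \<le> w u / n * exp \<bar>?y\<bar> * (w v * ?y\<^sup>2 + L\<^sup>2 / n * (w v * \<bar>?y\<bar>))"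
      by (rule edge_term_estimate) (use u wL[OF v] n in auto)
    also have "\<dots> \<le> w u / n * exp D * (\<tau>\<^sup>2 * (4 * (1 + w v ^ 3)) + L\<^sup>2 / n * (\<tau> * (2 * (1 + (w v)\<^sup>2))))"
    proof (rule mult_mono)
      show "w v * ?y\<^sup>2 + L\<^sup>2 / n * (w v * \<bar>?y\<bar>)
          \<le> \<tau>\<^sup>2 * (4 * (1 + w v ^ 3)) + L\<^sup>2 / n * (\<tau> * (2 * (1 + (w v)\<^sup>2)))"
        by (rule add_mono[OF 1 mult_left_mono[OF 2]]) simp
      show "0 \<le> w v * ?y\<^sup>2 + L\<^sup>2 / n * (w v * \<bar>?y\<bar>)" using wL[OF v] by simp
      show "w u / n * exp \<bar>?y\<bar> \<le> w u / n * exp D" using D[OF v] u by (intro mult_left_mono) auto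
    qed (use u in auto)
    finally show ?thesis .
  qed
  have "\<bar>(\<Sum>v\<in>U. edge_prob n (w u) (w v) * (exp (s + x * w v) - 1))
      - w u * ((\<Sum>v\<in>U. w v * (s + x * w v)) / n)\<bar>
    = \<bar>\<Sum>v\<in>U. edge_prob n (w u) (w v) * (exp (s + x * w v) - 1) - w u * w v / n * (s + x * w v)\<bar>"
    by (simp add: sum_subtractf sum_distrib_left sum_divide_distrib mult_ac)
  also have "\<dots> \<le> (\<Sum>v\<in>U. w u / n * exp D * (\<tau>\<^sup>2 * (4 * (1 + w v ^ 3)) + L\<^sup>2 / n * (\<tau> * (2 * (1 + (w v)\<^sup>2)))))"
    by (rule order_trans[OF sum_abs sum_mono[OF term_le]])
  also have "\<dots> = w u / n * exp D * (4 * \<tau>\<^sup>2 * (\<Sum>v\<in>U. 1 + w v ^ 3) + 2 * \<tau> * L\<^sup>2 / n * (\<Sum>v\<in>U. 1 + (w v)\<^sup>2))"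
  proof -
    have "(\<tau>\<^sup>2 * (4 * a) + L\<^sup>2 / n * (\<tau> * (2 * b))) = 4 * \<tau>\<^sup>2 * a + 2 * \<tau> * L\<^sup>2 / n * b" for a b
      by simp
    then show ?thesis by (simp only: sum_distrib_left[symmetric] sum.distrib)
  qed
  also have "\<dots> \<le> w u / n * exp D * (4 * \<tau>\<^sup>2 * (n * (1 + L powr (1 - \<beta>) * Q)) + 2 * \<tau> * L\<^sup>2 / n * (n * 3))"
  proof (intro mult_left_mono add_mono)
    have "(\<Sum>v\<in>U. 1 + w v ^ 3) \<le> (\<Sum>v\<in>U. 1 + L powr (1 - \<beta>) * w v powr (2 + \<beta>))"
      using wL \<beta> by (intro sum_mono add_left_mono cube_le_truncation) auto
    also have "\<dots> \<le> (\<Sum>v=1..n. 1 + L powr (1 - \<beta>) * w v powr (2 + \<beta>))"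
      using U by (intro sum_mono2) auto
    also have "\<dots> = n + L powr (1 - \<beta>) * (\<Sum>v=1..n. w v powr (2 + \<beta>))"
      by (simp add: sum.distrib sum_distrib_left)
    also have "\<dots> \<le> n + L powr (1 - \<beta>) * (Q * n)"
      using w by (intro add_left_mono mult_left_mono) (auto simp: good_weights_def)
    finally show "(\<Sum>v\<in>U. 1 + w v ^ 3) \<le> n * (1 + L powr (1 - \<beta>) * Q)" by (simp add: algebra_simps)
    have "(\<Sum>v\<in>U. 1 + (w v)\<^sup>2) \<le> (\<Sum>v=1..n. 1 + (w v)\<^sup>2)"
      using U by (intro sum_mono2) auto
    also have "\<dots> = n + (\<Sum>v=1..n. (w v)\<^sup>2)" by (simp add: sum.distrib)
    also have "(\<Sum>v=1..n. (w v)\<^sup>2) \<le> 2 * n"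
    proof -
      have "(\<Sum>i=1..n. (w i)\<^sup>2) / n \<le> \<nu> + \<eta>" using w by (auto simp: good_weights_def)
      then have "(\<Sum>i=1..n. (w i)\<^sup>2) / n \<le> 2" using \<nu> \<eta> by linarith
      then show ?thesis using n by (simp add: field_simps)
    qed
    finally show "(\<Sum>v\<in>U. 1 + (w v)\<^sup>2) \<le> n * 3" by simp
  qed (use u \<tau>0 in auto)
  also have "\<dots> = w u * (\<tau> * exp D * (4 * \<tau> * (1 + L powr (1 - \<beta>) * Q) + 6 * L\<^sup>2 / n))"
    using n by (simp add: field_simps power2_eq_square)
  finally show ?thesis .
qed

text \<open>Over all vertices the sum is a combination of the empirical first and second moments,
  which differ from their limits by at most \<eta>. The squares of the missing weights are cut at
  level \<open>T\<close>: the lower part is paid per vertex, the upper part by the moment of order 2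
  + \<beta>.\<close>

lemma linear_error:
  assumes w: "good_weights \<eta> K Q n w" and n: "0 < n" and U: "U \<subseteq> {1..n}"
    and m: "card ({1..n} - U) \<le> m" and T: "0 < T" and s: "\<bar>s\<bar> \<le> \<tau>" and x: "\<bar>x\<bar> \<le> \<tau>"
  shows "\<bar>(\<Sum>v\<in>U. w v * (s + x * w v)) / n - (s * \<mu> + x * \<nu>)\<bar>
    \<le> \<tau> * (2 * \<eta> + m / n * (1 + 2 * T\<^sup>2) + 2 * Q * T powr - \<beta>)"
proof -
  let ?V = "{1..n} - U"
  have w0: "0 \<le> w v" if "v \<in> {1..n}" for v using w that by (auto simp: good_weights_def)
  have \<tau>0: "0 \<le> \<tau>" using s by auto
  have "(\<Sum>v=1..n. w v * (s + x * w v)) = s * (\<Sum>v=1..n. w v) + x * (\<Sum>v=1..n. (w v)\<^sup>2)"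
    by (simp add: sum_distrib_left sum.distrib[symmetric] algebra_simps power2_eq_square)
  moreover have "(\<Sum>v=1..n. w v * (s + x * w v)) = (\<Sum>v\<in>U. w v * (s + x * w v)) + (\<Sum>v\<in>?V. w v * (s + x * w v))"
    using sum.subset_diff[OF U] by (simp add: add.commute)
  ultimately have eq: "(\<Sum>v\<in>U. w v * (s + x * w v))
     = s * (\<Sum>v=1..n. w v) + x * (\<Sum>v=1..n. (w v)\<^sup>2) - (\<Sum>v\<in>?V. w v * (s + x * w v))" by linarith
  have "(\<Sum>v\<in>U. w v * (s + x * w v)) / n - (s * \<mu> + x * \<nu>)
    = s * ((\<Sum>v=1..n. w v) / n - \<mu>) + x * ((\<Sum>v=1..n. (w v)\<^sup>2) / n - \<nu>) - (\<Sum>v\<in>?V. w v * (s + x * w v)) / n"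
    unfolding eq by (simp add: right_diff_distrib diff_divide_distrib add_divide_distrib)
  also have "\<bar>\<dots>\<bar> \<le> \<bar>s\<bar> * \<bar>(\<Sum>v=1..n. w v) / n - \<mu>\<bar> + \<bar>x\<bar> * \<bar>(\<Sum>v=1..n. (w v)\<^sup>2) / n - \<nu>\<bar>
      + \<bar>\<Sum>v\<in>?V. w v * (s + x * w v)\<bar> / n"
    unfolding abs_mult[symmetric]
    using abs_triangle_ineq4[of "s * ((\<Sum>v=1..n. w v) / n - \<mu>) + x * ((\<Sum>v=1..n. (w v)\<^sup>2) / n - \<nu>)" "(\<Sum>v\<in>?V. w v * (s + x * w v)) / n"]
      abs_triangle_ineq[of "s * ((\<Sum>v=1..n. w v) / n - \<mu>)" "x * ((\<Sum>v=1..n. (w v)\<^sup>2) / n - \<nu>)"]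
    by simp
  also have "\<dots> \<le> \<tau> * \<eta> + \<tau> * \<eta> + \<tau> * (m * (1 + 2 * T\<^sup>2) + 2 * Q * n * T powr - \<beta>) / n"
  proof (intro add_mono mult_mono divide_right_mono)
    have "\<bar>\<Sum>v\<in>?V. w v * (s + x * w v)\<bar> \<le> (\<Sum>v\<in>?V. \<tau> * (1 + 2 * T\<^sup>2 + 2 * T powr - \<beta> * w v powr (2 + \<beta>)))"
    proof (rule order_trans[OF sum_abs sum_mono])
      fix v assume v: "v \<in> ?V"
      then have v0: "0 \<le> w v" using w0 by auto
      have "\<bar>w v * (s + x * w v)\<bar> \<le> w v * (\<bar>s\<bar> + \<bar>x\<bar> * w v)"
        using v0 by (simp add: abs_mult mult_left_mono) (metis abs_mult abs_of_nonneg abs_triangle_ineq mult_left_mono)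
      also have "\<dots> \<le> w v * (\<tau> + \<tau> * w v)"
        using s x v0 by (intro mult_left_mono add_mono mult_right_mono) auto
      also have "\<dots> = \<tau> * (w v + (w v)\<^sup>2)" by (simp add: algebra_simps power2_eq_square)
      also have "\<dots> \<le> \<tau> * (1 + 2 * T\<^sup>2 + 2 * T powr - \<beta> * w v powr (2 + \<beta>))"
      proof (rule mult_left_mono[OF _ \<tau>0])
        have "0 \<le> (w v - 1 / 2)\<^sup>2" by simp
        then have "w v \<le> 1 + (w v)\<^sup>2" by (simp add: power2_eq_square algebra_simps)
        then show "w v + (w v)\<^sup>2 \<le> 1 + 2 * T\<^sup>2 + 2 * T powr - \<beta> * w v powr (2 + \<beta>)"
          using square_le_truncation[OF v0 T \<beta>(1)] by (simp add: mult_ac)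
      qed
      finally show "\<bar>w v * (s + x * w v)\<bar> \<le> \<tau> * (1 + 2 * T\<^sup>2 + 2 * T powr - \<beta> * w v powr (2 + \<beta>))" .
    qed
    also have "\<dots> = \<tau> * (card ?V * (1 + 2 * T\<^sup>2) + 2 * T powr - \<beta> * (\<Sum>v\<in>?V. w v powr (2 + \<beta>)))"
      by (simp add: sum_distrib_left[symmetric] sum.distrib)
    also have "\<dots> \<le> \<tau> * (m * (1 + 2 * T\<^sup>2) + 2 * T powr - \<beta> * (Q * n))"
    proof (intro mult_left_mono add_mono mult_right_mono)
      have "(\<Sum>v\<in>?V. w v powr (2 + \<beta>)) \<le> (\<Sum>v=1..n. w v powr (2 + \<beta>))"
        by (rule sum_mono2) auto
      then show "(\<Sum>v\<in>?V. w v powr (2 + \<beta>)) \<le> Q * n" using w by (auto simp: good_weights_def)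
    qed (use m \<tau>0 in auto)
    finally show "\<bar>\<Sum>v\<in>?V. w v * (s + x * w v)\<bar> \<le> \<tau> * (m * (1 + 2 * T\<^sup>2) + 2 * Q * n * T powr - \<beta>)"
      by (simp add: mult_ac)
  qed (use w s x in \<open>auto simp: good_weights_def\<close>)
  also have "\<dots> = \<tau> * (2 * \<eta> + m / n * (1 + 2 * T\<^sup>2) + 2 * Q * T powr - \<beta>)"
    using n by (simp add: field_simps)
  finally show ?thesis .
qed

end

section \<open>Uniform drift estimate at the scale n^\<alpha>\<close>

lemma abs_add_mult_le: "0 \<le> c \<Longrightarrow> \<bar>a + c * b\<bar> \<le> \<bar>a\<bar> + c * \<bar>b\<bar>" for a b c :: real
  using abs_triangle_ineq[of a "c * b"] by (simp add: abs_mult)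

context subcritical
begin

text \<open>The errors of \<open>quadratic_error\<close> and \<open>linear_error\<close>, except for
  2\<eta>, divided by \<tau> = t n^(-\<alpha>), with L = K n^\<alpha>, m = sqrt n and T = n^(1/8).
  This \<open>T\<close> grows, yet keeps sqrt n T^2 / n of order n^(-1/4).\<close>

definition drift_error :: "real \<Rightarrow> real \<Rightarrow> real \<Rightarrow> nat \<Rightarrow> real" where
  "drift_error t K Q n =
     exp (t * n powr - \<alpha> + t * K) *
       (4 * (t * n powr - \<alpha>) * (1 + (K * n powr \<alpha>) powr (1 - \<beta>) * Q) + 6 * (K * n powr \<alpha>)\<^sup>2 / n)
     + (sqrt n / n * (1 + 2 * (n powr (1 / 8))\<^sup>2) + 2 * Q * (n powr (1 / 8)) powr - \<beta>)"

text \<open>The rates are n^(-\<alpha>), n^(-\<alpha>\<beta>) and n^(2\<alpha>-1) for the quadratic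
  part, the last one vanishing because \<alpha> < 1/2, and n^(-1/4) and n^(-\<beta>/8) for the
  linear part.\<close>

lemma drift_error_tendsto:
  assumes "0 < K"
  shows "(\<lambda>n. drift_error t K Q n) \<longlonglongrightarrow> 0"
proof -
  have neg: "(\<lambda>n. real n powr r) \<longlonglongrightarrow> 0" if "r < 0" for r
    by (rule tendsto_neg_powr[OF that filterlim_real_sequentially])
  have 1: "(\<lambda>n. real n powr - \<alpha>) \<longlonglongrightarrow> 0" using \<alpha> by (intro neg) simp
  have 2: "(\<lambda>n. real n powr - \<alpha> * (K * n powr \<alpha>) powr (1 - \<beta>)) \<longlonglongrightarrow> 0"
  proof (rule Lim_transform_eventually)
    show "(\<lambda>n. K powr (1 - \<beta>) * real n powr (- (\<alpha> * \<beta>))) \<longlonglongrightarrow> 0"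
      using \<alpha> \<beta> by (intro tendsto_mult_right_zero neg) simp
    have "K powr (1 - \<beta>) * real n powr (- (\<alpha> * \<beta>)) = real n powr - \<alpha> * (K * n powr \<alpha>) powr (1 - \<beta>)" for n
    proof -
      have "- \<alpha> + \<alpha> * (1 - \<beta>) = - (\<alpha> * \<beta>)" by (simp add: algebra_simps)
      then have "real n powr - \<alpha> * real n powr (\<alpha> * (1 - \<beta>)) = real n powr (- (\<alpha> * \<beta>))"
        by (metis powr_add)
      moreover have "(K * n powr \<alpha>) powr (1 - \<beta>) = K powr (1 - \<beta>) * real n powr (\<alpha> * (1 - \<beta>))"
        using assms by (simp add: powr_mult powr_powr)
      ultimately show ?thesis by simp
    qed
    then show "\<forall>\<^sub>F n in sequentially. K powr (1 - \<beta>) * real n powr (- (\<alpha> * \<beta>))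
        = real n powr - \<alpha> * (K * n powr \<alpha>) powr (1 - \<beta>)" by simp
  qed
  have 3: "(\<lambda>n. (K * n powr \<alpha>)\<^sup>2 / n) \<longlonglongrightarrow> 0"
  proof (rule Lim_transform_eventually)
    show "(\<lambda>n. K\<^sup>2 * real n powr (2 * \<alpha> - 1)) \<longlonglongrightarrow> 0"
      using \<alpha> by (intro tendsto_mult_right_zero neg) simp
    show "\<forall>\<^sub>F n in sequentially. K\<^sup>2 * real n powr (2 * \<alpha> - 1) = (K * n powr \<alpha>)\<^sup>2 / n"
      using eventually_gt_at_top[of 0]
    proof eventually_elim
      case (elim n)
      then have "real n powr (2 * \<alpha> - 1) = n powr \<alpha> * n powr \<alpha> / n"
        unfolding powr_diff mult_2 powr_add by simp
      then show ?case by (simp add: power_mult_distrib power2_eq_square)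
    qed
  qed
  have 4: "(\<lambda>n. sqrt n / n * (1 + 2 * (real n powr (1 / 8))\<^sup>2)) \<longlonglongrightarrow> 0"
    by real_asymp
  have 5: "(\<lambda>n. (real n powr (1 / 8)) powr - \<beta>) \<longlonglongrightarrow> 0"
    unfolding powr_powr using \<beta> by (intro neg) simp
  have "(\<lambda>n. exp (t * n powr - \<alpha> + t * K) *
       (4 * t * (n powr - \<alpha> + n powr - \<alpha> * (K * n powr \<alpha>) powr (1 - \<beta>) * Q) + 6 * ((K * n powr \<alpha>)\<^sup>2 / n))
     + (sqrt n / n * (1 + 2 * (n powr (1 / 8))\<^sup>2) + 2 * Q * (n powr (1 / 8)) powr - \<beta>))
     \<longlonglongrightarrow> exp (t * 0 + t * K) * (4 * t * (0 + 0 * Q) + 6 * 0) + (0 + 2 * Q * 0)"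
    by (rule tendsto_add[OF tendsto_mult[OF
          tendsto_exp[OF tendsto_add[OF tendsto_mult[OF tendsto_const 1] tendsto_const]]
          tendsto_add[OF tendsto_mult[OF tendsto_const tendsto_add[OF 1 tendsto_mult[OF 2 tendsto_const]]]
            tendsto_mult[OF tendsto_const 3]]]
        tendsto_add[OF 4 tendsto_mult[OF tendsto_const 5]]])
  then show ?thesis by (simp add: drift_error_def distrib_left mult.assoc)
qed

text \<open>The factor \<open>w u\<close> in the error is essential: the drift condition compares
  with \<open>x * w u\<close>, which may be arbitrarily small.\<close>

lemma drift_estimate:
  assumes w: "good_weights \<eta> K Q n w" and n: "0 < n" and \<eta>: "\<eta> \<le> 1" and U: "U \<subseteq> {1..n}"
    and m: "card ({1..n} - U) \<le> sqrt n" and u: "u \<in> {1..n}" and K: "0 < K" and t: "0 \<le> t"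
    and s: "\<bar>s\<bar> \<le> t * n powr - \<alpha>" and x: "\<bar>x\<bar> \<le> t * n powr - \<alpha>" and Q: "0 \<le> Q"
  shows "\<bar>(\<Sum>v\<in>U. edge_prob n (w u) (w v) * (exp (s + x * w v) - 1)) - w u * (s * \<mu> + x * \<nu>)\<bar>
    \<le> w u * (t * n powr - \<alpha> * (2 * \<eta> + drift_error t K Q n))"
proof -
  let ?\<tau> = "t * n powr - \<alpha>" and ?L = "K * n powr \<alpha>" and ?T = "real n powr (1 / 8)"
  let ?S = "\<Sum>v\<in>U. edge_prob n (w u) (w v) * (exp (s + x * w v) - 1)"
  let ?l = "(\<Sum>v\<in>U. w v * (s + x * w v)) / n"
  let ?D = "?\<tau> + t * K"
  let ?e1 = "exp ?D * (4 * ?\<tau> * (1 + ?L powr (1 - \<beta>) * Q) + 6 * ?L\<^sup>2 / n)"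
  let ?e2 = "sqrt n / n * (1 + 2 * ?T\<^sup>2) + 2 * Q * ?T powr - \<beta>"
  have wL: "0 \<le> w v \<and> w v \<le> ?L" if "v \<in> {1..n}" for v using w that by (auto simp: good_weights_def)
  have "\<bar>?S - w u * ?l\<bar> \<le> w u * (?\<tau> * exp ?D * (4 * ?\<tau> * (1 + ?L powr (1 - \<beta>) * Q) + 6 * ?L\<^sup>2 / n))"
  proof (rule quadratic_error[OF w n \<eta> U])
    fix v assume v: "v \<in> U"
    then have v': "0 \<le> w v" "w v \<le> ?L" using wL U by auto
    have "\<bar>s + x * w v\<bar> \<le> \<bar>s\<bar> + \<bar>x\<bar> * w v" using v' by (metis abs_mult abs_of_nonneg abs_triangle_ineq)
    also have "\<dots> \<le> ?\<tau> + ?\<tau> * ?L" using s x v' t by (intro add_mono mult_mono) auto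
    also have "\<dots> = ?D" using n by (simp add: powr_minus)
    finally show "\<bar>s + x * w v\<bar> \<le> ?D" .
  qed (use wL U u s x K in auto)
  also have "\<dots> = w u * (?\<tau> * ?e1)" by (simp add: mult_ac)
  finally have 1: "\<bar>?S - w u * ?l\<bar> \<le> w u * (?\<tau> * ?e1)" .
  have 2: "\<bar>?l - (s * \<mu> + x * \<nu>)\<bar> \<le> ?\<tau> * (2 * \<eta> + ?e2)"
  proof -
    have "\<bar>?l - (s * \<mu> + x * \<nu>)\<bar> \<le> ?\<tau> * (2 * \<eta> + card ({1..n} - U) / n * (1 + 2 * ?T\<^sup>2) + 2 * Q * ?T powr - \<beta>)"
      by (rule linear_error[OF w n U order_refl _ s x]) (use n in auto)
    also have "\<dots> \<le> ?\<tau> * (2 * \<eta> + sqrt n / n * (1 + 2 * ?T\<^sup>2) + 2 * Q * ?T powr - \<beta>)"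
      using m t by (intro mult_left_mono add_mono mult_right_mono divide_right_mono) auto
    finally show ?thesis by (simp add: add.assoc)
  qed
  have eq2: "a * (T * x1) + a * (T * (y1 + x2)) = a * (T * (y1 + (x1 + x2)))" for a T x1 x2 y1 :: real
    by (simp add: algebra_simps)
  have eq: "S - a * c = (S - a * l) + a * (l - c)" for S a c l :: real
    by (simp add: algebra_simps)
  have "\<bar>?S - w u * (s * \<mu> + x * \<nu>)\<bar> \<le> \<bar>?S - w u * ?l\<bar> + w u * \<bar>?l - (s * \<mu> + x * \<nu>)\<bar>"
    unfolding eq[of ?S "w u" "s * \<mu> + x * \<nu>" ?l] using wL[OF u] by (intro abs_add_mult_le) simp
  moreover have "w u * \<bar>?l - (s * \<mu> + x * \<nu>)\<bar> \<le> w u * (?\<tau> * (2 * \<eta> + ?e2))"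
    using 2 by (rule mult_left_mono) (use wL[OF u] in simp)
  moreover have "w u * (?\<tau> * ?e1) + w u * (?\<tau> * (2 * \<eta> + ?e2)) = w u * (?\<tau> * (2 * \<eta> + (?e1 + ?e2)))"
    by (rule eq2)
  ultimately show ?thesis unfolding drift_error_def using 1 by linarith
qed

end

section \<open>Tail bounds given the weights\<close>

abbreviation graph_prob :: "nat \<Rightarrow> (nat \<Rightarrow> real) \<Rightarrow> (nat set set \<Rightarrow> bool) \<Rightarrow> real" where
  "graph_prob n w P \<equiv> bernoulli_sum (all_edges {1..n}) (edge_weight n w) (\<lambda>E. of_bool (P E))"

lemma bernoulli_sum_Markov:
  assumes "\<And>e. e \<in> X \<Longrightarrow> 0 \<le> p e \<and> p e \<le> 1" "0 < c"
    and "\<And>E. E \<subseteq> X \<Longrightarrow> 0 \<le> f E" "\<And>E. E \<subseteq> X \<Longrightarrow> P E \<Longrightarrow> c \<le> f E"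
  shows "bernoulli_sum X p (\<lambda>E. of_bool (P E)) \<le> bernoulli_sum X p f / c"
proof -
  have "bernoulli_sum X p (\<lambda>E. c * of_bool (P E)) \<le> bernoulli_sum X p f"
    by (rule bernoulli_sum_mono[OF assms(1)]) (use assms in auto)
  then show ?thesis using assms(2) by (simp add: bernoulli_sum_cmult field_simps)
qed

context subcritical
begin

text \<open>The solution of \<mu> + C \<nu> + 1 = C: taking x as this multiple of s > 0 meets the
  drift condition with room s to spare. It also bounds |x| / |s| in
  \<open>laplace_bound\<close>.\<close>

definition "C\<^sub>0 = (1 + \<mu>) / (1 - \<nu>)"

lemma C0_ge: "1 \<le> C\<^sub>0" "0 < C\<^sub>0"
  using \<mu> \<nu> by (auto simp: C\<^sub>0_def field_simps)

lemma good_weights_edge_bounds: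
  assumes "good_weights \<eta> K Q n w" "e \<in> all_edges {1..n}"
  shows "0 \<le> edge_weight n w e \<and> edge_weight n w e \<le> 1"
  using edge_weight_bounds[of n w e] assms by (auto simp: good_weights_def)

text \<open>The coefficient \<open>- s / (1 - \<nu>)\<close> of the degree cancels the main term at
  the root. What remains is at most K t \<rho> \<le> 1, and s \<le> 1, whence \<open>exp 2\<close>
  whatever \<open>t\<close> is. The budget \<open>b\<close> is restricted only for negative
  \<open>s\<close>, where omitted vertices raise the drift.\<close>

lemma laplace_bound:
  fixes s t :: real
  assumes w: "good_weights \<eta> K Q n w" and n: "0 < n" and \<eta>: "\<eta> \<le> 1" and K: "0 < K" and Q: "0 \<le> Q"
    and t: "0 < t" and \<rho>: "0 < \<rho>" "\<rho> \<le> 1" "K * t * \<rho> \<le> 1"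
    and err: "drift_error (C\<^sub>0 * t) K Q n \<le> \<eta>" "C\<^sub>0 * (3 * \<eta>) \<le> \<rho> * (1 - \<nu>)"
    and small: "t * n powr - \<alpha> \<le> 1"
    and s: "\<bar>s\<bar> = t * n powr - \<alpha>" and b: "b \<le> sqrt n \<or> 0 \<le> s" and v: "v \<in> {1..n}"
  shows "bernoulli_sum (all_edges {1..n}) (edge_weight n w)
      (\<lambda>E. if card (reach E {v}) \<le> b
           then exp (s * card (reach E {v}) + (- s / (1 - \<nu>)) * degree {1..n} E v) else 0)
    \<le> exp 2"
proof -
  define r where "r = - s / (1 - \<nu>)"
  \<comment> \<open>The exact solution of s \<mu> + x \<nu> = x plus a slack that is positive for
    both signs of \<open>s\<close>; the slack absorbs the drift error.\<close>
  define x where "x = s * \<mu> / (1 - \<nu>) + \<bar>s\<bar> * \<rho>"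
  let ?p = "edge_weight n w"
  have wL: "0 \<le> w v \<and> w v \<le> K * n powr \<alpha>" if "v \<in> {1..n}" for v using w that by (auto simp: good_weights_def)
  have est: "(\<Sum>v\<in>U. ?p {u, v} * (exp (s' + x * w v) - 1)) \<le> w u * (s' * \<mu> + x * \<nu> + \<bar>s\<bar> * \<rho> * (1 - \<nu>))"
    if U: "U \<subseteq> {1..n}" "card ({1..n} - U) \<le> sqrt n" and u: "u \<in> {1..n}" and s': "\<bar>s'\<bar> \<le> C\<^sub>0 * \<bar>s\<bar>" for U u s'
  proof -
    have "\<bar>x\<bar> \<le> \<bar>s * \<mu> / (1 - \<nu>)\<bar> + \<bar>\<bar>s\<bar> * \<rho>\<bar>" unfolding x_def by (rule abs_triangle_ineq)
    also have "\<dots> = \<bar>s\<bar> * (\<mu> / (1 - \<nu>) + \<rho>)"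
      using \<mu> \<nu> \<rho> by (simp add: abs_mult algebra_simps)
    also have "\<dots> \<le> \<bar>s\<bar> * C\<^sub>0"
    proof (rule mult_left_mono)
      have "1 \<le> 1 / (1 - \<nu>)" using \<nu> by simp
      then show "\<mu> / (1 - \<nu>) + \<rho> \<le> C\<^sub>0" using \<rho> by (simp add: C\<^sub>0_def add_divide_distrib)
    qed simp
    finally have x_le: "\<bar>x\<bar> \<le> C\<^sub>0 * t * n powr - \<alpha>" using s by (simp add: mult_ac)
    have "\<bar>(\<Sum>v\<in>U. edge_prob n (w u) (w v) * (exp (s' + x * w v) - 1)) - w u * (s' * \<mu> + x * \<nu>)\<bar>
      \<le> w u * ((C\<^sub>0 * t) * n powr - \<alpha> * (2 * \<eta> + drift_error (C\<^sub>0 * t) K Q n))"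
      by (rule drift_estimate[OF w n \<eta> U u K]) (use t s s' x_le Q C0_ge in \<open>auto simp: mult_ac\<close>)
    also have "\<dots> \<le> w u * (\<bar>s\<bar> * \<rho> * (1 - \<nu>))"
    proof (rule mult_left_mono)
      have "(C\<^sub>0 * t) * n powr - \<alpha> * (2 * \<eta> + drift_error (C\<^sub>0 * t) K Q n) \<le> (C\<^sub>0 * t) * n powr - \<alpha> * (3 * \<eta>)"
        using err t C0_ge by (intro mult_left_mono) auto
      also have "\<dots> = \<bar>s\<bar> * (C\<^sub>0 * (3 * \<eta>))" unfolding s by (simp only: mult_ac)
      also have "\<dots> \<le> \<bar>s\<bar> * (\<rho> * (1 - \<nu>))" by (rule mult_left_mono[OF err(2)]) simp
      finally show "(C\<^sub>0 * t) * n powr - \<alpha> * (2 * \<eta> + drift_error (C\<^sub>0 * t) K Q n) \<le> \<bar>s\<bar> * \<rho> * (1 - \<nu>)"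
        by (simp only: mult.assoc)
    qed (use wL u in auto)
    finally show ?thesis unfolding edge_weight_pair distrib_left[of "w u" _ "\<bar>s\<bar> * \<rho> * (1 - \<nu>)"] by linarith
  qed
  have fix_x: "s * \<mu> + x * \<nu> + \<bar>s\<bar> * \<rho> * (1 - \<nu>) = x"
    unfolding x_def using \<nu> by (simp add: field_simps)
  have "bernoulli_sum (all_edges {1..n}) ?p
      (\<lambda>E. if card (reach E {v}) \<le> b then exp (s * card (reach E {v}) + r * degree {1..n} E v) else 0)
    \<le> exp (s + (\<Sum>u\<in>{1..n} - {v}. ?p {v, u} * (exp (r + s + x * w u) - 1)))"
  proof (rule rooted_exploration_bound[OF _ good_weights_edge_bounds[OF w] _ v])
    fix u U assume u: "u \<in> {1..n}" and U: "U \<subseteq> {1..n}" and m: "card ({1..n} - U) \<le> b"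
    have s_C: "\<bar>s\<bar> \<le> C\<^sub>0 * \<bar>s\<bar>" using C0_ge by (simp add: mult_le_cancel_right1)
    from b show "(\<Sum>v\<in>U. ?p {u, v} * (exp (s + x * w v) - 1)) \<le> x * w u"
    proof
      assume "b \<le> sqrt n"
      then have "card ({1..n} - U) \<le> sqrt n" using m by linarith
      from est[OF U this u s_C] show ?thesis unfolding fix_x by (simp add: mult_ac)
    next
      \<comment> \<open>All terms are now nonnegative, so completing \<open>U\<close> to the full
        vertex set only increases the sum.\<close>
      assume s0: "0 \<le> s"
      then have x0: "0 \<le> x" unfolding x_def using \<mu> \<nu> \<rho> by auto
      have "(\<Sum>v\<in>U. ?p {u, v} * (exp (s + x * w v) - 1)) \<le> (\<Sum>v\<in>{1..n}. ?p {u, v} * (exp (s + x * w v) - 1))"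
      proof (rule sum_mono2[OF _ U])
        fix v assume "v \<in> {1..n} - U"
        then have "0 \<le> w v" "0 \<le> w u" using wL u by auto
        then show "0 \<le> ?p {u, v} * (exp (s + x * w v) - 1)"
          unfolding edge_weight_pair using n s0 x0 by (intro mult_nonneg_nonneg edge_prob_bounds) auto
      qed simp
      also have "\<dots> \<le> x * w u"
        using est[of "{1..n}", OF _ _ u s_C] unfolding fix_x by (simp add: mult_ac)
      finally show ?thesis .
    qed
  qed auto
  also have "\<dots> \<le> exp 2"
  proof -
    have "(\<Sum>u\<in>{1..n} - {v}. ?p {v, u} * (exp (r + s + x * w u) - 1))
      \<le> w v * ((r + s) * \<mu> + x * \<nu> + \<bar>s\<bar> * \<rho> * (1 - \<nu>))"
    proof (rule est)
      have "{1..n} - ({1..n} - {v}) = {v}" using v by auto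
      then show "card ({1..n} - ({1..n} - {v})) \<le> sqrt n" using n by simp
      have "r + s = - s * (\<nu> / (1 - \<nu>))" unfolding r_def using \<nu> by (simp add: field_simps)
      then have "\<bar>r + s\<bar> = \<bar>s\<bar> * (\<nu> / (1 - \<nu>))" using \<nu> by (simp add: abs_mult)
      also have "\<dots> \<le> \<bar>s\<bar> * C\<^sub>0" using \<mu> \<nu> unfolding C\<^sub>0_def by (intro mult_left_mono divide_right_mono) auto
      finally show "\<bar>r + s\<bar> \<le> C\<^sub>0 * \<bar>s\<bar>" by (simp only: mult_ac)
    qed (use v in auto)
    \<comment> \<open>By \<open>fix_x\<close> all terms other than \<open>r * \<mu>\<close> add up
      to \<open>x\<close>, whose main part \<open>r * \<mu>\<close> cancels; only the slack
      survives.\<close>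
    also have "(r + s) * \<mu> + x * \<nu> + \<bar>s\<bar> * \<rho> * (1 - \<nu>) = r * \<mu> + x"
      using fix_x by (simp add: distrib_right)
    also have "\<dots> = \<bar>s\<bar> * \<rho>" by (simp add: r_def x_def)
    also have "w v * (\<bar>s\<bar> * \<rho>) \<le> (K * n powr \<alpha>) * (\<bar>s\<bar> * \<rho>)"
      using wL[OF v] \<rho> by (intro mult_right_mono) auto
    also have "\<dots> = K * t * \<rho>" unfolding s using n by (simp add: powr_minus)
    finally have "(\<Sum>u\<in>{1..n} - {v}. ?p {v, u} * (exp (r + s + x * w u) - 1)) \<le> 1" using \<rho> by linarith
    moreover have "s \<le> 1" using small s by linarith
    ultimately show ?thesis by simp
  qed
  finally show ?thesis unfolding r_def .
qed

text \<open>With s = x = 0 the rooted bound is the Laplace transform of the degree alone, taken at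
  n^(-\<alpha>). A budget of \<open>n\<close> is never exceeded. The 3 bounds 2\<eta> plus the drift
  error, each of them measured against \<eta> \<le> 1.\<close>

lemma degree_tail:
  fixes d :: real
  assumes w: "good_weights \<eta> K Q n w" and n: "0 < n" and \<eta>: "0 \<le> \<eta>" "\<eta> \<le> 1" and K: "0 < K" and Q: "0 \<le> Q"
    and err: "drift_error 1 K Q n \<le> \<eta>" and v: "v \<in> {1..n}"
  shows "graph_prob n w (\<lambda>E. d \<le> degree {1..n} E v) \<le> exp (K * (\<mu> + 3) - d * n powr - \<alpha>)"
proof -
  let ?p = "edge_weight n w"
  let ?r = "real n powr - \<alpha>"
  have wL: "0 \<le> w v" "w v \<le> K * n powr \<alpha>" using w v by (auto simp: good_weights_def)
  have "graph_prob n w (\<lambda>E. d \<le> degree {1..n} E v) \<le> bernoulli_sum (all_edges {1..n}) ?p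
      (\<lambda>E. if card (reach E {v}) \<le> n then exp (0 * real (card (reach E {v})) + ?r * degree {1..n} E v) else 0)
      / exp (d * n powr - \<alpha>)"
  proof (rule bernoulli_sum_Markov[OF good_weights_edge_bounds[OF w]])
    fix E assume "E \<subseteq> all_edges {1..n}" and d: "d \<le> degree {1..n} E v"
    then have "card (reach E {v}) \<le> card {1..n}"
      using reach_subset[of E "{1..n}" "{v}"] v by (intro card_mono) auto
    moreover have "?r * d \<le> ?r * degree {1..n} E v" using d by (rule mult_left_mono) simp
    ultimately show "exp (d * n powr - \<alpha>) \<le> (if card (reach E {v}) \<le> n
       then exp (0 * real (card (reach E {v})) + ?r * degree {1..n} E v) else 0)"
      by (simp add: mult.commute)
  qed auto
  also have "\<dots> \<le> exp (K * (\<mu> + 3)) / exp (d * n powr - \<alpha>)"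
  proof (rule divide_right_mono)
    have "bernoulli_sum (all_edges {1..n}) ?p
      (\<lambda>E. if card (reach E {v}) \<le> n then exp (0 * real (card (reach E {v})) + ?r * degree {1..n} E v) else 0)
      \<le> exp (0 + (\<Sum>u\<in>{1..n} - {v}. ?p {v, u} * (exp (?r + 0 + 0 * w u) - 1)))"
      by (rule rooted_exploration_bound[OF _ good_weights_edge_bounds[OF w] _ v]) auto
    also have "\<dots> \<le> exp (K * (\<mu> + 3))"
    proof -
      have "{1..n} - ({1..n} - {v}) = {v}" using v by auto
      then have "\<bar>(\<Sum>u\<in>{1..n} - {v}. edge_prob n (w v) (w u) * (exp (?r + 0 * w u) - 1)) - w v * (?r * \<mu> + 0 * \<nu>)\<bar>
        \<le> w v * (1 * n powr - \<alpha> * (2 * \<eta> + drift_error 1 K Q n))"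
        by (intro drift_estimate[OF w n \<eta>(2) _ _ v K]) (use Q n in auto)
      also have "\<dots> \<le> w v * (1 * n powr - \<alpha> * 3)"
        using wL err \<eta> by (intro mult_left_mono) auto
      finally have "(\<Sum>u\<in>{1..n} - {v}. ?p {v, u} * (exp (?r + 0 + 0 * w u) - 1)) \<le> w v * (?r * (\<mu> + 3))"
        by (simp add: edge_weight_pair algebra_simps)
      also have "\<dots> \<le> K * n powr \<alpha> * (?r * (\<mu> + 3))"
        using wL \<mu> by (intro mult_right_mono) auto
      also have "\<dots> = K * (\<mu> + 3)" using n by (simp add: powr_minus)
      finally show ?thesis by simp
    qed
    finally show "bernoulli_sum (all_edges {1..n}) ?p
      (\<lambda>E. if card (reach E {v}) \<le> n then exp (0 * real (card (reach E {v})) + ?r * degree {1..n} E v) else 0)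
      \<le> exp (K * (\<mu> + 3))" .
  qed simp
  finally show ?thesis by (simp add: exp_diff)
qed

text \<open>Three bad events share \<theta>: the upper tail with s > 0, the lower tail with s < 0
  for components of at most sqrt n vertices, and a degree of at least (1 - \<nu>) sqrt n, which any
  other failure forces.\<close>

lemma card_reach_concentration:
  assumes K: "0 < K" and Q: "0 \<le> Q" and \<epsilon>: "0 < \<epsilon>" and \<theta>: "0 < \<theta>"
  shows "\<exists>\<eta>>0. \<eta> \<le> 1 \<and> (\<forall>\<^sub>F n in sequentially. \<forall>w v. good_weights \<eta> K Q n w \<longrightarrow> v \<in> {1..n} \<longrightarrow>
     graph_prob n w (\<lambda>E. \<not> \<bar>card (reach E {v}) - degree {1..n} E v / (1 - \<nu>)\<bar> \<le> \<epsilon> * n powr \<alpha>) \<le> \<theta>)"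
proof -
  \<comment> \<open>Markov's inequality at level \<epsilon> n^\<alpha> leaves exp(2 - t \<epsilon>).
    The slack \<rho> depends on this \<open>t\<close>, and \<eta> on \<rho>.\<close>
  define t where "t = max 1 ((2 - ln (\<theta> / 3)) / \<epsilon>)"
  have t: "0 < t" by (simp add: t_def)
  have t\<epsilon>: "exp (2 - t * \<epsilon>) \<le> \<theta> / 3"
  proof -
    have "(2 - ln (\<theta> / 3)) / \<epsilon> \<le> t" by (simp add: t_def)
    then have "2 - t * \<epsilon> \<le> ln (\<theta> / 3)" using \<epsilon> by (simp add: field_simps)
    then have "exp (2 - t * \<epsilon>) \<le> exp (ln (\<theta> / 3))" by simp
    then show ?thesis using \<theta> by simp
  qed
  define \<rho> where "\<rho> = min 1 (1 / (K * t))"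
  have \<rho>: "0 < \<rho>" "\<rho> \<le> 1" "K * t * \<rho> \<le> 1"
  proof -
    show "0 < \<rho>" "\<rho> \<le> 1" using K t by (auto simp: \<rho>_def)
    have "K * t * \<rho> \<le> K * t * (1 / (K * t))" using K t by (intro mult_left_mono) (auto simp: \<rho>_def)
    then show "K * t * \<rho> \<le> 1" using K t by simp
  qed
  define \<eta> where "\<eta> = min 1 (\<rho> * (1 - \<nu>) / (3 * C\<^sub>0))"
  have \<eta>: "0 < \<eta>" "\<eta> \<le> 1" using \<rho> \<nu> C0_ge by (auto simp: \<eta>_def)
  have \<eta>C: "C\<^sub>0 * (3 * \<eta>) \<le> \<rho> * (1 - \<nu>)"
  proof -
    have "(3 * C\<^sub>0) * \<eta> \<le> (3 * C\<^sub>0) * (\<rho> * (1 - \<nu>) / (3 * C\<^sub>0))"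
      using C0_ge by (intro mult_left_mono) (auto simp: \<eta>_def)
    also have "\<dots> = \<rho> * (1 - \<nu>)" using C0_ge(2) by simp
    finally show ?thesis by (simp only: mult_ac)
  qed
  have ev1: "\<forall>\<^sub>F n in sequentially. drift_error (C\<^sub>0 * t) K Q n < \<eta>"
    by (rule order_tendstoD(2)[OF drift_error_tendsto[OF K] \<eta>(1)])
  have ev2: "\<forall>\<^sub>F n in sequentially. drift_error 1 K Q n < \<eta>"
    by (rule order_tendstoD(2)[OF drift_error_tendsto[OF K] \<eta>(1)])
  have neg: "(\<lambda>n. real n powr - \<alpha>) \<longlonglongrightarrow> 0"
    by (rule tendsto_neg_powr[OF _ filterlim_real_sequentially]) (use \<alpha> in simp)
  have ev3: "\<forall>\<^sub>F n in sequentially. t * n powr - \<alpha> < 1"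
    by (rule order_tendstoD(2)[OF tendsto_mult_right_zero[OF neg]]) simp
  have "filterlim (\<lambda>n. (1 - \<nu>) * real n powr (1 / 2 - \<alpha>)) at_top sequentially"
    using \<nu> \<alpha> by (intro filterlim_tendsto_pos_mult_at_top[OF tendsto_const] filterlim_compose[OF real_powr_at_top filterlim_real_sequentially]) auto
  then have ev4: "\<forall>\<^sub>F n in sequentially. K * (\<mu> + 3) - ln (\<theta> / 3) \<le> (1 - \<nu>) * real n powr (1 / 2 - \<alpha>)"
    by (auto simp: filterlim_at_top)
  have "\<forall>\<^sub>F n in sequentially. \<forall>w v. good_weights \<eta> K Q n w \<longrightarrow> v \<in> {1..n} \<longrightarrow>
     graph_prob n w (\<lambda>E. \<not> \<bar>card (reach E {v}) - degree {1..n} E v / (1 - \<nu>)\<bar> \<le> \<epsilon> * n powr \<alpha>) \<le> \<theta>"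
    using ev1 ev2 ev3 ev4 eventually_gt_at_top[of 0]
  proof eventually_elim
    case (elim n)
    show ?case
    proof (intro allI impI)
      fix w v assume w: "good_weights \<eta> K Q n w" and v: "v \<in> {1..n}"
      let ?p = "edge_weight n w" and ?X = "all_edges {1..n}"
      let ?c = "\<lambda>E. real (card (reach E {v}))" and ?d = "\<lambda>E. real (degree {1..n} E v)"
      define s where "s = t * n powr - \<alpha>"
      have s0: "0 < s" using t elim by (simp add: s_def)
      have s\<epsilon>: "s * (\<epsilon> * n powr \<alpha>) = t * \<epsilon>" using elim by (simp add: s_def powr_minus)
      define b where "b = nat \<lfloor>sqrt n\<rfloor>"
      have b: "b \<le> sqrt n" by (simp add: b_def)
      have upper: "graph_prob n w (\<lambda>E. \<epsilon> * n powr \<alpha> < ?c E - ?d E / (1 - \<nu>)) \<le> \<theta> / 3"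
      proof -
        have "graph_prob n w (\<lambda>E. \<epsilon> * n powr \<alpha> < ?c E - ?d E / (1 - \<nu>))
          \<le> bernoulli_sum ?X ?p (\<lambda>E. if card (reach E {v}) \<le> n then exp (s * ?c E + (- s / (1 - \<nu>)) * ?d E) else 0)
            / exp (t * \<epsilon>)"
        proof (rule bernoulli_sum_Markov[OF good_weights_edge_bounds[OF w]])
          fix E assume E: "E \<subseteq> ?X" and *: "\<epsilon> * n powr \<alpha> < ?c E - ?d E / (1 - \<nu>)"
          have "card (reach E {v}) \<le> card {1..n}"
            using reach_subset[of E "{1..n}" "{v}"] v E by (intro card_mono) auto
          moreover have "s * (\<epsilon> * n powr \<alpha>) \<le> s * (?c E - ?d E / (1 - \<nu>))"
            using * s0 by (intro mult_left_mono) auto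
          ultimately show "exp (t * \<epsilon>) \<le> (if card (reach E {v}) \<le> n then exp (s * ?c E + (- s / (1 - \<nu>)) * ?d E) else 0)"
            unfolding s\<epsilon> by (simp add: algebra_simps)
        qed auto
        also have "\<dots> \<le> exp 2 / exp (t * \<epsilon>)"
          using elim \<eta> \<rho> \<eta>C K Q t v s0 by (intro divide_right_mono laplace_bound[OF w, of t \<rho>]) (auto simp: s_def)
        finally show ?thesis using t\<epsilon> unfolding exp_diff by (rule order_trans)
      qed
      have lower: "graph_prob n w (\<lambda>E. card (reach E {v}) \<le> b \<and> \<epsilon> * n powr \<alpha> < ?d E / (1 - \<nu>) - ?c E) \<le> \<theta> / 3"
      proof -
        have "graph_prob n w (\<lambda>E. card (reach E {v}) \<le> b \<and> \<epsilon> * n powr \<alpha> < ?d E / (1 - \<nu>) - ?c E)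
          \<le> bernoulli_sum ?X ?p (\<lambda>E. if card (reach E {v}) \<le> b then exp (- s * ?c E + (- (- s) / (1 - \<nu>)) * ?d E) else 0)
            / exp (t * \<epsilon>)"
        proof (rule bernoulli_sum_Markov[OF good_weights_edge_bounds[OF w]])
          fix E assume *: "card (reach E {v}) \<le> b \<and> \<epsilon> * n powr \<alpha> < ?d E / (1 - \<nu>) - ?c E"
          then have "s * (\<epsilon> * n powr \<alpha>) \<le> s * (?d E / (1 - \<nu>) - ?c E)"
            using s0 by (intro mult_left_mono) auto
          then show "exp (t * \<epsilon>) \<le> (if card (reach E {v}) \<le> b then exp (- s * ?c E + (- (- s) / (1 - \<nu>)) * ?d E) else 0)"
            unfolding s\<epsilon> using * by (simp add: algebra_simps)
        qed auto
        also have "\<dots> \<le> exp 2 / exp (t * \<epsilon>)"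
          using elim \<eta> \<rho> \<eta>C K Q t v s0 b by (intro divide_right_mono laplace_bound[OF w, of t \<rho>]) (auto simp: s_def)
        finally show ?thesis using t\<epsilon> unfolding exp_diff by (rule order_trans)
      qed
      \<comment> \<open>The exponent contains -(1 - \<nu>) n^(1/2 - \<alpha>), which tends to minus
        infinity since n^\<alpha> is of smaller order than sqrt n.\<close>
      have deg: "graph_prob n w (\<lambda>E. (1 - \<nu>) * sqrt n \<le> degree {1..n} E v) \<le> \<theta> / 3"
      proof -
        have "graph_prob n w (\<lambda>E. (1 - \<nu>) * sqrt n \<le> degree {1..n} E v)
          \<le> exp (K * (\<mu> + 3) - (1 - \<nu>) * sqrt n * n powr - \<alpha>)"
          by (rule degree_tail[OF w _ _ _ K Q _ v]) (use elim \<eta> in auto)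
        also have "sqrt n * n powr - \<alpha> = real n powr (1 / 2 - \<alpha>)"
          using elim by (simp add: powr_half_sqrt[symmetric] powr_add[symmetric])
        then have "(1 - \<nu>) * sqrt n * n powr - \<alpha> = (1 - \<nu>) * real n powr (1 / 2 - \<alpha>)" by simp
        then have "K * (\<mu> + 3) - (1 - \<nu>) * sqrt n * n powr - \<alpha> \<le> ln (\<theta> / 3)" using elim by linarith
        then have "exp (K * (\<mu> + 3) - (1 - \<nu>) * sqrt n * n powr - \<alpha>) \<le> exp (ln (\<theta> / 3))" by simp
        finally show ?thesis using \<theta> by simp
      qed
      have "graph_prob n w (\<lambda>E. \<not> \<bar>?c E - ?d E / (1 - \<nu>)\<bar> \<le> \<epsilon> * n powr \<alpha>)
        \<le> bernoulli_sum ?X ?p (\<lambda>E. (of_bool (\<epsilon> * n powr \<alpha> < ?c E - ?d E / (1 - \<nu>))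
          + of_bool (card (reach E {v}) \<le> b \<and> \<epsilon> * n powr \<alpha> < ?d E / (1 - \<nu>) - ?c E))
          + of_bool ((1 - \<nu>) * sqrt n \<le> degree {1..n} E v))"
      proof (rule bernoulli_sum_mono[OF good_weights_edge_bounds[OF w]])
        fix E
        have "(1 - \<nu>) * sqrt n \<le> degree {1..n} E v"
          if "\<not> card (reach E {v}) \<le> b" "\<epsilon> * n powr \<alpha> < ?d E / (1 - \<nu>) - ?c E"
        proof -
          have "sqrt n \<le> ?c E" using that(1) unfolding b_def by linarith
          also have "\<dots> \<le> ?d E / (1 - \<nu>)" using that(2) \<epsilon> mult_nonneg_nonneg[of \<epsilon> "n powr \<alpha>"] powr_ge_zero[of n \<alpha>] by linarith
          finally show ?thesis using \<nu> by (simp add: field_simps)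
        qed
        then show "(of_bool (\<not> \<bar>?c E - ?d E / (1 - \<nu>)\<bar> \<le> \<epsilon> * n powr \<alpha>) :: real)
         \<le> of_bool (\<epsilon> * n powr \<alpha> < ?c E - ?d E / (1 - \<nu>))
          + of_bool (card (reach E {v}) \<le> b \<and> \<epsilon> * n powr \<alpha> < ?d E / (1 - \<nu>) - ?c E)
          + of_bool ((1 - \<nu>) * sqrt n \<le> degree {1..n} E v)"
          by (auto simp: of_bool_def abs_le_iff not_le)
      qed
      also have "\<dots> \<le> \<theta>" unfolding bernoulli_sum_add using upper lower deg by linarith
      finally show "graph_prob n w (\<lambda>E. \<not> \<bar>?c E - ?d E / (1 - \<nu>)\<bar> \<le> \<epsilon> * n powr \<alpha>) \<le> \<theta>" .
    qed
  qed
  then show ?thesis using \<eta> by blast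
qed

text \<open>Among the vertices of weight at most \<open>\<delta> n\<^sup>\<alpha>\<close> the Laplace parameter may be taken of the larger
  order \<open>ln n / n\<^sup>\<alpha>\<close>; this makes the failure probability of a single vertex \<open>o(1/n)\<close>.\<close>

lemma small_vertices_components:
  assumes \<epsilon>: "0 < \<epsilon>"
  shows "\<exists>\<delta>>0. \<exists>\<eta>>0. \<eta> \<le> 1 \<and> (\<forall>K Q \<theta>. 0 \<le> Q \<longrightarrow> 0 < \<theta> \<longrightarrow>
    (\<forall>\<^sub>F n in sequentially. \<forall>w. good_weights \<eta> K Q n w \<longrightarrow>
      graph_prob n w (\<lambda>E. \<exists>v\<in>{v \<in> {1..n}. w v \<le> \<delta> * n powr \<alpha>}.
        \<epsilon> * n powr \<alpha> < card (reach (E \<inter> all_edges {v \<in> {1..n}. w v \<le> \<delta> * n powr \<alpha>}) {v})) \<le> \<theta>))"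
proof -
  \<comment> \<open>With s = b ln n / n^\<alpha> Markov's inequality gains n^(-3). The Laplace
    transform costs at most e n^\<kappa> \<le> e n, so each vertex fails with probability at most e
    n^(-2), and the union bound leaves e / n.\<close>
  define b where "b = 3 / \<epsilon>"
  \<comment> \<open>The errors are now multiplied by n^\<kappa>, so \<kappa> has to stay below the
    decay exponents \<alpha>, \<alpha>\<beta> and 1 - 2\<alpha>.\<close>
  define \<kappa> where "\<kappa> = min (\<alpha> * \<beta> / 2) ((1 - 2 * \<alpha>) / 2)"
  \<comment> \<open>Chosen so that \<open>x * w v\<close> is at most \<kappa> ln n for every light
    vertex.\<close>
  define \<delta> where "\<delta> = \<kappa> / (C\<^sub>0 * b)"
  \<comment> \<open>The room s in the drift condition is shared equally: \<eta> (1 +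
    \<open>C\<^sub>0\<close>) = 1/2 pays for the empirical moments, and \<open>err\<close> < 1/2 for
    the quadratic error.\<close>
  define \<eta> where "\<eta> = 1 / (2 * (1 + C\<^sub>0))"
  have b: "0 < b" using \<epsilon> by (simp add: b_def)
  have \<kappa>: "0 < \<kappa>" "\<kappa> \<le> \<alpha> * \<beta> / 2" "\<kappa> \<le> (1 - 2 * \<alpha>) / 2" "\<kappa> < \<alpha>" "\<kappa> < 1"
  proof -
    show *: "0 < \<kappa>" using \<alpha> \<beta> by (simp add: \<kappa>_def)
    show **: "\<kappa> \<le> \<alpha> * \<beta> / 2" "\<kappa> \<le> (1 - 2 * \<alpha>) / 2"
      unfolding \<kappa>_def by (rule min.cobounded1, rule min.cobounded2)
    have "\<alpha> * \<beta> \<le> \<alpha> * 1" using \<alpha> \<beta> by (intro mult_left_mono) auto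
    then show "\<kappa> < \<alpha>" "\<kappa> < 1" using * ** \<alpha> by linarith+
  qed
  have \<delta>: "0 < \<delta>" using \<kappa> C0_ge b by (simp add: \<delta>_def)
  have \<eta>: "0 < \<eta>" "\<eta> \<le> 1" "\<eta> * (1 + C\<^sub>0) = 1 / 2" using C0_ge by (auto simp: \<eta>_def field_simps)
  define \<tau> where "\<tau> = (\<lambda>n::nat. C\<^sub>0 * (b * ln n * n powr - \<alpha>))"
  \<comment> \<open>The error of \<open>quadratic_error\<close> for the light vertices, divided by
    \<open>s\<close>; n^\<kappa> stems from exp(\<kappa> ln n).\<close>
  define err where "err = (\<lambda>Q (n::nat). C\<^sub>0 * (exp 1 * n powr \<kappa> * (4 * \<tau> n * (1 + (\<delta> * n powr \<alpha>) powr (1 - \<beta>) * Q)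
      + 6 * (\<delta> * n powr \<alpha>)\<^sup>2 / n)))"
  have neg: "(\<lambda>n. real n powr r) \<longlonglongrightarrow> 0" if "r < 0" for r
    by (rule tendsto_neg_powr[OF that filterlim_real_sequentially])
  have lnneg: "(\<lambda>n. ln (real n) * real n powr r) \<longlonglongrightarrow> 0" if "r < 0" for r
  proof -
    have "((\<lambda>n. ln (real n) / real n powr (- r)) \<longlongrightarrow> 0) sequentially"
      by (rule lim_ln_over_power) (use that in simp)
    then show ?thesis by (simp add: powr_minus field_simps)
  qed
  have err0: "(\<lambda>n. err Q n) \<longlonglongrightarrow> 0" for Q
  proof -
    have 1: "(\<lambda>n. ln (real n) * real n powr (\<kappa> - \<alpha>)) \<longlonglongrightarrow> 0" using \<kappa> by (intro lnneg) simp
    have 2: "(\<lambda>n. ln (real n) * real n powr (\<kappa> - \<alpha> * \<beta>)) \<longlonglongrightarrow> 0"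
    proof (rule lnneg)
      have "0 < \<alpha> * \<beta>" using \<alpha> \<beta> by simp
      then show "\<kappa> - \<alpha> * \<beta> < 0" using \<kappa>(2) by linarith
    qed
    have 3: "(\<lambda>n. real n powr (\<kappa> + 2 * \<alpha> - 1)) \<longlonglongrightarrow> 0"
    proof (rule neg)
      have "\<kappa> \<le> 1 / 2 - \<alpha>" using \<kappa>(3) by (simp add: field_simps)
      then show "\<kappa> + 2 * \<alpha> - 1 < 0" using \<alpha>(2) by simp
    qed
    have "(\<lambda>n. C\<^sub>0 * (exp 1 * (4 * C\<^sub>0 * b * (ln n * n powr (\<kappa> - \<alpha>) + ln n * n powr (\<kappa> - \<alpha> * \<beta>) * (\<delta> powr (1 - \<beta>) * Q))
        + 6 * \<delta>\<^sup>2 * n powr (\<kappa> + 2 * \<alpha> - 1))))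
      \<longlonglongrightarrow> C\<^sub>0 * (exp 1 * (4 * C\<^sub>0 * b * (0 + 0 * (\<delta> powr (1 - \<beta>) * Q)) + 6 * \<delta>\<^sup>2 * 0))"
      by (rule tendsto_mult[OF tendsto_const tendsto_mult[OF tendsto_const tendsto_add[OF
            tendsto_mult[OF tendsto_const tendsto_add[OF 1 tendsto_mult[OF 2 tendsto_const]]]
            tendsto_mult[OF tendsto_const 3]]]])
    moreover have "\<forall>\<^sub>F n in sequentially. C\<^sub>0 * (exp 1 * (4 * C\<^sub>0 * b * (ln n * n powr (\<kappa> - \<alpha>) + ln n * n powr (\<kappa> - \<alpha> * \<beta>) * (\<delta> powr (1 - \<beta>) * Q))
        + 6 * \<delta>\<^sup>2 * n powr (\<kappa> + 2 * \<alpha> - 1))) = err Q n"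
      using eventually_gt_at_top[of 0]
    proof eventually_elim
      case (elim n)
      have "real n powr (\<kappa> - \<alpha>) = n powr \<kappa> * n powr - \<alpha>" by (simp flip: powr_add)
      moreover have "\<kappa> - \<alpha> * \<beta> = \<kappa> + - \<alpha> + \<alpha> * (1 - \<beta>)" by (simp add: algebra_simps)
      then have "real n powr (\<kappa> - \<alpha> * \<beta>) = n powr \<kappa> * n powr - \<alpha> * n powr (\<alpha> * (1 - \<beta>))" by (metis powr_add)
      moreover have "real n powr (\<kappa> + 2 * \<alpha> - 1) = n powr \<kappa> * (n powr \<alpha>)\<^sup>2 / n"
        unfolding powr_diff powr_add mult_2 using elim by (simp add: power2_eq_square)
      moreover have "(\<delta> * n powr \<alpha>) powr (1 - \<beta>) = \<delta> powr (1 - \<beta>) * real n powr (\<alpha> * (1 - \<beta>))"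
        using \<delta> by (simp add: powr_mult powr_powr)
      ultimately show ?case unfolding err_def \<tau>_def power_mult_distrib
        by (simp add: algebra_simps)
    qed
    ultimately show ?thesis by (simp add: Lim_transform_eventually)
  qed
  have "\<forall>\<^sub>F n in sequentially. \<forall>w. good_weights \<eta> K Q n w \<longrightarrow>
      graph_prob n w (\<lambda>E. \<exists>v\<in>{v \<in> {1..n}. w v \<le> \<delta> * n powr \<alpha>}.
        \<epsilon> * n powr \<alpha> < card (reach (E \<inter> all_edges {v \<in> {1..n}. w v \<le> \<delta> * n powr \<alpha>}) {v})) \<le> \<theta>"
    if Q: "0 \<le> Q" and \<theta>: "0 < \<theta>" for K Q \<theta>
  proof -
    have ev1: "\<forall>\<^sub>F n in sequentially. err Q n < 1 / 2" by (rule order_tendstoD(2)[OF err0]) simp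
    have "(\<lambda>n. b * (ln n * n powr - \<alpha>)) \<longlonglongrightarrow> 0"
      using \<alpha> by (intro tendsto_mult_right_zero lnneg) simp
    then have ev2: "\<forall>\<^sub>F n in sequentially. b * (ln n * n powr - \<alpha>) < 1" by (rule order_tendstoD(2)) simp
    have "(\<lambda>n. exp 1 * real n powr - 1) \<longlonglongrightarrow> 0" by (intro tendsto_mult_right_zero neg) simp
    then have ev3: "\<forall>\<^sub>F n in sequentially. exp 1 * real n powr - 1 < \<theta>" by (rule order_tendstoD(2)) (rule \<theta>)
    show ?thesis using ev1 ev2 ev3 eventually_gt_at_top[of 1]
    proof eventually_elim
      case (elim n)
      then have n: "0 < n" and ln0: "0 < ln (real n)" by auto
      show ?case
      proof (intro allI impI)
        fix w assume w: "good_weights \<eta> K Q n w"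
        define S where "S = {v \<in> {1..n}. w v \<le> \<delta> * n powr \<alpha>}"
        have S: "S \<subseteq> {1..n}" by (auto simp: S_def)
        have finS: "finite S" using S finite_subset by auto
        have wL: "0 \<le> w v" "w v \<le> \<delta> * n powr \<alpha>" if "v \<in> S" for v
          using that w by (auto simp: S_def good_weights_def)
        let ?p = "edge_weight n w"
        note p01 = good_weights_edge_bounds[OF w]
        define s where "s = b * ln n * n powr - \<alpha>"
        define x where "x = C\<^sub>0 * s"
        have s: "0 < s" "s \<le> 1" using b ln0 n elim by (auto simp: s_def mult.assoc)
        have x: "0 < x" "s \<le> x" using s C0_ge by (auto simp: x_def mult_le_cancel_right1)
        have x\<tau>: "\<tau> n = x" by (simp add: x_def \<tau>_def s_def)
        have xw: "s + x * w v \<le> 1 + \<kappa> * ln n" if "v \<in> S" for v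
        proof -
          have "x * w v \<le> x * (\<delta> * n powr \<alpha>)" using wL[OF that] x by (intro mult_left_mono) auto
          also have "\<dots> = \<kappa> * ln n"
            using n C0_ge b unfolding x_def s_def \<delta>_def by (simp add: powr_minus)
          finally show ?thesis using s by linarith
        qed
        have drift: "(\<Sum>v\<in>U. ?p {u, v} * (exp (s + x * w v) - 1)) \<le> x * w u"
          if u: "u \<in> S" and U: "U \<subseteq> S" for u U
        proof -
          have "\<bar>(\<Sum>v\<in>U. edge_prob n (w u) (w v) * (exp (s + x * w v) - 1))
              - w u * ((\<Sum>v\<in>U. w v * (s + x * w v)) / n)\<bar>
            \<le> w u * (x * exp (1 + \<kappa> * ln n) * (4 * x * (1 + (\<delta> * n powr \<alpha>) powr (1 - \<beta>) * Q) + 6 * (\<delta> * n powr \<alpha>)\<^sup>2 / n))"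
          proof (rule quadratic_error[OF w n \<eta>(2)])
            fix v assume v: "v \<in> U"
            then have "0 \<le> s + x * w v" using U wL s x by (intro add_nonneg_nonneg mult_nonneg_nonneg) auto
            then show "\<bar>s + x * w v\<bar> \<le> 1 + \<kappa> * ln n" using xw v U by auto
          qed (use U S wL u s x \<delta> in auto)
          also have "x * exp (1 + \<kappa> * ln n) * (4 * x * (1 + (\<delta> * n powr \<alpha>) powr (1 - \<beta>) * Q) + 6 * (\<delta> * n powr \<alpha>)\<^sup>2 / n)
            = s * err Q n"
            unfolding err_def x\<tau> x_def using n by (simp add: exp_add powr_def mult_ac)
          also have "w u * (s * err Q n) \<le> w u * (s * (1 / 2))"
            using elim wL[OF u] s by (intro mult_left_mono) auto
          finally have "(\<Sum>v\<in>U. ?p {u, v} * (exp (s + x * w v) - 1))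
             \<le> w u * ((\<Sum>v\<in>U. w v * (s + x * w v)) / n) + w u * (s * (1 / 2))"
            unfolding edge_weight_pair by linarith
          also have "w u * ((\<Sum>v\<in>U. w v * (s + x * w v)) / n) \<le> w u * (s * (\<mu> + \<eta>) + x * (\<nu> + \<eta>))"
          proof (rule mult_left_mono)
            have "(\<Sum>v\<in>U. w v * (s + x * w v)) \<le> (\<Sum>v=1..n. w v * (s + x * w v))"
              using U S w s x by (intro sum_mono2) (auto simp: good_weights_def)
            also have "\<dots> = s * (\<Sum>v=1..n. w v) + x * (\<Sum>v=1..n. (w v)\<^sup>2)"
              by (simp add: sum_distrib_left sum.distrib[symmetric] algebra_simps power2_eq_square)
            finally have "(\<Sum>v\<in>U. w v * (s + x * w v)) / n \<le> (s * (\<Sum>v=1..n. w v) + x * (\<Sum>v=1..n. (w v)\<^sup>2)) / n"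
              by (rule divide_right_mono) simp
            also have "\<dots> = s * ((\<Sum>v=1..n. w v) / n) + x * ((\<Sum>v=1..n. (w v)\<^sup>2) / n)"
              by (simp add: add_divide_distrib)
            also have "\<dots> \<le> s * (\<mu> + \<eta>) + x * (\<nu> + \<eta>)"
              using w s x by (intro add_mono mult_left_mono) (auto simp: good_weights_def)
            finally show "(\<Sum>v\<in>U. w v * (s + x * w v)) / n \<le> s * (\<mu> + \<eta>) + x * (\<nu> + \<eta>)" .
          qed (rule wL[OF u])
          also have "w u * (s * (\<mu> + \<eta>) + x * (\<nu> + \<eta>)) + w u * (s * (1 / 2)) = x * w u"
          proof -
            have "\<mu> + C\<^sub>0 * \<nu> + 1 = C\<^sub>0" unfolding C\<^sub>0_def using \<nu> by (simp add: field_simps)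
            then have C: "\<mu> + C\<^sub>0 * \<nu> = C\<^sub>0 - 1" by simp
            have "s * (\<mu> + \<eta>) + x * (\<nu> + \<eta>) + s * (1 / 2) = s * (C\<^sub>0 - 1 + \<eta> * (1 + C\<^sub>0) + 1 / 2)"
              unfolding x_def C[symmetric] by (simp add: algebra_simps)
            also have "\<dots> = x" unfolding \<eta>(3) x_def by simp
            finally have "w u * (s * (\<mu> + \<eta>) + x * (\<nu> + \<eta>) + s * (1 / 2)) = w u * x" by simp
            then show ?thesis by (simp add: algebra_simps)
          qed
          finally show ?thesis by simp
        qed
        have vertex: "graph_prob n w (\<lambda>E. \<epsilon> * n powr \<alpha> < card (reach (E \<inter> all_edges S) {v})) \<le> exp 1 * n powr - 2"
          if v: "v \<in> S" for v
        proof -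
          have "graph_prob n w (\<lambda>E. \<epsilon> * n powr \<alpha> < card (reach (E \<inter> all_edges S) {v}))
             = bernoulli_sum (all_edges S) ?p (\<lambda>E. of_bool (\<epsilon> * n powr \<alpha> < card (reach E {v})))"
            by (rule bernoulli_sum_subset[OF _ all_edges_mono[OF S]]) (simp add: finite_all_edges)
          also have "\<dots> \<le> bernoulli_sum (all_edges S) ?p
              (\<lambda>E. if card (reach E {v}) \<le> card S then exp (s * card (reach E {v})) else 0) / exp (s * (\<epsilon> * n powr \<alpha>))"
          proof (rule bernoulli_sum_Markov)
            fix e assume "e \<in> all_edges S"
            then show "0 \<le> ?p e \<and> ?p e \<le> 1" using p01 all_edges_mono[OF S] by auto
          next
            fix E assume E: "E \<subseteq> all_edges S" and *: "\<epsilon> * n powr \<alpha> < card (reach E {v})"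
            have "card (reach E {v}) \<le> card S"
              using reach_subset[of E S "{v}"] v E finS by (intro card_mono) auto
            moreover have "s * (\<epsilon> * n powr \<alpha>) \<le> s * card (reach E {v})"
              using * s by (intro mult_left_mono) auto
            ultimately show "exp (s * (\<epsilon> * n powr \<alpha>))
              \<le> (if card (reach E {v}) \<le> card S then exp (s * card (reach E {v})) else 0)" by simp
          qed auto
          also have "\<dots> \<le> exp (1 + \<kappa> * ln n) / exp (s * (\<epsilon> * n powr \<alpha>))"
          proof (rule divide_right_mono)
            have "bernoulli_sum (all_edges S) ?p
              (\<lambda>E. if card (reach E {v}) \<le> card S then exp (s * card (reach E {v})) else 0)
              \<le> (\<Prod>u\<in>{v}. exp (s + x * w u))"
            \<comment> \<open>A budget of \<open>card S\<close> imposes no cutoff;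
              \<open>drift\<close> holds for all subsets of \<open>S\<close> because
              \<open>s\<close> and \<open>x\<close> are positive.\<close>
            proof (rule exploration_bound[OF finS, where M = "card S"])
              fix e assume "e \<in> all_edges S"
              then show "0 \<le> ?p e \<and> ?p e \<le> 1" using p01 all_edges_mono[OF S] by auto
            qed (use drift v in auto)
            then show "bernoulli_sum (all_edges S) ?p
              (\<lambda>E. if card (reach E {v}) \<le> card S then exp (s * card (reach E {v})) else 0)
              \<le> exp (1 + \<kappa> * ln n)" using xw[OF v] by (auto intro: order_trans)
          qed simp
          also have "\<dots> \<le> exp (1 + - 2 * ln n)"
          proof -
            have "s * (\<epsilon> * n powr \<alpha>) = 3 * ln n"
              using n \<epsilon> unfolding s_def b_def by (simp add: powr_minus)
            moreover have "\<kappa> * ln n \<le> 1 * ln n" using \<kappa> ln0 by (intro mult_right_mono) auto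
            ultimately show ?thesis unfolding exp_diff[symmetric] by simp
          qed
          also have "\<dots> = exp 1 * n powr - 2" unfolding exp_add powr_def using n by simp
          finally show ?thesis .
        qed
        have "graph_prob n w (\<lambda>E. \<exists>v\<in>S. \<epsilon> * n powr \<alpha> < card (reach (E \<inter> all_edges S) {v}))
          \<le> bernoulli_sum (all_edges {1..n}) ?p (\<lambda>E. \<Sum>v\<in>S. of_bool (\<epsilon> * n powr \<alpha> < card (reach (E \<inter> all_edges S) {v})))"
        proof (rule bernoulli_sum_mono[OF p01])
          fix E
          show "(of_bool (\<exists>v\<in>S. \<epsilon> * n powr \<alpha> < card (reach (E \<inter> all_edges S) {v})) :: real)
            \<le> (\<Sum>v\<in>S. of_bool (\<epsilon> * n powr \<alpha> < card (reach (E \<inter> all_edges S) {v})))"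
          proof (cases "\<exists>v\<in>S. \<epsilon> * n powr \<alpha> < card (reach (E \<inter> all_edges S) {v})")
            case True
            then obtain v where v: "v \<in> S" "\<epsilon> * n powr \<alpha> < card (reach (E \<inter> all_edges S) {v})" by auto
            then have "(of_bool (\<epsilon> * n powr \<alpha> < card (reach (E \<inter> all_edges S) {v})) :: real)
              \<le> (\<Sum>v\<in>S. of_bool (\<epsilon> * n powr \<alpha> < card (reach (E \<inter> all_edges S) {v})))"
              using finS by (intro member_le_sum) auto
            then show ?thesis using v by auto
          qed (simp add: sum_nonneg)
        qed
        also have "\<dots> \<le> (\<Sum>v\<in>S. exp 1 * n powr - 2)"
          unfolding bernoulli_sum_sum by (rule sum_mono[OF vertex])
        also have "\<dots> \<le> n * (exp 1 * n powr - 2)"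
          using card_mono[OF _ S] by (simp add: mult_right_mono)
        also have "\<dots> = exp 1 * n powr - 1" using n by (simp add: powr_minus power2_eq_square)
        also have "\<dots> \<le> \<theta>" using elim by simp
        finally show "graph_prob n w (\<lambda>E. \<exists>v\<in>{v \<in> {1..n}. w v \<le> \<delta> * n powr \<alpha>}.
          \<epsilon> * n powr \<alpha> < card (reach (E \<inter> all_edges {v \<in> {1..n}. w v \<le> \<delta> * n powr \<alpha>}) {v})) \<le> \<theta>"
          unfolding S_def .
      qed
    qed
  qed
  then show ?thesis using \<delta> \<eta>(1,2) by blast
qed

text \<open>The order of quantifiers matters: \<delta> decides how many vertices count as heavy, so
  \<open>R\<close> can only be chosen after it. The accuracy \<eta> comes last and may depend on
  everything, as the law of large numbers provides any \<eta> > 0.\<close>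

lemma largest_component_given_weights:
  assumes \<epsilon>: "0 < \<epsilon>" and \<theta>: "0 < \<theta>"
  shows "\<exists>\<delta>>0. \<forall>K>0. \<forall>Q\<ge>0. \<forall>R::nat. \<exists>\<eta>>0. \<forall>\<^sub>F n in sequentially. \<forall>w.
    good_weights \<eta> K Q n w \<longrightarrow> card {v \<in> {1..n}. \<delta> * n powr \<alpha> < w v} \<le> R \<longrightarrow>
    graph_prob n w (\<lambda>E. \<epsilon> * n powr \<alpha> <
      \<bar>card (largest_component {1..n} E) - max_degree {1..n} E / (1 - \<nu>)\<bar>) \<le> \<theta>"
proof -
  \<comment> \<open>Makes the two occurrences of the error in
    \<open>largest_component_max_degree\<close> add up to at most \<epsilon>/2; the other half
    covers R / (1 - \<nu>).\<close>
  define \<epsilon>' where "\<epsilon>' = \<epsilon> * (1 - \<nu>) / 4"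
  have \<epsilon>': "0 < \<epsilon>'" "\<epsilon>' + \<epsilon>' / (1 - \<nu>) \<le> \<epsilon> / 2"
  proof -
    show "0 < \<epsilon>'" using \<epsilon> \<nu> by (simp add: \<epsilon>'_def)
    have "\<epsilon>' \<le> \<epsilon> / 4" using \<epsilon> \<nu> by (simp add: \<epsilon>'_def mult_le_cancel_left2)
    moreover have "\<epsilon>' / (1 - \<nu>) = \<epsilon> / 4"
    proof -
      have "\<epsilon>' = \<epsilon> / 4 * (1 - \<nu>)" by (simp add: \<epsilon>'_def)
      moreover have "1 - \<nu> \<noteq> 0" using \<nu> by simp
      ultimately show ?thesis by (metis nonzero_mult_div_cancel_right)
    qed
    ultimately show "\<epsilon>' + \<epsilon>' / (1 - \<nu>) \<le> \<epsilon> / 2" by simp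
  qed
  from small_vertices_components[OF \<epsilon>'(1)] obtain \<delta> \<eta>1 where \<delta>: "0 < \<delta>" and \<eta>1: "0 < \<eta>1"
    and small: "\<And>K Q \<theta>. 0 \<le> Q \<Longrightarrow> 0 < \<theta> \<Longrightarrow> \<forall>\<^sub>F n in sequentially. \<forall>w. good_weights \<eta>1 K Q n w \<longrightarrow>
      graph_prob n w (\<lambda>E. \<exists>v\<in>{v \<in> {1..n}. w v \<le> \<delta> * n powr \<alpha>}.
        \<epsilon>' * n powr \<alpha> < card (reach (E \<inter> all_edges {v \<in> {1..n}. w v \<le> \<delta> * n powr \<alpha>}) {v})) \<le> \<theta>"
    by blast
  have "\<exists>\<eta>>0. \<forall>\<^sub>F n in sequentially. \<forall>w.
    good_weights \<eta> K Q n w \<longrightarrow> card {v \<in> {1..n}. \<delta> * n powr \<alpha> < w v} \<le> R \<longrightarrow>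
    graph_prob n w (\<lambda>E. \<epsilon> * n powr \<alpha> <
      \<bar>card (largest_component {1..n} E) - max_degree {1..n} E / (1 - \<nu>)\<bar>) \<le> \<theta>"
    if K: "0 < K" and Q: "0 \<le> Q" for K Q and R :: nat
  proof -
    \<comment> \<open>The share of one heavy vertex in a union bound over at most \<open>R\<close>;
      the extra 1 keeps the denominator positive.\<close>
    have \<theta>R: "0 < \<theta> / (2 * (R + 1))" using \<theta> by simp
    from card_reach_concentration[OF K Q \<epsilon>'(1) \<theta>R] obtain \<eta>2 where \<eta>2: "0 < \<eta>2" and
      big: "\<forall>\<^sub>F n in sequentially. \<forall>w v. good_weights \<eta>2 K Q n w \<longrightarrow> v \<in> {1..n} \<longrightarrow>
       graph_prob n w (\<lambda>E. \<not> \<bar>card (reach E {v}) - degree {1..n} E v / (1 - \<nu>)\<bar> \<le> \<epsilon>' * n powr \<alpha>) \<le> \<theta> / (2 * (R + 1))"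
      by blast
    define \<eta> where "\<eta> = min \<eta>1 \<eta>2"
    have \<eta>: "0 < \<eta>" using \<eta>1 \<eta>2 by (simp add: \<eta>_def)
    have "filterlim (\<lambda>n. \<epsilon> / 2 * real n powr \<alpha>) at_top sequentially"
      using \<epsilon> \<alpha> by (intro filterlim_tendsto_pos_mult_at_top[OF tendsto_const] filterlim_compose[OF real_powr_at_top filterlim_real_sequentially]) auto
    then have ev: "\<forall>\<^sub>F n in sequentially. R / (1 - \<nu>) \<le> \<epsilon> / 2 * real n powr \<alpha>"
      unfolding filterlim_at_top by (rule spec)
    have "\<forall>\<^sub>F n in sequentially. \<forall>w.
      good_weights \<eta> K Q n w \<longrightarrow> card {v \<in> {1..n}. \<delta> * n powr \<alpha> < w v} \<le> R \<longrightarrow>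
      graph_prob n w (\<lambda>E. \<epsilon> * n powr \<alpha> <
        \<bar>card (largest_component {1..n} E) - max_degree {1..n} E / (1 - \<nu>)\<bar>) \<le> \<theta>"
      using small[OF Q half_gt_zero[OF \<theta>], of K] big ev eventually_gt_at_top[of 0]
    proof eventually_elim
      case (elim n)
      show ?case
      proof (intro allI impI)
        fix w assume w: "good_weights \<eta> K Q n w" and R: "card {v \<in> {1..n}. \<delta> * n powr \<alpha> < w v} \<le> R"
        have w1: "good_weights \<eta>1 K Q n w" and w2: "good_weights \<eta>2 K Q n w"
          by (rule good_weights_mono[OF w], simp add: \<eta>_def)+
        define S where "S = {v \<in> {1..n}. w v \<le> \<delta> * n powr \<alpha>}"
        define B where "B = {v \<in> {1..n}. \<delta> * n powr \<alpha> < w v}"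
        have SB: "{1..n} - S = B" "S \<subseteq> {1..n}" by (auto simp: S_def B_def)
        have finB: "finite B" by (simp add: B_def)
        let ?s = "\<lambda>E. \<exists>v\<in>S. \<epsilon>' * n powr \<alpha> < card (reach (E \<inter> all_edges S) {v})"
        let ?b = "\<lambda>v E. \<not> \<bar>card (reach E {v}) - degree {1..n} E v / (1 - \<nu>)\<bar> \<le> \<epsilon>' * n powr \<alpha>"
        have "graph_prob n w (\<lambda>E. \<epsilon> * n powr \<alpha> <
            \<bar>card (largest_component {1..n} E) - max_degree {1..n} E / (1 - \<nu>)\<bar>)
          \<le> bernoulli_sum (all_edges {1..n}) (edge_weight n w) (\<lambda>E. of_bool (?s E) + (\<Sum>v\<in>B. of_bool (?b v E)))"
        proof (rule bernoulli_sum_mono[OF good_weights_edge_bounds[OF w]])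
          fix E assume E: "E \<subseteq> all_edges {1..n}"
          show "(of_bool (\<epsilon> * n powr \<alpha> < \<bar>card (largest_component {1..n} E) - max_degree {1..n} E / (1 - \<nu>)\<bar>) :: real)
            \<le> of_bool (?s E) + (\<Sum>v\<in>B. of_bool (?b v E))"
          proof (cases "?s E \<or> (\<exists>v\<in>B. ?b v E)")
            case True
            have "1 \<le> of_bool (?s E) + (\<Sum>v\<in>B. of_bool (?b v E) :: real)"
            proof (cases "?s E")
              case False
              then obtain v where v: "v \<in> B" "?b v E" using True by blast
              then have "(of_bool (?b v E) :: real) \<le> (\<Sum>v\<in>B. of_bool (?b v E))"
                using finB by (intro member_le_sum) auto
              moreover have "(of_bool (?b v E) :: real) = 1" using v(2) by simp
              ultimately show ?thesis by (simp add: add_increasing)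
            qed (simp add: sum_nonneg)
            then show ?thesis by (rule order_trans[rotated]) simp
          next
            case False
            have "\<bar>card (largest_component {1..n} E) - max_degree {1..n} E / (1 - \<nu>)\<bar>
              \<le> \<epsilon>' * n powr \<alpha> + (\<epsilon>' * n powr \<alpha> + card ({1..n} - S)) / (1 - \<nu>)"
              by (rule largest_component_max_degree[OF _ _ E SB(2) \<nu>])
                 (use False elim \<epsilon>' SB in \<open>auto simp: not_less\<close>)
            also have "\<dots> \<le> \<epsilon>' * n powr \<alpha> + (\<epsilon>' * n powr \<alpha> + R) / (1 - \<nu>)"
              using R SB \<nu> by (intro add_left_mono divide_right_mono) (auto simp: B_def)
            also have "\<dots> = (\<epsilon>' + \<epsilon>' / (1 - \<nu>)) * n powr \<alpha> + R / (1 - \<nu>)"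
              by (simp add: algebra_simps add_divide_distrib)
            also have "\<dots> \<le> \<epsilon> / 2 * n powr \<alpha> + \<epsilon> / 2 * n powr \<alpha>"
              using \<epsilon>'(2) elim by (intro add_mono mult_right_mono) auto
            finally show ?thesis by (simp add: sum_nonneg)
          qed
        qed
        also have "\<dots> = graph_prob n w ?s + (\<Sum>v\<in>B. graph_prob n w (?b v))"
          unfolding bernoulli_sum_add bernoulli_sum_sum by simp
        also have "\<dots> \<le> \<theta> / 2 + (\<Sum>v\<in>B. \<theta> / (2 * (R + 1)))"
        proof (intro add_mono sum_mono)
          show "graph_prob n w ?s \<le> \<theta> / 2" using elim(1) w1 unfolding S_def by blast
          show "graph_prob n w (?b v) \<le> \<theta> / (2 * (R + 1))" if "v \<in> B" for v
            using elim(2) w2 that by (auto simp: B_def)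
        qed
        also have "(\<Sum>v\<in>B. \<theta> / (2 * (R + 1))) \<le> (R + 1) * (\<theta> / (2 * (R + 1)))"
          using R \<theta> unfolding B_def[symmetric] by (simp add: divide_right_mono mult_right_mono)
        also have "\<dots> = \<theta> / 2" by (simp add: field_simps)
        finally show "graph_prob n w (\<lambda>E. \<epsilon> * n powr \<alpha> <
          \<bar>card (largest_component {1..n} E) - max_degree {1..n} E / (1 - \<nu>)\<bar>) \<le> \<theta>" by simp
      qed
    qed
    then show ?thesis using \<eta> by blast
  qed
  then show ?thesis using \<delta> by blast
qed

end

section \<open>Laws of large numbers and moments\<close>

lemma (in prob_space) prob_Markov:
  fixes u :: "'a \<Rightarrow> real"
  assumes "integrable M u" "AE x in M. 0 \<le> u x" "0 < c"
  shows "prob {x \<in> space M. c \<le> u x} \<le> expectation u / c"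
  by (rule integral_Markov_inequality_measure[OF assms(1) sets.empty_sets assms(2,3)])

lemma (in prob_space) weak_law_of_large_numbers:
  fixes X :: "nat \<Rightarrow> 'a \<Rightarrow> real"
  assumes indep: "indep_vars (\<lambda>_. borel) X {1..}"
    and distr: "\<And>i. 1 \<le> i \<Longrightarrow> distr M borel (X i) = distr M borel (X 1)"
    and int: "integrable M (X 1)" and \<eta>: "0 < \<eta>"
  shows "(\<lambda>n. prob {\<omega> \<in> space M. \<eta> < \<bar>(\<Sum>i=1..n. X i \<omega>) / n - expectation (X 1)\<bar>}) \<longlonglongrightarrow> 0"
proof (rule order_tendstoI)
  fix \<theta> :: real assume \<theta>: "0 < \<theta>"
  have rv: "random_variable borel (X i)" if "1 \<le> i" for i
    using indep that unfolding indep_vars_def by auto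
  note rv1 [measurable] = rv[OF order_refl]
  note [measurable] = rv1[unfolded One_nat_def]
  define clamp where "clamp = (\<lambda>T x :: real. max (- T) (min T x))"
  have clamp_m [measurable]: "clamp T \<in> borel_measurable borel" for T
    unfolding clamp_def by measurable
  have "(\<lambda>k. expectation (\<lambda>\<omega>. \<bar>X 1 \<omega> - clamp (real k) (X 1 \<omega>)\<bar>)) \<longlonglongrightarrow> expectation (\<lambda>\<omega>. 0)"
  proof (rule integral_dominated_convergence)
    show "integrable M (\<lambda>\<omega>. \<bar>X 1 \<omega>\<bar>)" using int by simp
    show "AE \<omega> in M. (\<lambda>k. \<bar>X 1 \<omega> - clamp (real k) (X 1 \<omega>)\<bar>) \<longlonglongrightarrow> 0"
    proof (rule AE_I2, rule tendsto_eventually)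
      fix \<omega>
      show "\<forall>\<^sub>F k in sequentially. \<bar>X 1 \<omega> - clamp (real k) (X 1 \<omega>)\<bar> = 0"
        using eventually_ge_at_top[of "nat \<lceil>\<bar>X 1 \<omega>\<bar>\<rceil>"]
      proof eventually_elim
        case (elim k)
        then have "\<bar>X 1 \<omega>\<bar> \<le> real k" by linarith
        then show ?case by (auto simp: clamp_def)
      qed
    qed
  qed (auto simp: clamp_def)
  then have "(\<lambda>k. expectation (\<lambda>\<omega>. \<bar>X 1 \<omega> - clamp (real k) (X 1 \<omega>)\<bar>)) \<longlonglongrightarrow> 0" by simp
  then have "\<forall>\<^sub>F k in sequentially. expectation (\<lambda>\<omega>. \<bar>X 1 \<omega> - clamp (real k) (X 1 \<omega>)\<bar>) < min (\<eta> / 4) (\<eta> * \<theta> / 16)"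
    by (rule order_tendstoD(2)) (use \<eta> \<theta> in auto)
  then have "\<forall>\<^sub>F k in sequentially. 0 < k \<and> expectation (\<lambda>\<omega>. \<bar>X 1 \<omega> - clamp (real k) (X 1 \<omega>)\<bar>) < min (\<eta> / 4) (\<eta> * \<theta> / 16)"
    using eventually_gt_at_top[of 0] by eventually_elim auto
  then obtain k :: nat where k: "0 < k"
    and z: "expectation (\<lambda>\<omega>. \<bar>X 1 \<omega> - clamp (real k) (X 1 \<omega>)\<bar>) < min (\<eta> / 4) (\<eta> * \<theta> / 16)"
    unfolding eventually_sequentially by blast
  define T where "T = real k"
  have T: "0 < T" using k by (simp add: T_def)
  define z where "z = expectation (\<lambda>\<omega>. \<bar>X 1 \<omega> - clamp T (X 1 \<omega>)\<bar>)"
  have z_lt: "z < \<eta> / 4" "z < \<eta> * \<theta> / 16" using z by (auto simp: z_def T_def)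
  define Y where "Y = (\<lambda>i \<omega>. clamp T (X i \<omega>))"
  have clamp_bound: "clamp T x \<in> {- T..T}" for x using T by (auto simp: clamp_def)
  have intY: "integrable M (Y 1)"
  proof (rule integrable_const_bound[of _ T])
    have "\<bar>clamp T x\<bar> \<le> T" for x using clamp_bound[of x] by auto
    then show "AE \<omega> in M. norm (Y 1 \<omega>) \<le> T" by (simp add: Y_def)
  qed (simp add: Y_def)
  have diff: "\<bar>expectation (X 1) - expectation (Y 1)\<bar> \<le> z"
  proof -
    have "expectation (X 1) - expectation (Y 1) = expectation (\<lambda>\<omega>. X 1 \<omega> - Y 1 \<omega>)"
      using int intY by simp
    then show ?thesis unfolding z_def Y_def by (simp add: integral_abs_bound)
  qed
  have intZ: "integrable M (\<lambda>\<omega>. \<bar>X i \<omega> - Y i \<omega>\<bar>) \<and> expectation (\<lambda>\<omega>. \<bar>X i \<omega> - Y i \<omega>\<bar>) = z" if i: "1 \<le> i" for i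
  proof -
    note [measurable] = rv[OF i]
    have m: "(\<lambda>x. \<bar>x - clamp T x\<bar>) \<in> borel_measurable borel" by measurable
    have "integrable (distr M borel (X 1)) (\<lambda>x. \<bar>x - clamp T x\<bar>)"
      unfolding integrable_distr_eq[OF rv1 m] using int intY by (auto simp: Y_def)
    then have "integrable (distr M borel (X i)) (\<lambda>x. \<bar>x - clamp T x\<bar>)" using distr[OF i] by simp
    then have 1: "integrable M (\<lambda>\<omega>. \<bar>X i \<omega> - Y i \<omega>\<bar>)"
      unfolding integrable_distr_eq[OF rv[OF i] m] by (simp add: Y_def)
    have "expectation (\<lambda>\<omega>. \<bar>X i \<omega> - Y i \<omega>\<bar>) = integral\<^sup>L (distr M borel (X i)) (\<lambda>x. \<bar>x - clamp T x\<bar>)"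
      by (simp add: integral_distr[OF rv[OF i] m] Y_def)
    also have "\<dots> = z" unfolding distr[OF i] z_def by (rule integral_distr[OF rv1 m])
    finally show ?thesis using 1 by simp
  qed
  define h where "h = (\<lambda>n::nat. 2 * exp (- 2 * n * (\<eta> / 4)\<^sup>2 / (T - - T)\<^sup>2))"
  have "(\<lambda>n. h n) \<longlonglongrightarrow> 2 * 0"
  proof -
    define c where "c = 2 * (\<eta> / 4)\<^sup>2 / (T - - T)\<^sup>2"
    have c: "0 < c" using \<eta> T by (simp add: c_def)
    have "filterlim (\<lambda>n. - (c * real n)) at_bot sequentially"
      unfolding filterlim_uminus_at_bot
      using c by (simp add: filterlim_tendsto_pos_mult_at_top[OF tendsto_const _ filterlim_real_sequentially])
    then have "(\<lambda>n. exp (- (c * real n))) \<longlonglongrightarrow> 0" by (rule filterlim_compose[OF exp_at_bot])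
    moreover have "h n = 2 * exp (- (c * real n))" for n by (simp add: h_def c_def mult_ac)
    ultimately show ?thesis by (simp only: tendsto_mult_left)
  qed
  then have "\<forall>\<^sub>F n in sequentially. h n < \<theta> / 2" by (rule order_tendstoD(2)) (use \<theta> in simp)
  then show "\<forall>\<^sub>F n in sequentially. prob {\<omega> \<in> space M. \<eta> < \<bar>(\<Sum>i=1..n. X i \<omega>) / n - expectation (X 1)\<bar>} < \<theta>"
    using eventually_gt_at_top[of 0]
  proof eventually_elim
    case (elim n)
    note [measurable] = rv
    have Ym: "random_variable borel (Y i)" if "1 \<le> i" for i
      using rv[OF that] unfolding Y_def by measurable
    note [measurable] = Ym
    interpret H: Hoeffding_ineq_iid M "{1..n}" Y "Y 1" "- T" T "expectation (Y 1)"
    proof unfold_locales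
      show "indep_vars (\<lambda>_. borel) Y {1..n}"
        unfolding Y_def by (rule indep_vars_compose2[OF indep_vars_subset[OF indep]]) auto
      fix i assume "i \<in> {1..n}"
      then have i: "1 \<le> i" by simp
      have "distr M borel (Y i) = distr (distr M borel (X i)) borel (clamp T)"
        using rv[OF i] by (subst distr_distr) (auto simp: Y_def comp_def)
      also have "\<dots> = distr M borel (Y 1)"
        unfolding distr[OF i] by (subst distr_distr) (auto simp: Y_def comp_def)
      finally show "distr M borel (Y i) = distr M borel (Y 1)" .
    qed (use Ym clamp_bound in \<open>auto simp: Y_def\<close>)
    let ?A = "{\<omega> \<in> space M. \<bar>(\<Sum>i=1..n. Y i \<omega>) / n - expectation (Y 1)\<bar> \<ge> \<eta> / 4}"
    let ?B = "{\<omega> \<in> space M. \<eta> / 4 \<le> (\<Sum>i=1..n. \<bar>X i \<omega> - Y i \<omega>\<bar>) / n}"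
    have "prob {\<omega> \<in> space M. \<eta> < \<bar>(\<Sum>i=1..n. X i \<omega>) / n - expectation (X 1)\<bar>} \<le> prob (?A \<union> ?B)"
    proof (rule finite_measure_mono)
      \<comment> \<open>Three deviations below \<eta>/4 each: of the clamped average, of the average
        remainder, and of the means, which differ by at most \<open>z\<close>.\<close>
      show "{\<omega> \<in> space M. \<eta> < \<bar>(\<Sum>i=1..n. X i \<omega>) / n - expectation (X 1)\<bar>} \<subseteq> ?A \<union> ?B"
      proof clarify
        fix \<omega> assume \<omega>: "\<omega> \<in> space M" "\<eta> < \<bar>(\<Sum>i=1..n. X i \<omega>) / n - expectation (X 1)\<bar>"
          and nB: "\<not> \<eta> / 4 \<le> (\<Sum>i=1..n. \<bar>X i \<omega> - Y i \<omega>\<bar>) / n"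
        have "\<bar>(\<Sum>i=1..n. X i \<omega>) / n - (\<Sum>i=1..n. Y i \<omega>) / n\<bar> = \<bar>\<Sum>i=1..n. X i \<omega> - Y i \<omega>\<bar> / n"
          by (simp add: sum_subtractf diff_divide_distrib[symmetric])
        also have "\<dots> \<le> (\<Sum>i=1..n. \<bar>X i \<omega> - Y i \<omega>\<bar>) / n" by (intro divide_right_mono sum_abs) simp
        finally show "\<eta> / 4 \<le> \<bar>(\<Sum>i=1..n. Y i \<omega>) / n - expectation (Y 1)\<bar>"
          using \<omega> nB diff z_lt \<eta> by linarith
      qed
      show "?A \<union> ?B \<in> events" by measurable
    qed
    also have "\<dots> \<le> prob ?A + prob ?B" by (rule measure_Un_le) measurable
    also have "prob ?A \<le> h n"
    proof -
      have "- T < T" "{1..n} \<noteq> {}" "0 \<le> \<eta> / 4" using T elim \<eta> by auto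
      from H.Hoeffding_ineq_abs_ge'[OF this(3,1,2)] show ?thesis by (simp add: h_def)
    qed
    also have "prob ?B \<le> expectation (\<lambda>\<omega>. (\<Sum>i=1..n. \<bar>X i \<omega> - Y i \<omega>\<bar>) / n) / (\<eta> / 4)"
    proof (rule prob_Markov)
      have "integrable M (\<lambda>\<omega>. \<Sum>i=1..n. \<bar>X i \<omega> - Y i \<omega>\<bar>)"
        by (rule Bochner_Integration.integrable_sum) (simp add: intZ)
      then show "integrable M (\<lambda>\<omega>. (\<Sum>i=1..n. \<bar>X i \<omega> - Y i \<omega>\<bar>) / n)" by (rule integrable_divide)
      show "AE \<omega> in M. 0 \<le> (\<Sum>i=1..n. \<bar>X i \<omega> - Y i \<omega>\<bar>) / n"
        by (intro AE_I2 divide_nonneg_nonneg sum_nonneg) auto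
    qed (use \<eta> in simp)
    also have "expectation (\<lambda>\<omega>. (\<Sum>i=1..n. \<bar>X i \<omega> - Y i \<omega>\<bar>) / n) = z"
    proof -
      have "expectation (\<lambda>\<omega>. \<Sum>i=1..n. \<bar>X i \<omega> - Y i \<omega>\<bar>) = (\<Sum>i=1..n. expectation (\<lambda>\<omega>. \<bar>X i \<omega> - Y i \<omega>\<bar>))"
        by (rule Bochner_Integration.integral_sum) (simp add: intZ)
      also have "\<dots> = (\<Sum>i=1..n. z)" by (rule sum.cong) (simp_all add: intZ)
      finally show ?thesis using elim by simp
    qed
    also have "z / (\<eta> / 4) \<le> \<theta> / 2" using z_lt(2) \<eta> mult_pos_pos[OF \<eta> \<theta>] by (simp add: field_simps)
    finally show ?case using elim by linarith
  qed
qed (rule always_eventually, rule allI, erule less_le_trans, rule measure_nonneg)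

text \<open>Dyadic decomposition: where 2^k \<le> X < 2^(k+1) the power is at most 2^((k+1)r), and
  the tail at 2^k is at most C 2^(-kq). The expectation is dominated by a geometric series of ratio
  2^(r-q) < 1.\<close>

lemma (in prob_space) integrable_powr_if_tail:
  fixes X :: "'a \<Rightarrow> real"
  assumes [measurable]: "random_variable borel X" and nonneg: "AE \<omega> in M. 0 \<le> X \<omega>"
    and tail: "\<And>x. 0 < x \<Longrightarrow> prob {\<omega> \<in> space M. x \<le> X \<omega>} \<le> C * x powr - q"
    and r: "0 < r" "r < q"
  shows "integrable M (\<lambda>\<omega>. X \<omega> powr r)"
proof (rule integrableI_bounded)
  have "0 \<le> prob {\<omega> \<in> space M. 1 \<le> X \<omega>}" by simp
  also have "\<dots> \<le> C" using tail[of 1] by simp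
  finally have C: "0 \<le> C" .
  let ?t = "\<lambda>k \<omega>. ennreal ((2 ^ Suc k) powr r) * indicator {\<omega> \<in> space M. 2 ^ k \<le> X \<omega>} \<omega>"
  have dyadic: "ennreal (norm (X \<omega> powr r)) \<le> 1 + (\<Sum>k. ?t k \<omega>)" if \<omega>: "\<omega> \<in> space M" "0 \<le> X \<omega>" for \<omega>
  proof (cases "X \<omega> < 1")
    case True
    then have "X \<omega> powr r \<le> 1 powr r" using \<omega> r by (intro powr_mono2) auto
    then have "ennreal (norm (X \<omega> powr r)) \<le> 1" by simp
    then show ?thesis by (rule order_trans) simp
  next
    case False
    then have "\<exists>k. 2 ^ k \<le> X \<omega> \<and> X \<omega> < 2 ^ Suc k"
    proof -
      obtain m where "X \<omega> < 2 ^ m" using real_arch_pow[of 2 "X \<omega>"] by auto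
      define m' where "m' = (LEAST m. X \<omega> < 2 ^ m)"
      have m': "X \<omega> < 2 ^ m'" unfolding m'_def by (rule LeastI) fact
      then obtain k where k: "m' = Suc k" using False by (cases m') auto
      have "\<not> X \<omega> < 2 ^ k" using not_less_Least[of k "\<lambda>m. X \<omega> < 2 ^ m"] k unfolding m'_def by auto
      then show ?thesis using m' k by (intro exI[of _ k]) auto
    qed
    then obtain k where k: "2 ^ k \<le> X \<omega>" "X \<omega> < 2 ^ Suc k" by blast
    have "ennreal (norm (X \<omega> powr r)) \<le> ?t k \<omega>"
      using k \<omega> r by (auto intro!: ennreal_leI powr_mono2)
    also have "\<dots> \<le> (\<Sum>k. ?t k \<omega>)"
    proof -
      have "sum (\<lambda>k. ?t k \<omega>) {k} \<le> (\<Sum>k. ?t k \<omega>)" by (rule sum_le_suminf) auto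
      then show ?thesis by (simp only: sum.insert sum.empty finite.emptyI empty_iff not_False_eq_True add_0_right)
    qed
    finally show ?thesis by (rule order_trans) simp
  qed
  have "(\<integral>\<^sup>+ \<omega>. ennreal (norm (X \<omega> powr r)) \<partial>M) \<le> (\<integral>\<^sup>+ \<omega>. 1 + (\<Sum>k. ?t k \<omega>) \<partial>M)"
  proof (rule nn_integral_mono_AE)
    show "AE \<omega> in M. ennreal (norm (X \<omega> powr r)) \<le> 1 + (\<Sum>k. ?t k \<omega>)"
      using nonneg AE_space by eventually_elim (rule dyadic)
  qed
  also have "\<dots> = 1 + (\<Sum>k. \<integral>\<^sup>+ \<omega>. ?t k \<omega> \<partial>M)"
    by (simp add: nn_integral_add nn_integral_suminf emeasure_space_1)
  also have "(\<Sum>k. \<integral>\<^sup>+ \<omega>. ?t k \<omega> \<partial>M) \<le> (\<Sum>k. ennreal (C * 2 powr r * (2 powr (r - q)) ^ k))"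
  proof (rule suminf_le)
    fix k
    have "(\<integral>\<^sup>+ \<omega>. ?t k \<omega> \<partial>M) = ennreal ((2 ^ Suc k) powr r) * ennreal (prob {\<omega> \<in> space M. 2 ^ k \<le> X \<omega>})"
      by (simp add: nn_integral_cmult_indicator emeasure_eq_measure)
    also have "\<dots> \<le> ennreal ((2 ^ Suc k) powr r) * ennreal (C * (2 ^ k) powr - q)"
      by (intro mult_left_mono ennreal_leI tail) auto
    also have "\<dots> = ennreal (C * 2 powr r * (2 powr (r - q)) ^ k)"
    proof -
      have "(2 ^ Suc k) powr r * (C * (2 ^ k) powr - q) = C * 2 powr r * ((2 ^ k) powr r * (2 ^ k) powr - q :: real)"
        by (simp add: powr_mult)
      also have "(2 ^ k) powr r * (2 ^ k) powr - q = (2 ^ k :: real) powr (r - q)"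
        by (simp flip: powr_add)
      also have "\<dots> = (2 powr (r - q)) ^ k"
        by (simp add: powr_power powr_powr mult.commute flip: powr_realpow)
      finally show ?thesis using C by (simp flip: ennreal_mult)
    qed
    finally show "(\<integral>\<^sup>+ \<omega>. ?t k \<omega> \<partial>M) \<le> ennreal (C * 2 powr r * (2 powr (r - q)) ^ k)" .
  qed auto
  also have "\<dots> < \<infinity>"
  proof -
    have "2 powr (r - q) < 2 powr (0::real)" using r by (intro powr_less_mono) auto
    then have "summable (\<lambda>k. C * 2 powr r * (2 powr (r - q)) ^ k)"
      by (intro summable_mult summable_geometric) auto
    then have "(\<Sum>k. ennreal (C * 2 powr r * (2 powr (r - q)) ^ k)) = ennreal (\<Sum>k. C * 2 powr r * (2 powr (r - q)) ^ k)"
      using C by (intro suminf_ennreal2) auto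
    then show ?thesis by simp
  qed
  finally show "(\<integral>\<^sup>+ \<omega>. ennreal (norm (X \<omega> powr r)) \<partial>M) < \<infinity>"
    by (simp add: add_left_mono less_top[symmetric] top_unique)
qed measurable

section \<open>From the conditional law to the graph\<close>

text \<open>The hypotheses on the graph only provide the conditional probabilities of \<open>J \<subseteq> G\<close>; these
  determine those of \<open>G = E\<close>.\<close>

lemma superset_sums_determine:
  fixes f g :: "'e set \<Rightarrow> real"
  assumes "finite X"
    and eq: "\<And>J. J \<subseteq> X \<Longrightarrow> (\<Sum>E | E \<subseteq> X \<and> J \<subseteq> E. f E) = (\<Sum>E | E \<subseteq> X \<and> J \<subseteq> E. g E)"
    and "E \<subseteq> X"
  shows "f E = g E"
  using assms(3)
\<comment> \<open>Downwards from \<open>X\<close>: once all proper supersets are settled, only the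
  term of \<open>E\<close> itself remains in its up-set sum.\<close>
proof (induction "card (X - E)" arbitrary: E rule: less_induct)
  case less
  have fin: "finite {F. F \<subseteq> X \<and> E \<subseteq> F}" using assms(1) by (auto intro: finite_subset[of _ "Pow X"])
  have E: "E \<in> {F. F \<subseteq> X \<and> E \<subseteq> F}" using less.prems by auto
  have "f F = g F" if F: "F \<in> {F. F \<subseteq> X \<and> E \<subseteq> F} - {E}" for F
  proof (rule less.hyps)
    have "X - F \<subset> X - E" using F by auto
    then show "card (X - F) < card (X - E)" using assms(1) by (intro psubset_card_mono) auto
  qed (use F in auto)
  then have "(\<Sum>F\<in>{F. F \<subseteq> X \<and> E \<subseteq> F} - {E}. f F) = (\<Sum>F\<in>{F. F \<subseteq> X \<and> E \<subseteq> F} - {E}. g F)"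
    by (rule sum.cong[OF refl])
  then show ?case
    using eq[OF less.prems] sum.remove[OF fin E, of f] sum.remove[OF fin E, of g] by simp
qed

text \<open>Up-sets are the events on which conditional independence speaks directly; under
  independent edges they have product probabilities.\<close>

lemma bernoulli_sum_superset:
  fixes p :: "'e \<Rightarrow> real"
  assumes "finite X" "J \<subseteq> X"
  shows "(\<Sum>E | E \<subseteq> X \<and> J \<subseteq> E. (\<Prod>e\<in>E. p e) * (\<Prod>e\<in>X - E. 1 - p e)) = (\<Prod>e\<in>J. p e)"
proof -
  have "bernoulli_sum (J \<union> (X - J)) p (\<lambda>E. of_bool (J \<subseteq> E)) =
    bernoulli_sum J p (\<lambda>E. bernoulli_sum (X - J) p (\<lambda>F. of_bool (J \<subseteq> E \<union> F)))"
    by (rule bernoulli_sum_Un) (use assms in \<open>auto intro: finite_subset\<close>)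
  also have "\<dots> = bernoulli_sum J p (\<lambda>E. bernoulli_sum (X - J) p (\<lambda>F. \<Prod>e\<in>E. 1) * of_bool (J \<subseteq> E))"
  proof (intro bernoulli_sum_cong)
    fix E assume E: "E \<subseteq> J"
    have "bernoulli_sum (X - J) p (\<lambda>F. of_bool (J \<subseteq> E \<union> F)) = bernoulli_sum (X - J) p (\<lambda>F. of_bool (J \<subseteq> E))"
    proof (rule bernoulli_sum_cong)
      fix F assume "F \<subseteq> X - J"
      then have "J \<subseteq> E \<union> F \<longleftrightarrow> J \<subseteq> E" by auto
      then show "(of_bool (J \<subseteq> E \<union> F) :: real) = of_bool (J \<subseteq> E)" by simp
    qed
    then show "bernoulli_sum (X - J) p (\<lambda>F. of_bool (J \<subseteq> E \<union> F))
      = bernoulli_sum (X - J) p (\<lambda>F. \<Prod>e\<in>E. 1) * of_bool (J \<subseteq> E)"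
      using assms by (simp add: bernoulli_sum_const)
  qed
  also have "\<dots> = bernoulli_sum J p (\<lambda>E. of_bool (J \<subseteq> E))"
    using assms by (simp add: bernoulli_sum_const)
  also have "\<dots> = (\<Sum>E\<in>{J}. (\<Prod>e\<in>E. p e) * (\<Prod>e\<in>J - E. 1 - p e) * of_bool (J \<subseteq> E))"
    unfolding bernoulli_sum_def
    by (rule sum.mono_neutral_right) (use assms in \<open>auto intro: finite_subset\<close>)
  also have "\<dots> = (\<Prod>e\<in>J. p e)" by simp
  finally have "(\<Prod>e\<in>J. p e) = bernoulli_sum X p (\<lambda>E. of_bool (J \<subseteq> E))"
    using assms by (simp add: Un_absorb1)
  also have "\<dots> = (\<Sum>E | E \<subseteq> X \<and> J \<subseteq> E. (\<Prod>e\<in>E. p e) * (\<Prod>e\<in>X - E. 1 - p e))"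
    unfolding bernoulli_sum_def
    by (rule sum.mono_neutral_cong_right) (use assms in auto)
  finally show ?thesis by simp
qed

section \<open>The conditional law given the weights\<close>

lemma subalgebra_weight_algebra:
  assumes "\<And>i. i \<in> {1..n} \<Longrightarrow> W i \<in> borel_measurable M"
  shows "subalgebra M (weight_algebra M W n)"
    and "i \<in> {1..n} \<Longrightarrow> W i \<in> borel_measurable (weight_algebra M W n)"
proof -
  let ?X = "\<lambda>\<omega>. \<lambda>i\<in>{1..n}. W i \<omega>" and ?P = "Pi\<^sub>M {1..n} (\<lambda>_. borel :: real measure)"
  have m: "?X \<in> measurable M ?P" by (rule measurable_restrict) (use assms in auto)
  then have sp: "?X \<in> space M \<rightarrow> space ?P" by (auto simp: measurable_def)
  show "subalgebra M (weight_algebra M W n)"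
    unfolding subalgebra_def weight_algebra_def sets_vimage_algebra2[OF sp]
    using measurable_sets[OF m] by auto
  assume i: "i \<in> {1..n}"
  have "(\<lambda>f. f i) \<circ> ?X \<in> borel_measurable (weight_algebra M W n)"
    unfolding weight_algebra_def
    by (rule measurable_comp[OF measurable_vimage_algebra1[OF sp]]) (rule measurable_component_singleton[OF i])
  moreover have "(\<lambda>f. f i) \<circ> ?X = W i" using i by (auto simp: fun_eq_iff)
  ultimately show "W i \<in> borel_measurable (weight_algebra M W n)" by simp
qed

text \<open>The map from \<open>e\<close> to \<open>(Min e, Max e)\<close> translates unordered
  edges into the ordered pairs indexing \<open>edge_event\<close>. The empty \<open>J\<close> is
  separate: conditional independence concerns nonempty families, and there the conditional
  probability of the whole space is needed.\<close>

lemma weighted_random_graph_superset: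
  assumes "prob_space M"
    and W: "\<And>i. i \<in> {1..n} \<Longrightarrow> W i \<in> borel_measurable M"
    and G: "weighted_random_graph M W n G" and J: "J \<subseteq> all_edges {1..n}"
  shows "{\<omega> \<in> space M. J \<subseteq> G \<omega>} \<in> sets M"
    and "AE \<omega> in M. cond_prob M (weight_algebra M W n) {\<omega> \<in> space M. J \<subseteq> G \<omega>} \<omega>
       = (\<Prod>e\<in>J. edge_weight n (\<lambda>i. W i \<omega>) e)"
proof -
  interpret prob_space M by fact
  let ?F = "weight_algebra M W n"
  have sub: "subalgebra M ?F" by (rule subalgebra_weight_algebra) (rule W)
  interpret finite_measure_subalgebra M ?F by unfold_locales (rule sub)
  let ?h = "\<lambda>e :: nat set. (Min e, Max e)"
  let ?I = "{(i, j). 1 \<le> i \<and> i < j \<and> j \<le> n}"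
  have Gm: "G \<in> M \<rightarrow>\<^sub>M count_space (simple_graphs {1..n})"
    and AE1: "\<And>i j. 1 \<le> i \<Longrightarrow> i < j \<Longrightarrow> j \<le> n \<Longrightarrow>
      AE \<omega> in M. cond_prob M ?F (edge_event M G (i, j)) \<omega> = edge_prob n (W i \<omega>) (W j \<omega>)"
    and ind: "cond_indep_events M ?F (edge_event M G) ?I"
    using G unfolding weighted_random_graph_def by auto
  have finJ: "finite J" using J finite_all_edges finite_subset by blast
  have pair: "\<exists>i j. e = {i, j} \<and> ?h e = (i, j) \<and> 1 \<le> i \<and> i < j \<and> j \<le> n" if "e \<in> J" for e
  proof -
    have "e \<in> all_edges {1..n}" using that J by auto
    then obtain x y where xy: "e = {x, y}" "x \<noteq> y" "x \<in> {1..n}" "y \<in> {1..n}"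
      by (auto simp: all_edges_def card_2_iff)
    show ?thesis
      by (rule exI[of _ "min x y"], rule exI[of _ "max x y"]) (use xy in \<open>auto simp: min_def max_def\<close>)
  qed
  have inj: "inj_on ?h J"
  proof (rule inj_onI)
    fix e f assume "e \<in> J" "f \<in> J" "?h e = ?h f"
    then show "e = f" using pair[of e] pair[of f] by auto
  qed
  have hI: "?h ` J \<subseteq> ?I"
  proof
    fix z assume "z \<in> ?h ` J"
    then obtain e where e: "e \<in> J" "z = ?h e" by auto
    from pair[OF e(1)] e(2) show "z \<in> ?I" by auto
  qed
  have ev: "edge_event M G (?h e) = {\<omega> \<in> space M. e \<in> G \<omega>}" if "e \<in> J" for e
    using pair[OF that] by (auto simp: edge_event_def)
  have Ginv: "{\<omega> \<in> space M. J \<subseteq> G \<omega>} = G -` {E. E \<subseteq> all_edges {1..n} \<and> J \<subseteq> E} \<inter> space M"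
    using measurable_space[OF Gm] by (auto simp: simple_graphs_def)
  show sets: "{\<omega> \<in> space M. J \<subseteq> G \<omega>} \<in> sets M"
    unfolding Ginv by (rule measurable_sets[OF Gm]) (auto simp: simple_graphs_def)
  show "AE \<omega> in M. cond_prob M ?F {\<omega> \<in> space M. J \<subseteq> G \<omega>} \<omega>
       = (\<Prod>e\<in>J. edge_weight n (\<lambda>i. W i \<omega>) e)"
  proof (cases "J = {}")
    case True
    have "AE \<omega> in M. real_cond_exp M ?F (indicator (space M)) \<omega> = indicator (space M) \<omega>"
    proof (rule real_cond_exp_F_meas)
      have "space M = space ?F" using sub by (simp add: subalgebra_def)
      then show "indicator (space M) \<in> borel_measurable ?F" by (metis borel_measurable_indicator sets.top)
      show "integrable M (indicat_real (space M))"
        by (rule integrable_real_indicator) (auto simp: emeasure_space_1)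
    qed
    then show ?thesis using True AE_space by (auto simp: cond_prob_def)
  next
    case False
    have A: "AE \<omega> in M. cond_prob M ?F (\<Inter>j\<in>?h ` J. edge_event M G j) \<omega>
      = (\<Prod>j\<in>?h ` J. cond_prob M ?F (edge_event M G j) \<omega>)"
      using ind hI finJ False unfolding cond_indep_events_def by blast
    have eq: "(\<Inter>j\<in>?h ` J. edge_event M G j) = {\<omega> \<in> space M. J \<subseteq> G \<omega>}"
      using False ev by auto
    have B: "AE \<omega> in M. \<forall>e\<in>J. cond_prob M ?F (edge_event M G (?h e)) \<omega> = edge_weight n (\<lambda>i. W i \<omega>) e"
      unfolding AE_ball_countable[OF countable_finite[OF finJ]]
    proof
      fix e assume "e \<in> J"
      from pair[OF this] obtain i j where ij: "e = {i, j}" "?h e = (i, j)" "1 \<le> i" "i < j" "j \<le> n" by blast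
      show "AE \<omega> in M. cond_prob M ?F (edge_event M G (?h e)) \<omega> = edge_weight n (\<lambda>i. W i \<omega>) e"
        using AE1[OF ij(3-5)] unfolding ij(2) unfolding ij(1) edge_weight_pair .
    qed
    from A B show ?thesis unfolding eq
    proof eventually_elim
      case (elim \<omega>)
      then show ?case by (simp add: prod.reindex[OF inj])
    qed
  qed
qed

text \<open>Conditional bounds enter in integrated form: for \<open>H\<close> measurable in the
  weights, the probability of \<open>H\<close> together with G = E is the integral over
  \<open>H\<close> of the Bernoulli weight of \<open>E\<close>. A bound valid pointwise on
  \<open>H\<close> then survives integration.\<close>

lemma weighted_random_graph_bound:
  assumes "prob_space M"
    and W: "\<And>i. i \<in> {1..n} \<Longrightarrow> W i \<in> borel_measurable M"
    and nonneg: "\<And>i. i \<in> {1..n} \<Longrightarrow> AE \<omega> in M. 0 \<le> W i \<omega>"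
    and G: "weighted_random_graph M W n G"
    and H: "H \<in> sets (weight_algebra M W n)"
    and bound: "\<And>\<omega>. \<omega> \<in> H \<Longrightarrow> graph_prob n (\<lambda>i. W i \<omega>) P \<le> \<theta>" and \<theta>: "0 \<le> \<theta>"
  shows "measure M {\<omega> \<in> H. P (G \<omega>)} \<le> \<theta>"
proof -
  interpret prob_space M by fact
  let ?F = "weight_algebra M W n"
  have sub: "subalgebra M ?F" by (rule subalgebra_weight_algebra) (rule W)
  interpret finite_measure_subalgebra M ?F by unfold_locales (rule sub)
  let ?X = "all_edges {1..n}"
  have finX: "finite ?X" by (simp add: finite_all_edges)
  have HM [measurable]: "H \<in> sets M" using H sub by (auto simp: subalgebra_def)
  have HS: "H \<subseteq> space M" using sets.sets_into_space[OF HM] .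
  have Gm: "G \<in> M \<rightarrow>\<^sub>M count_space (simple_graphs {1..n})"
    using G unfolding weighted_random_graph_def by auto
  have GX: "G \<omega> \<subseteq> ?X" if "\<omega> \<in> space M" for \<omega>
    using measurable_space[OF Gm that] by (auto simp: simple_graphs_def)
  have Geq [measurable]: "{\<omega> \<in> space M. G \<omega> = E} \<in> sets M" if "E \<subseteq> ?X" for E
  proof -
    have "{\<omega> \<in> space M. G \<omega> = E} = G -` {E} \<inter> space M" by auto
    then show ?thesis using measurable_sets[OF Gm, of "{E}"] that by (simp add: simple_graphs_def)
  qed
  let ?p = "\<lambda>\<omega>. edge_weight n (\<lambda>i. W i \<omega>)"
  have pm [measurable]: "(\<lambda>\<omega>. ?p \<omega> e) \<in> borel_measurable M" if "e \<in> ?X" for e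
  proof -
    obtain x y where xy: "e = {x, y}" "x \<in> {1..n}" "y \<in> {1..n}"
      using \<open>e \<in> ?X\<close> by (auto simp: all_edges_def card_2_iff)
    note [measurable] = W[OF xy(2)] W[OF xy(3)]
    show ?thesis unfolding xy(1) edge_weight_pair edge_prob_def by measurable
  qed
  have p01: "AE \<omega> in M. \<forall>e\<in>?X. 0 \<le> ?p \<omega> e \<and> ?p \<omega> e \<le> 1"
  proof -
    have "AE \<omega> in M. \<forall>i\<in>{1..n}. 0 \<le> W i \<omega>"
      unfolding AE_ball_countable[OF countable_finite[OF finite_atLeastAtMost]] using nonneg by blast
    then show ?thesis
    proof eventually_elim
      case (elim \<omega>)
      show ?case
      proof
        fix e assume "e \<in> ?X"
        then show "0 \<le> ?p \<omega> e \<and> ?p \<omega> e \<le> 1"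
          using edge_weight_bounds[of n "\<lambda>i. W i \<omega>" e] elim by simp
      qed
    qed
  qed
  let ?q = "\<lambda>E \<omega>. (\<Prod>e\<in>E. ?p \<omega> e) * (\<Prod>e\<in>?X - E. 1 - ?p \<omega> e)"
  have qm [measurable]: "?q E \<in> borel_measurable M" if "E \<subseteq> ?X" for E
  proof -
    have "(\<lambda>\<omega>. \<Prod>e\<in>E. ?p \<omega> e) \<in> borel_measurable M"
      by (rule borel_measurable_prod, rule pm) (use that in blast)
    moreover have "(\<lambda>\<omega>. \<Prod>e\<in>?X - E. 1 - ?p \<omega> e) \<in> borel_measurable M"
      by (rule borel_measurable_prod, rule borel_measurable_diff[OF borel_measurable_const], rule pm) blast
    ultimately show ?thesis by (rule borel_measurable_times)
  qed
  have qint: "integrable M (\<lambda>\<omega>. indicator H \<omega> * ?q E \<omega>)" if E: "E \<subseteq> ?X" for E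
  proof (rule integrable_const_bound[of _ 1])
    show "AE \<omega> in M. norm (indicator H \<omega> * ?q E \<omega>) \<le> 1"
      using p01
    proof eventually_elim
      case (elim \<omega>)
      have "0 \<le> (\<Prod>e\<in>E. ?p \<omega> e)" "(\<Prod>e\<in>E. ?p \<omega> e) \<le> 1"
        using elim E by (auto intro!: prod_nonneg prod_le_1)
      moreover have "0 \<le> (\<Prod>e\<in>?X - E. 1 - ?p \<omega> e)" "(\<Prod>e\<in>?X - E. 1 - ?p \<omega> e) \<le> 1"
        using elim by (auto intro!: prod_nonneg prod_le_1)
      ultimately have "0 \<le> ?q E \<omega>" "?q E \<omega> \<le> 1" by (auto simp: mult_le_one)
      then show ?case by (auto simp: indicator_def)
    qed
    show "(\<lambda>\<omega>. indicator H \<omega> * ?q E \<omega>) \<in> borel_measurable M"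
      by (rule borel_measurable_times[OF borel_measurable_indicator[OF HM] qm[OF E]])
  qed
  define f where "f = (\<lambda>E. measure M {\<omega> \<in> H. G \<omega> = E})"
  define g where "g = (\<lambda>E. \<integral>\<omega>. indicator H \<omega> * ?q E \<omega> \<partial>M)"
  have disj: "(\<Sum>E\<in>A. f E) = measure M {\<omega> \<in> H. G \<omega> \<in> A}" if A: "A \<subseteq> Pow ?X" for A
  proof -
    have finA: "finite A" using A finX by (auto intro: finite_subset)
    have "measure M (\<Union>E\<in>A. {\<omega> \<in> H. G \<omega> = E}) = (\<Sum>E\<in>A. measure M {\<omega> \<in> H. G \<omega> = E})"
    proof (rule finite_measure_finite_Union[OF finA])
      show "(\<lambda>E. {\<omega> \<in> H. G \<omega> = E}) ` A \<subseteq> events"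
      proof clarify
        fix E assume "E \<in> A"
        then have "H \<inter> {\<omega> \<in> space M. G \<omega> = E} \<in> events" using A Geq HM by blast
        moreover have "H \<inter> {\<omega> \<in> space M. G \<omega> = E} = {\<omega> \<in> H. G \<omega> = E}" using HS by auto
        ultimately show "{\<omega> \<in> H. G \<omega> = E} \<in> events" by simp
      qed
    qed (auto simp: disjoint_family_on_def)
    moreover have "(\<Union>E\<in>A. {\<omega> \<in> H. G \<omega> = E}) = {\<omega> \<in> H. G \<omega> \<in> A}" by auto
    ultimately show ?thesis by (simp add: f_def)
  qed
  \<comment> \<open>Both up-set sums equal the probability of \<open>H\<close> together with J
    \<subseteq> G: for \<open>f\<close> by disjointness, for \<open>g\<close> by averaging the
    conditional probability over \<open>H\<close>.\<close>
  have fg: "f E = g E" if "E \<subseteq> ?X" for E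
  proof (rule superset_sums_determine[OF finX _ that])
    fix J assume J: "J \<subseteq> ?X"
    let ?A = "{\<omega> \<in> space M. J \<subseteq> G \<omega>}"
    have sup1: "?A \<in> sets M"
      by (rule weighted_random_graph_superset(1)[OF \<open>prob_space M\<close> W G J])
    have sup2: "AE \<omega> in M. cond_prob M ?F ?A \<omega> = (\<Prod>e\<in>J. ?p \<omega> e)"
      by (rule weighted_random_graph_superset(2)[OF \<open>prob_space M\<close> W G J])
    have "(\<Sum>E | E \<subseteq> ?X \<and> J \<subseteq> E. f E) = measure M {\<omega> \<in> H. G \<omega> \<in> {E. E \<subseteq> ?X \<and> J \<subseteq> E}}"
      by (rule disj) auto
    also have "{\<omega> \<in> H. G \<omega> \<in> {E. E \<subseteq> ?X \<and> J \<subseteq> E}} = H \<inter> ?A" using HS GX by auto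
    also have "measure M (H \<inter> ?A) = (\<integral>\<omega>. indicator (H \<inter> ?A) \<omega> \<partial>M)"
      using sup1 HM by simp
    also have "\<dots> = (\<integral>\<omega>\<in>H. indicator ?A \<omega> \<partial>M)"
      unfolding set_lebesgue_integral_def by (rule Bochner_Integration.integral_cong) (auto simp: indicator_def)
    also have "\<dots> = (\<integral>\<omega>\<in>H. cond_prob M ?F ?A \<omega> \<partial>M)"
      unfolding cond_prob_def
      by (rule real_cond_exp_intA[OF integrable_real_indicator[OF sup1] H])
         (rule le_less_trans[OF prob_space.emeasure_le_1[OF \<open>prob_space M\<close>]], simp)
    also have "\<dots> = (\<integral>\<omega>. (\<Sum>E | E \<subseteq> ?X \<and> J \<subseteq> E. indicator H \<omega> * ?q E \<omega>) \<partial>M)"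
      unfolding set_lebesgue_integral_def
    proof (rule integral_cong_AE)
      have "real_cond_exp M ?F (indicator ?A) \<in> borel_measurable M"
        by (rule borel_measurable_cond_exp2)
      then show "(\<lambda>\<omega>. indicator H \<omega> *\<^sub>R cond_prob M ?F ?A \<omega>) \<in> borel_measurable M"
        unfolding cond_prob_def using HM by measurable
      show "(\<lambda>\<omega>. \<Sum>E | E \<subseteq> ?X \<and> J \<subseteq> E. indicator H \<omega> * ?q E \<omega>) \<in> borel_measurable M"
        using HM by (intro borel_measurable_sum borel_measurable_times qm) auto
      show "AE \<omega> in M. indicator H \<omega> *\<^sub>R cond_prob M ?F ?A \<omega> = (\<Sum>E | E \<subseteq> ?X \<and> J \<subseteq> E. indicator H \<omega> * ?q E \<omega>)"
        using sup2
      proof eventually_elim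
        case (elim \<omega>)
        then show ?case
          unfolding sum_distrib_left[symmetric] bernoulli_sum_superset[OF finX J] by simp
      qed
    qed
    also have "\<dots> = (\<Sum>E | E \<subseteq> ?X \<and> J \<subseteq> E. g E)"
      unfolding g_def by (rule Bochner_Integration.integral_sum) (use qint in auto)
    finally show "(\<Sum>E | E \<subseteq> ?X \<and> J \<subseteq> E. f E) = (\<Sum>E | E \<subseteq> ?X \<and> J \<subseteq> E. g E)" .
  qed
  have "{\<omega> \<in> H. P (G \<omega>)} = {\<omega> \<in> H. G \<omega> \<in> {E \<in> Pow ?X. P E}}" using HS GX by auto
  then have "measure M {\<omega> \<in> H. P (G \<omega>)} = (\<Sum>E | E \<in> Pow ?X \<and> P E. f E)"
    using disj[OF Collect_restrict[of "Pow ?X" P]] by simp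
  also have "\<dots> = (\<Sum>E | E \<in> Pow ?X \<and> P E. g E)" by (rule sum.cong) (auto simp: fg)
  also have "\<dots> = (\<integral>\<omega>. (\<Sum>E | E \<in> Pow ?X \<and> P E. indicator H \<omega> * ?q E \<omega>) \<partial>M)"
    unfolding g_def by (rule Bochner_Integration.integral_sum[symmetric]) (use qint in auto)
  also have "\<dots> \<le> (\<integral>\<omega>. \<theta> \<partial>M)"
  proof (rule integral_mono)
    show "integrable M (\<lambda>\<omega>. \<Sum>E | E \<in> Pow ?X \<and> P E. indicator H \<omega> * ?q E \<omega>)"
      by (rule Bochner_Integration.integrable_sum) (use qint in auto)
    fix \<omega>
    have "(\<Sum>E | E \<in> Pow ?X \<and> P E. indicator H \<omega> * ?q E \<omega>) = indicator H \<omega> * graph_prob n (\<lambda>i. W i \<omega>) P"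
      unfolding bernoulli_sum_def sum_distrib_left[symmetric]
      by (intro arg_cong[where f = "(*) (indicator H \<omega>)"] sum.mono_neutral_cong_left) (use finX in auto)
    also have "\<dots> \<le> \<theta>" using bound \<theta> by (auto simp: indicator_def)
    finally show "(\<Sum>E | E \<in> Pow ?X \<and> P E. indicator H \<omega> * ?q E \<omega>) \<le> \<theta>" .
  qed simp
  finally show ?thesis by (simp add: prob_space)
qed

section \<open>Averaging over i.i.d. weights\<close>

lemma card_eq_sum_indicator:
  "real (card {v \<in> {1..n}. c < w v}) = (\<Sum>v=1..n. indicator {c<..} (w v))" for w :: "nat \<Rightarrow> real"
proof -
  have "(\<Sum>v=1..n. indicator {c<..} (w v) :: real) = (\<Sum>v\<in>{1..n}. if c < w v then 1 else 0)"
    by (rule sum.cong) (auto simp: indicator_def)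
  also have "\<dots> = (\<Sum>v\<in>{v \<in> {1..n}. c < w v}. 1)" by (rule sum.inter_filter[symmetric]) simp
  finally show ?thesis by simp
qed

text \<open>The bad event is covered by \<open>B\<close>, where the weights are good and the
  conditional bound applies, and by exceptional events \<open>E0\<close> to \<open>E5\<close> on
  which one of the requirements on the weights may fail.\<close>

lemma (in prob_space) largest_component_iid:
  fixes X :: "nat \<Rightarrow> 'a \<Rightarrow> real"
  assumes \<gamma>: "3 < \<gamma>"
    and indep: "indep_vars (\<lambda>_. borel) X {1..}"
    and distr: "\<And>i. 1 \<le> i \<Longrightarrow> distr M borel (X i) = distr M borel (X 1)"
    and nonneg: "AE \<omega> in M. 0 \<le> X 1 \<omega>"
    and tail: "\<And>x. 0 < x \<Longrightarrow> prob {\<omega> \<in> space M. x \<le> X 1 \<omega>} \<le> C * x powr (1 - \<gamma>)"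
    and \<nu>: "\<nu> = expectation (\<lambda>\<omega>. (X 1 \<omega>)\<^sup>2)" "\<nu> < 1"
    and G: "\<And>n. 1 \<le> n \<Longrightarrow> weighted_random_graph M X n (G n)"
  shows "small_o_p M
     (\<lambda>n \<omega>. real (card (largest_component {1..n} (G n \<omega>)))
              - real (max_degree {1..n} (G n \<omega>)) / (1 - \<nu>))
     (\<lambda>n. real n powr (1 / (\<gamma> - 1)))"
proof -
  define q where "q = \<gamma> - 1"
  define \<alpha> where "\<alpha> = 1 / q"
  \<comment> \<open>Half the gap keeps 2 + \<beta> below \<gamma> - 1, so that this moment is
    finite; \<open>cube_le_truncation\<close> asks for \<beta> \<le> 1.\<close>
  define \<beta> where "\<beta> = min 1 ((\<gamma> - 3) / 2)"
  have q: "2 < q" "1 - \<gamma> = - q" using \<gamma> by (auto simp: q_def)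
  have \<beta>: "0 < \<beta>" "\<beta> \<le> 1" "2 + \<beta> < q"
  proof -
    show "0 < \<beta>" "\<beta> \<le> 1" using \<gamma> by (auto simp: \<beta>_def)
    have "\<beta> \<le> (\<gamma> - 3) / 2" unfolding \<beta>_def by (rule min.cobounded2)
    then have "2 * \<beta> \<le> \<gamma> - 3" by simp
    then show "2 + \<beta> < q" using \<gamma> unfolding q_def by linarith
  qed
  have \<alpha>: "0 < \<alpha>" "\<alpha> < 1 / 2" "\<alpha> * q = 1" using q by (auto simp: \<alpha>_def field_simps)
  have "0 \<le> prob {\<omega> \<in> space M. 1 \<le> X 1 \<omega>}" by simp
  also have "\<dots> \<le> C" using tail[of 1] by simp
  finally have C: "0 \<le> C" .
  have rv: "random_variable borel (X i)" if "1 \<le> i" for i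
    using indep that unfolding indep_vars_def by auto
  note rv1 = rv[OF order_refl]
  have nonneg_i: "AE \<omega> in M. 0 \<le> X i \<omega>" if i: "1 \<le> i" for i
  proof -
    have "AE x in distr M borel (X 1). 0 \<le> x" using rv1 nonneg by (subst AE_distr_iff) auto
    then have "AE x in distr M borel (X i). 0 \<le> x" unfolding distr[OF i] .
    then show ?thesis using rv[OF i] by (subst (asm) AE_distr_iff) auto
  qed
  have prob_i: "prob {\<omega> \<in> space M. X i \<omega> \<in> A} = prob {\<omega> \<in> space M. X 1 \<omega> \<in> A}"
    if i: "1 \<le> i" and A: "A \<in> sets borel" for i A
  proof -
    have "measure (distr M borel (X i)) A = measure (distr M borel (X 1)) A" by (simp only: distr[OF i])
    then show ?thesis
      unfolding measure_distr[OF rv[OF i] A] measure_distr[OF rv1 A] by (simp add: vimage_def Int_def conj_commute)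
  qed
  have expect_i: "integrable M (\<lambda>\<omega>. h (X i \<omega>)) \<and> expectation (\<lambda>\<omega>. h (X i \<omega>)) = expectation (\<lambda>\<omega>. h (X 1 \<omega>))"
    if i: "1 \<le> i" and h: "h \<in> borel_measurable borel" and int: "integrable M (\<lambda>\<omega>. h (X 1 \<omega>))"
    for i and h :: "real \<Rightarrow> real"
  proof
    have "integrable (distr M borel (X i)) h"
      unfolding distr[OF i] integrable_distr_eq[OF rv1 h] by (rule int)
    then show "integrable M (\<lambda>\<omega>. h (X i \<omega>))" unfolding integrable_distr_eq[OF rv[OF i] h] .
    show "expectation (\<lambda>\<omega>. h (X i \<omega>)) = expectation (\<lambda>\<omega>. h (X 1 \<omega>))"
      unfolding integral_distr[OF rv[OF i] h, symmetric] integral_distr[OF rv1 h, symmetric] distr[OF i] ..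
  qed
  have moment: "integrable M (\<lambda>\<omega>. X 1 \<omega> powr r)" if "0 < r" "r < q" for r
    using integrable_powr_if_tail[OF rv1 nonneg tail[unfolded q(2)] that] .
  have int1: "integrable M (X 1)"
  proof -
    have "integrable M (X 1) \<longleftrightarrow> integrable M (\<lambda>\<omega>. X 1 \<omega> powr 1)"
      by (rule integrable_cong_AE) (use rv1 nonneg in auto)
    then show ?thesis using moment[of 1] q by simp
  qed
  have int2: "integrable M (\<lambda>\<omega>. (X 1 \<omega>)\<^sup>2)"
  proof -
    have "integrable M (\<lambda>\<omega>. (X 1 \<omega>)\<^sup>2) \<longleftrightarrow> integrable M (\<lambda>\<omega>. X 1 \<omega> powr 2)"
      by (rule integrable_cong_AE) (use rv1 nonneg in auto)
    then show ?thesis using moment[of 2] q by simp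
  qed
  define \<mu> where "\<mu> = expectation (X 1)"
  have \<mu>: "0 \<le> \<mu>" unfolding \<mu>_def by (rule integral_nonneg_AE) (rule nonneg)
  have \<nu>0: "0 \<le> \<nu>" unfolding \<nu>(1) by simp
  interpret S: subcritical \<alpha> \<beta> \<mu> \<nu>
    by unfold_locales (use \<alpha> \<beta> \<mu> \<nu>0 \<nu>(2) in auto)
  have wlln1: "(\<lambda>n. prob {\<omega> \<in> space M. \<eta> < \<bar>(\<Sum>i=1..n. X i \<omega>) / n - \<mu>\<bar>}) \<longlonglongrightarrow> 0" if "0 < \<eta>" for \<eta>
    unfolding \<mu>_def by (rule weak_law_of_large_numbers[OF indep distr int1 that])
  have wlln2: "(\<lambda>n. prob {\<omega> \<in> space M. \<eta> < \<bar>(\<Sum>i=1..n. (X i \<omega>)\<^sup>2) / n - \<nu>\<bar>}) \<longlonglongrightarrow> 0" if "0 < \<eta>" for \<eta>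
    unfolding \<nu>(1)
  proof (rule weak_law_of_large_numbers[where X = "\<lambda>i \<omega>. (X i \<omega>)\<^sup>2", OF _ _ int2 that])
    show "indep_vars (\<lambda>_. borel) (\<lambda>i \<omega>. (X i \<omega>)\<^sup>2) {1..}"
      by (rule indep_vars_compose2[OF indep]) auto
    fix i :: nat assume i: "1 \<le> i"
    have "distr M borel (\<lambda>\<omega>. (X i \<omega>)\<^sup>2) = distr (distr M borel (X i)) borel (\<lambda>x. x\<^sup>2)"
      using rv[OF i] by (subst distr_distr) (auto simp: comp_def)
    also have "\<dots> = distr M borel (\<lambda>\<omega>. (X 1 \<omega>)\<^sup>2)"
      unfolding distr[OF i] using rv1 by (subst distr_distr) (auto simp: comp_def)
    finally show "distr M borel (\<lambda>\<omega>. (X i \<omega>)\<^sup>2) = distr M borel (\<lambda>\<omega>. (X 1 \<omega>)\<^sup>2)" .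
  qed
  \<comment> \<open>Since \<alpha> q = 1, the expected number of weights above c n^\<alpha> stays
    bounded. This bounds the maximum when c = \<open>K\<close> and the number of heavy vertices when
    c = \<delta>.\<close>
  have tail_i: "n * prob {\<omega> \<in> space M. X i \<omega> \<in> {c * n powr \<alpha>..}} \<le> C * c powr - q"
    if i: "1 \<le> i" and c: "0 < c" and n: "0 < n" for i c and n :: nat
  proof -
    have "prob {\<omega> \<in> space M. X i \<omega> \<in> {c * n powr \<alpha>..}} \<le> C * (c * n powr \<alpha>) powr - q"
      using prob_i[OF i, of "{c * n powr \<alpha>..}"] tail[of "c * n powr \<alpha>"] c n by (simp add: q(2))
    also have "(c * n powr \<alpha>) powr - q = c powr - q / n"
      using c n \<alpha>(3) by (simp add: powr_mult powr_powr powr_minus_divide)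
    finally show ?thesis using n by (simp add: field_simps)
  qed
  show ?thesis
    unfolding small_o_p_def
  proof (intro allI impI order_tendstoI)
    fix \<epsilon> \<theta> :: real assume \<epsilon>: "0 < \<epsilon>" and \<theta>: "0 < \<theta>"
    \<comment> \<open>Six events, \<open>B\<close> and \<open>E1\<close> to \<open>E5\<close>,
      receive this share each, and \<open>E0\<close> is null, so the total stays below
      \<theta>.\<close>
    define \<theta>' where "\<theta>' = \<theta> / 8"
    have \<theta>': "0 < \<theta>'" using \<theta> by (simp add: \<theta>'_def)
    let ?P = "\<lambda>n E. \<epsilon> * n powr \<alpha> < \<bar>card (largest_component {1..n} E) - max_degree {1..n} E / (1 - \<nu>)\<bar>"
    from S.largest_component_given_weights[OF \<epsilon> \<theta>'] obtain \<delta> where \<delta>: "0 < \<delta>" and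
      quenched: "\<And>K Q R. 0 < K \<Longrightarrow> 0 \<le> Q \<Longrightarrow> \<exists>\<eta>>0. \<forall>\<^sub>F n in sequentially. \<forall>w.
        S.good_weights \<eta> K Q n w \<longrightarrow> card {v \<in> {1..n}. \<delta> * n powr \<alpha> < w v} \<le> R \<longrightarrow> graph_prob n w (?P n) \<le> \<theta>'"
      by blast
    \<comment> \<open>Gives C K^(-q) = C / (C/\<theta>' + 1), which is at most \<theta>'; the added
      1 keeps \<open>K\<close> positive when C = 0.\<close>
    define K where "K = (C / \<theta>' + 1) powr (1 / q)"
    have pos: "0 < C / \<theta>' + 1" using C \<theta>' by (simp add: add_nonneg_pos)
    have K: "0 < K" using pos by (simp add: K_def)
    have CK: "C * K powr - q \<le> \<theta>'"
    proof -
      have "K powr - q = 1 / (C / \<theta>' + 1)"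
        unfolding K_def using q pos by (simp add: powr_powr powr_minus_divide)
      moreover have "C / (C / \<theta>' + 1) \<le> \<theta>'"
        using pos \<theta>' by (simp add: pos_divide_le_eq distrib_left)
      ultimately show ?thesis by simp
    qed
    define m where "m = expectation (\<lambda>\<omega>. X 1 \<omega> powr (2 + \<beta>))"
    have m: "0 \<le> m" unfolding m_def by simp
    define Q where "Q = m / \<theta>' + 1"
    have Q: "0 < Q" using m \<theta>' by (simp add: Q_def add_nonneg_pos)
    have mQ: "m / Q \<le> \<theta>'" using m \<theta>' Q by (simp add: Q_def field_simps)
    \<comment> \<open>Markov's inequality for the number of heavy vertices: the probability of
      \<open>R + 1\<close> or more is at most C \<delta>^(-q) / (R + 1).\<close>
    define R where "R = nat \<lceil>C * \<delta> powr - q / \<theta>'\<rceil>"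
    have CR: "C * \<delta> powr - q / (R + 1) \<le> \<theta>'"
    proof -
      have "C * \<delta> powr - q / \<theta>' \<le> R + 1" unfolding R_def by linarith
      then show ?thesis using \<theta>' by (simp add: field_simps)
    qed
    from quenched[OF K less_imp_le[OF Q]] obtain \<eta> where \<eta>: "0 < \<eta>" and
      ev: "\<forall>\<^sub>F n in sequentially. \<forall>w. S.good_weights \<eta> K Q n w \<longrightarrow>
        card {v \<in> {1..n}. \<delta> * n powr \<alpha> < w v} \<le> R \<longrightarrow> graph_prob n w (?P n) \<le> \<theta>'" by blast
    have ev1: "\<forall>\<^sub>F n in sequentially. prob {\<omega> \<in> space M. \<eta> < \<bar>(\<Sum>i=1..n. X i \<omega>) / n - \<mu>\<bar>} < \<theta>'"
      by (rule order_tendstoD(2)[OF wlln1[OF \<eta>] \<theta>'])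
    have ev2: "\<forall>\<^sub>F n in sequentially. prob {\<omega> \<in> space M. \<eta> < \<bar>(\<Sum>i=1..n. (X i \<omega>)\<^sup>2) / n - \<nu>\<bar>} < \<theta>'"
      by (rule order_tendstoD(2)[OF wlln2[OF \<eta>] \<theta>'])
    show "\<forall>\<^sub>F n in sequentially. prob {\<omega> \<in> space M. \<epsilon> * n powr (1 / (\<gamma> - 1)) <
        \<bar>real (card (largest_component {1..n} (G n \<omega>))) - real (max_degree {1..n} (G n \<omega>)) / (1 - \<nu>)\<bar>} < \<theta>"
      using ev ev1 ev2 eventually_gt_at_top[of 0]
    proof eventually_elim
      case (elim n)
      then have n: "0 < n" "1 \<le> n" by auto
      let ?F = "weight_algebra M X n"
      have rvn: "X i \<in> borel_measurable M" if "i \<in> {1..n}" for i using rv that by auto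
      note [measurable] = rvn
      have sub: "subalgebra M ?F" by (rule subalgebra_weight_algebra) (rule rvn)
      define H where "H = {\<omega> \<in> space M. S.good_weights \<eta> K Q n (\<lambda>i. X i \<omega>) \<and>
          card {v \<in> {1..n}. \<delta> * n powr \<alpha> < X v \<omega>} \<le> R}"
      have HF: "H \<in> sets ?F"
      proof -
        have [measurable]: "X i \<in> borel_measurable ?F" if "i \<in> {1..n}" for i
          by (rule subalgebra_weight_algebra(2)[OF _ that]) (rule rvn)
        have "H = {\<omega> \<in> space ?F. ((\<forall>i\<in>{1..n}. 0 \<le> X i \<omega> \<and> X i \<omega> \<le> K * n powr \<alpha>) \<and>
             \<bar>(\<Sum>i=1..n. X i \<omega>) / n - \<mu>\<bar> \<le> \<eta> \<and> \<bar>(\<Sum>i=1..n. (X i \<omega>)\<^sup>2) / n - \<nu>\<bar> \<le> \<eta> \<and>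
             (\<Sum>i=1..n. X i \<omega> powr (2 + \<beta>)) \<le> Q * n) \<and>
             (\<Sum>v=1..n. indicator {\<delta> * n powr \<alpha><..} (X v \<omega>)) \<le> real R}"
          unfolding H_def S.good_weights_def card_eq_sum_indicator[symmetric] of_nat_le_iff
          using sub by (simp add: subalgebra_def)
        also have "\<dots> \<in> sets ?F" by measurable
        finally show ?thesis .
      qed
      then have HM: "H \<in> events" using sub by (auto simp: subalgebra_def)
      have main: "prob {\<omega> \<in> H. ?P n (G n \<omega>)} \<le> \<theta>'"
        by (rule weighted_random_graph_bound[OF prob_space_axioms rvn _ G[OF n(2)] HF])
           (use nonneg_i elim \<theta>' in \<open>auto simp: H_def\<close>)
      define E0 where "E0 = {\<omega> \<in> space M. \<exists>i\<in>{1..n}. X i \<omega> < 0}"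
      define E1 where "E1 = (\<Union>i\<in>{1..n}. {\<omega> \<in> space M. X i \<omega> \<in> {K * n powr \<alpha>..}})"
      \<comment> \<open>Closed half-lines match the tail hypothesis; the strict count in
        \<open>H\<close> is at most this one.\<close>
      define E2 where "E2 = {\<omega> \<in> space M. real (R + 1) \<le> (\<Sum>i=1..n. indicator {\<delta> * n powr \<alpha>..} (X i \<omega>))}"
      define E3 where "E3 = {\<omega> \<in> space M. Q * n \<le> (\<Sum>i=1..n. X i \<omega> powr (2 + \<beta>))}"
      define E4 where "E4 = {\<omega> \<in> space M. \<eta> < \<bar>(\<Sum>i=1..n. X i \<omega>) / n - \<mu>\<bar>}"
      define E5 where "E5 = {\<omega> \<in> space M. \<eta> < \<bar>(\<Sum>i=1..n. (X i \<omega>)\<^sup>2) / n - \<nu>\<bar>}"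
      define B where "B = {\<omega> \<in> H. ?P n (G n \<omega>)}"
      have BM: "B \<in> events"
      proof -
        have Gm: "G n \<in> M \<rightarrow>\<^sub>M count_space (simple_graphs {1..n})"
          using G[OF n(2)] unfolding weighted_random_graph_def by auto
        have "B = H \<inter> (G n -` {E \<in> simple_graphs {1..n}. ?P n E} \<inter> space M)"
          using measurable_space[OF Gm] sets.sets_into_space[OF HM] by (auto simp: B_def)
        then show ?thesis using measurable_sets[OF Gm, of "{E \<in> simple_graphs {1..n}. ?P n E}"] HM by auto
      qed
      have E0M: "E0 \<in> events" unfolding E0_def by measurable
      have E1M: "E1 \<in> events" unfolding E1_def by (rule sets.finite_UN) (use rvn in measurable)
      have E2M: "E2 \<in> events" unfolding E2_def by measurable
      have E3M: "E3 \<in> events" unfolding E3_def by measurable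
      have E4M: "E4 \<in> events" unfolding E4_def by measurable
      have E5M: "E5 \<in> events" unfolding E5_def by measurable
      have p0: "prob E0 = 0"
      proof -
        have "AE \<omega> in M. \<forall>i\<in>{1..n}. 0 \<le> X i \<omega>"
          unfolding AE_ball_countable[OF countable_finite[OF finite_atLeastAtMost]] using nonneg_i by auto
        then have "AE \<omega> in M. \<not> (\<exists>i\<in>{1..n}. X i \<omega> < 0)"
          by eventually_elim (auto simp: not_less)
        then show ?thesis unfolding E0_def by (rule prob_Collect_eq_0[THEN iffD2, rotated]) (use E0M in \<open>simp add: E0_def\<close>)
      qed
      have p1: "prob E1 \<le> \<theta>'"
      proof -
        have "prob E1 \<le> (\<Sum>i\<in>{1..n}. prob {\<omega> \<in> space M. X i \<omega> \<in> {K * n powr \<alpha>..}})"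
          unfolding E1_def by (rule finite_measure_subadditive_finite) auto
        also have "\<dots> \<le> (\<Sum>i\<in>{1..n}. C * K powr - q / n)"
          by (rule sum_mono) (use tail_i K n in \<open>auto simp: field_simps\<close>)
        also have "\<dots> = C * K powr - q" using n by simp
        finally show ?thesis using CK by linarith
      qed
      have p2: "prob E2 \<le> \<theta>'"
      proof -
        let ?u = "\<lambda>i \<omega>. indicator {\<delta> * n powr \<alpha>..} (X i \<omega>) :: real"
        have e: "integrable M (?u i) \<and> expectation (?u i) \<le> C * \<delta> powr - q / n" if i: "i \<in> {1..n}" for i
        proof
          note [measurable] = rvn[OF i]
          show "integrable M (?u i)"
            by (rule integrable_const_bound[of _ 1]) (auto simp: indicator_def)
          have "expectation (?u i) = expectation (indicator {\<omega> \<in> space M. X i \<omega> \<in> {\<delta> * n powr \<alpha>..}})"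
            by (rule Bochner_Integration.integral_cong) (auto simp: indicator_def)
          also have "\<dots> = prob {\<omega> \<in> space M. X i \<omega> \<in> {\<delta> * n powr \<alpha>..}}" by simp
          also have "\<dots> \<le> C * \<delta> powr - q / n"
            using tail_i[of i \<delta> n] i \<delta> n by (simp add: field_simps)
          finally show "expectation (?u i) \<le> C * \<delta> powr - q / n" .
        qed
        have "prob E2 \<le> expectation (\<lambda>\<omega>. \<Sum>i=1..n. ?u i \<omega>) / real (R + 1)"
          unfolding E2_def
        proof (rule prob_Markov)
          show "integrable M (\<lambda>\<omega>. \<Sum>i=1..n. ?u i \<omega>)"
            by (rule Bochner_Integration.integrable_sum) (simp only: e)
          show "AE \<omega> in M. 0 \<le> (\<Sum>i=1..n. ?u i \<omega>)" by (intro AE_I2 sum_nonneg) simp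
        qed simp
        also have "expectation (\<lambda>\<omega>. \<Sum>i=1..n. ?u i \<omega>) = (\<Sum>i=1..n. expectation (?u i))"
          by (rule Bochner_Integration.integral_sum) (simp only: e)
        also have "(\<Sum>i=1..n. expectation (?u i)) / real (R + 1) \<le> (\<Sum>i=1..n. C * \<delta> powr - q / n) / real (R + 1)"
          by (rule divide_right_mono[OF sum_mono]) (use e in auto)
        also have "(\<Sum>i=1..n. C * \<delta> powr - q / n) = C * \<delta> powr - q" using n by simp
        finally show ?thesis using CR by linarith
      qed
      have p3: "prob E3 \<le> \<theta>'"
      proof -
        have e: "integrable M (\<lambda>\<omega>. X i \<omega> powr (2 + \<beta>)) \<and> expectation (\<lambda>\<omega>. X i \<omega> powr (2 + \<beta>)) = m" if "1 \<le> i" for i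
          unfolding m_def by (rule expect_i[OF that]) (use moment \<beta> in auto)
        have "prob E3 \<le> expectation (\<lambda>\<omega>. \<Sum>i=1..n. X i \<omega> powr (2 + \<beta>)) / (Q * n)"
          unfolding E3_def
        proof (rule prob_Markov)
          show "integrable M (\<lambda>\<omega>. \<Sum>i=1..n. X i \<omega> powr (2 + \<beta>))"
            by (rule Bochner_Integration.integrable_sum) (simp add: e)
          show "AE \<omega> in M. 0 \<le> (\<Sum>i=1..n. X i \<omega> powr (2 + \<beta>))" by (intro AE_I2 sum_nonneg) simp
        qed (use Q n in simp)
        also have "expectation (\<lambda>\<omega>. \<Sum>i=1..n. X i \<omega> powr (2 + \<beta>)) = (\<Sum>i=1..n. expectation (\<lambda>\<omega>. X i \<omega> powr (2 + \<beta>)))"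
          by (rule Bochner_Integration.integral_sum) (simp add: e)
        also have "\<dots> = (\<Sum>i=1..n. m)" by (rule sum.cong) (simp_all add: e)
        also have "\<dots> / (Q * n) = m / Q" using n by simp
        finally show ?thesis using mQ by linarith
      qed
      have p45: "prob E4 < \<theta>'" "prob E5 < \<theta>'" using elim by (simp_all add: E4_def E5_def)
      have "{\<omega> \<in> space M. ?P n (G n \<omega>)} \<subseteq> B \<union> (E0 \<union> (E1 \<union> (E2 \<union> (E3 \<union> (E4 \<union> E5)))))"
      proof
        fix \<omega> assume \<omega>: "\<omega> \<in> {\<omega> \<in> space M. ?P n (G n \<omega>)}"
        show "\<omega> \<in> B \<union> (E0 \<union> (E1 \<union> (E2 \<union> (E3 \<union> (E4 \<union> E5)))))"
        proof (rule ccontr)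
          assume no: "\<omega> \<notin> B \<union> (E0 \<union> (E1 \<union> (E2 \<union> (E3 \<union> (E4 \<union> E5)))))"
          have "real (card {v \<in> {1..n}. \<delta> * n powr \<alpha> < X v \<omega>}) \<le> (\<Sum>i=1..n. indicator {\<delta> * n powr \<alpha>..} (X i \<omega>))"
            unfolding card_eq_sum_indicator by (rule sum_mono) (auto simp: indicator_def)
          then have "card {v \<in> {1..n}. \<delta> * n powr \<alpha> < X v \<omega>} \<le> R"
            using no \<omega> by (auto simp: E2_def not_le)
          moreover have "S.good_weights \<eta> K Q n (\<lambda>i. X i \<omega>)"
            unfolding S.good_weights_def
            using no \<omega> by (auto simp: E0_def E1_def E3_def E4_def E5_def not_less not_le less_imp_le)
          ultimately have "\<omega> \<in> B" using \<omega> by (simp add: B_def H_def)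
          then show False using no by simp
        qed
      qed
      then have "prob {\<omega> \<in> space M. ?P n (G n \<omega>)} \<le> prob (B \<union> (E0 \<union> (E1 \<union> (E2 \<union> (E3 \<union> (E4 \<union> E5))))))"
        by (rule finite_measure_mono) (use BM E0M E1M E2M E3M E4M E5M in auto)
      also have "\<dots> \<le> prob B + (prob E0 + (prob E1 + (prob E2 + (prob E3 + (prob E4 + prob E5)))))"
        using BM E0M E1M E2M E3M E4M E5M
        by (intro order_trans[OF measure_Un_le] add_left_mono sets.Un) auto
      also have "\<dots> < \<theta>" using main p0 p1 p2 p3 p45 \<theta> unfolding B_def[symmetric] \<theta>'_def by linarith
      finally show ?case unfolding \<alpha>_def q_def .
    qed
  qed (rule always_eventually, rule allI, erule less_le_trans, rule measure_nonneg)
qed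

theorem corollary4p4:
  fixes \<gamma> \<nu> :: real
    and N :: "'b measure" and W :: "'b \<Rightarrow> real"
    and M :: "'a measure" and Ws :: "nat \<Rightarrow> 'a \<Rightarrow> real"
    and G :: "nat \<Rightarrow> 'a \<Rightarrow> nat set set"
  assumes "\<gamma> > 3"
    and "prob_space N"
    and "W \<in> borel_measurable N"
    and "AE x in N. W x \<ge> 0"
    and "\<exists>C. \<forall>x>0. measure N {\<omega> \<in> space N. W \<omega> \<ge> x} \<le> C * x powr (1 - \<gamma>)"
    and "\<nu> = prob_space.expectation N (\<lambda>\<omega>. (W \<omega>)\<^sup>2)"
    and "\<nu> < 1"
    and "prob_space M"
    and "prob_space.indep_vars M (\<lambda>_. borel) Ws {1..}"
    and "\<And>i. i \<ge> 1 \<Longrightarrow> distr M borel (Ws i) = distr N borel W"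
    and "\<And>n. n \<ge> 1 \<Longrightarrow> weighted_random_graph M Ws n (G n)"
  shows "small_o_p M
           (\<lambda>n \<omega>. real (card (largest_component {1..n} (G n \<omega>)))
                    - real (max_degree {1..n} (G n \<omega>)) / (1 - \<nu>))
           (\<lambda>n. real n powr (1 / (\<gamma> - 1)))"
proof -
  interpret N: prob_space N by fact
  interpret M: prob_space M by fact
  note [measurable] = assms(3)
  obtain C where C: "\<And>x. 0 < x \<Longrightarrow> measure N {\<omega> \<in> space N. x \<le> W \<omega>} \<le> C * x powr (1 - \<gamma>)"
    using assms(5) by blast
  have Ws1 [measurable]: "Ws 1 \<in> borel_measurable M"
    using assms(9) unfolding M.indep_vars_def by auto
  have distr1: "distr M borel (Ws 1) = distr N borel W" by (rule assms(10)) simp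
  show ?thesis
  \<comment> \<open>The hypotheses on \<open>W\<close> concern only its law, so they pass to
    \<open>Ws 1\<close> through \<open>distr1\<close> although the two variables live on different
    spaces.\<close>
  proof (rule M.largest_component_iid[OF assms(1,9)])
    show "distr M borel (Ws i) = distr M borel (Ws 1)" if "1 \<le> i" for i
      using assms(10)[OF that] distr1 by simp
    have "AE x in distr N borel W. 0 \<le> x" using assms(3,4) by (subst AE_distr_iff) auto
    then have "AE x in distr M borel (Ws 1). 0 \<le> x" unfolding distr1 .
    then show "AE \<omega> in M. 0 \<le> Ws 1 \<omega>" using Ws1 by (subst (asm) AE_distr_iff) auto
    show "M.prob {\<omega> \<in> space M. x \<le> Ws 1 \<omega>} \<le> C * x powr (1 - \<gamma>)" if "0 < x" for x
    proof -
      have "measure (distr M borel (Ws 1)) {x..} = measure (distr N borel W) {x..}" by (simp only: distr1)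
      then have "M.prob {\<omega> \<in> space M. x \<le> Ws 1 \<omega>} = measure N {\<omega> \<in> space N. x \<le> W \<omega>}"
        unfolding measure_distr[OF Ws1 atLeast_borel] measure_distr[OF assms(3) atLeast_borel]
        by (simp add: vimage_def Int_def conj_commute)
      then show ?thesis using C[OF that] by simp
    qed
    have sq: "(\<lambda>x :: real. x\<^sup>2) \<in> borel_measurable borel" by measurable
    show "\<nu> = M.expectation (\<lambda>\<omega>. (Ws 1 \<omega>)\<^sup>2)"
      unfolding assms(6) integral_distr[OF assms(3) sq, symmetric] integral_distr[OF Ws1 sq, symmetric] distr1 ..
  qed (use assms(7,11) in auto)
qed

end
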